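(* The decision problem ConsComp is NP-complete, where ConsComp is the following problem. Instance: a finite family (repetitions allowed) $e_1, e_2, \ldots, e_k$ of integers such that $e_1 + e_2 + \cdots + e_k = 0$, and an integer $C > 0$. Question: is there a permutation $\pi \in S_k$ such that for all $i \in \{1, 2, \ldots, k\}$ $$0 \le \sum_{j=1}^{i} e_{\pi(j)} \le C\,?$$ That is, ConsComp belongs to NP and every problem in NP is polynomial-time many-one reducible to ConsComp.
   Context: $S_k$ denotes the symmetric group on $\{1, \ldots, k\}$. Integers in instances are encoded in binary in the usual way, and polynomial time is measured with respect to the length of this encoding. NP, polynomial-time many-one (Karp) reductions and NP-completeness have their standard meaning. *)

theory Defs
  imports "HOL-Computational_Algebra.Polynomial" "HOL-Combinatorics.Permutations"
begin

text \<open>Deterministic multi-tape Turing machines with two-way infinite tapes.  States and tape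
  symbols are initial segments of the natural numbers.  Symbol 0 is the blank, symbols 1 and 2
  are the input bits; further symbols are available for internal use.\<close>

datatype move = MoveLeft | Stay | MoveRight

record tm =
  tapes :: nat
  symbols :: nat
  states :: nat
  start :: nat
  accept :: nat
  reject :: nat
  delta :: "nat \<Rightarrow> nat list \<Rightarrow> nat \<times> (nat \<times> move) list"

definition wf_tm :: "tm \<Rightarrow> bool" where
  "wf_tm M \<longleftrightarrow>
     tapes M \<ge> 1 \<and> symbols M \<ge> 3 \<and>
     start M < states M \<and> accept M < states M \<and> reject M < states M \<and> accept M \<noteq> reject M \<and>
     (\<forall>q < states M. \<forall>as. length as = tapes M \<and> set as \<subseteq> {..<symbols M} \<longrightarrow>
        (case delta M q as of (q', acts) \<Rightarrow>
           q' < states M \<and> length acts = tapes M \<and> (\<forall>(b, m) \<in> set acts. b < symbols M)))"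

text \<open>A tape is its contents together with the position of the head.\<close>

type_synonym tape = "(int \<Rightarrow> nat) \<times> int"
type_synonym config = "nat \<times> tape list"

fun read :: "tape \<Rightarrow> nat" where
  "read (c, h) = c h"

fun displacement :: "move \<Rightarrow> int" where
  "displacement MoveLeft = - 1"
| "displacement Stay = 0"
| "displacement MoveRight = 1"

fun act :: "nat \<times> move \<Rightarrow> tape \<Rightarrow> tape" where
  "act (b, m) (c, h) = (c(h := b), h + displacement m)"

definition halted :: "tm \<Rightarrow> config \<Rightarrow> bool" where
  "halted M cfg \<longleftrightarrow> fst cfg \<in> {accept M, reject M}"

text \<open>Halted configurations are fixed points, so being halted after exactly \<open>t\<close> steps means
  halting within \<open>t\<close> steps.\<close>

definition step :: "tm \<Rightarrow> config \<Rightarrow> config" where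
  "step M cfg =
     (if halted M cfg then cfg
      else case delta M (fst cfg) (map read (snd cfg)) of
        (q', acts) \<Rightarrow> (q', map2 act acts (snd cfg)))"

definition contents :: "bool list \<Rightarrow> int \<Rightarrow> nat" where
  "contents w i =
     (if 0 \<le> i \<and> i < int (length w) then (if w ! nat i then 2 else 1) else 0)"

text \<open>A machine with several arguments receives the \<open>i\<close>-th one on its \<open>i\<close>-th tape; the
  remaining tapes are blank.\<close>

definition init :: "tm \<Rightarrow> bool list list \<Rightarrow> config" where
  "init M ws =
     (start M, map (\<lambda>i. (contents (if i < length ws then ws ! i else []), 0)) [0..<tapes M])"

definition run :: "tm \<Rightarrow> bool list list \<Rightarrow> nat \<Rightarrow> config" where
  "run M ws t = (step M ^^ t) (init M ws)"

definition input_size :: "bool list list \<Rightarrow> nat" where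
  "input_size ws = sum_list (map length ws)"

text \<open>\<open>n\<close> is the number of arguments.\<close>

definition poly_time :: "tm \<Rightarrow> nat \<Rightarrow> bool" where
  "poly_time M n \<longleftrightarrow>
     (\<exists>p :: nat poly. \<forall>ws. length ws = n \<longrightarrow> halted M (run M ws (poly p (input_size ws))))"

definition accepts :: "tm \<Rightarrow> bool list list \<Rightarrow> bool" where
  "accepts M ws \<longleftrightarrow> (\<exists>t. fst (run M ws t) = accept M)"

text \<open>The output is the contents of tape 1, which is initially blank.\<close>

definition outputs :: "tm \<Rightarrow> bool list list \<Rightarrow> bool list \<Rightarrow> bool" where
  "outputs M ws y \<longleftrightarrow> (\<exists>t. halted M (run M ws t) \<and> fst (snd (run M ws t) ! 1) = contents y)"

definition poly_time_computable :: "(bool list \<Rightarrow> bool list) \<Rightarrow> bool" where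
  "poly_time_computable f \<longleftrightarrow>
     (\<exists>M. wf_tm M \<and> tapes M \<ge> 2 \<and> poly_time M 1 \<and> (\<forall>x. outputs M [x] (f x)))"

text \<open>NP in its certificate formulation: \<open>M\<close> is a polynomial-time verifier with the arguments
  \<open>x\<close> (the input) and \<open>u\<close> (the certificate).\<close>

definition NP :: "bool list set set" where
  "NP = {L. \<exists>M. \<exists>q :: nat poly. wf_tm M \<and> tapes M \<ge> 2 \<and> poly_time M 2 \<and>
     (\<forall>x. x \<in> L \<longleftrightarrow> (\<exists>u. length u \<le> poly q (length x) \<and> accepts M [x, u]))}"

definition karp_reducible :: "bool list set \<Rightarrow> bool list set \<Rightarrow> bool"  (infix "\<le>\<^sub>p" 50) where
  "A \<le>\<^sub>p B \<longleftrightarrow> (\<exists>f. poly_time_computable f \<and> (\<forall>x. x \<in> A \<longleftrightarrow> f x \<in> B))"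

definition NP_complete :: "bool list set \<Rightarrow> bool" where
  "NP_complete L \<longleftrightarrow> L \<in> NP \<and> (\<forall>A \<in> NP. A \<le>\<^sub>p L)"

text \<open>Instances are written over the alphabet consisting of the binary digits, a minus sign and
  a comma that terminates each integer; every character is then coded by two bits.\<close>

datatype char4 = Digit bool | Minus | Comma

fun char_code :: "char4 \<Rightarrow> bool list" where
  "char_code (Digit b) = [False, b]"
| "char_code Minus = [True, False]"
| "char_code Comma = [True, True]"

text \<open>Most significant bit first, without leading zeros; 0 is written as the single digit 0.\<close>

fun binary :: "nat \<Rightarrow> bool list" where
  "binary n = (if n < 2 then [n = 1] else binary (n div 2) @ [odd n])"

declare binary.simps [simp del]

definition int_chars :: "int \<Rightarrow> char4 list" where
  "int_chars z = (if z < 0 then [Minus] else []) @ map Digit (binary (nat \<bar>z\<bar>)) @ [Comma]"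

definition encode_ints :: "int list \<Rightarrow> bool list" where
  "encode_ints zs = concat (map char_code (concat (map int_chars zs)))"

definition conscomp_instance :: "int list \<Rightarrow> int \<Rightarrow> bool" where
  "conscomp_instance es C \<longleftrightarrow> sum_list es = 0 \<and> C > 0"

text \<open>List positions, and with them the permutation, are counted from 0.\<close>

definition conscomp_solvable :: "int list \<Rightarrow> int \<Rightarrow> bool" where
  "conscomp_solvable es C \<longleftrightarrow>
     (\<exists>\<pi>. \<pi> permutes {..<length es} \<and>
       (\<forall>i < length es. 0 \<le> (\<Sum>j\<le>i. es ! \<pi> j) \<and> (\<Sum>j\<le>i. es ! \<pi> j) \<le> C))"

text \<open>The language of encoded yes-instances, the bound \<open>C\<close> being written first.\<close>

definition ConsComp :: "bool list set" where
  "ConsComp = {encode_ints (C # es) | C es. conscomp_instance es C \<and> conscomp_solvable es C}"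

lemma binary_inj: "binary m = binary n \<Longrightarrow> m = n"
proof (induction m arbitrary: n rule: binary.induct)
  case (1 m)
  have ne: "binary k \<noteq> []" for k by (subst binary.simps) auto
  show ?case
  proof (cases "m < 2 \<or> n < 2")
    case True
    then show ?thesis
      using "1.prems" ne[of "m div 2"] ne[of "n div 2"]
      by (subst (asm) (1 2) binary.simps) (auto split: if_splits)
  next
    case False
    then have "binary (m div 2) @ [odd m] = binary (n div 2) @ [odd n]"
      using "1.prems" by (metis binary.simps)
    then have "m div 2 = n div 2" "odd m = odd n"
      using "1.IH" False by auto
    then show ?thesis
      by (metis div_mult_mod_eq odd_iff_mod_2_eq_one parity_cases)
  qed
qed

lemma char_codes_inj:
  "concat (map char_code xs) = concat (map char_code ys) \<Longrightarrow> xs = ys"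
proof (induction xs arbitrary: ys)
  case Nil
  then show ?case by (cases ys) (auto elim: char_code.elims)
next
  case (Cons x xs)
  then show ?case by (cases ys; cases x; cases "hd ys") auto
qed

lemma int_chars_prefix_free:
  assumes "int_chars y @ xs = int_chars z @ ys"
  shows "y = z \<and> xs = ys"
proof -
  have sep: "a = b \<and> r = s"
    if "map Digit a @ Comma # r = map Digit b @ Comma # s" for a b :: "bool list" and r s
    using that
  proof (induction a arbitrary: b)
    case Nil
    then show ?case by (cases b) auto
  next
    case (Cons c a)
    then show ?case by (cases b) auto
  qed
  have ne: "binary k \<noteq> []" for k by (subst binary.simps) auto
  have sign: "(y < 0) = (z < 0)"
    using assms ne[of "nat \<bar>y\<bar>"] ne[of "nat \<bar>z\<bar>"]
    by (auto simp: int_chars_def neq_Nil_conv split: if_splits)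
  then have "map Digit (binary (nat \<bar>y\<bar>)) @ Comma # xs = map Digit (binary (nat \<bar>z\<bar>)) @ Comma # ys"
    using assms by (auto simp: int_chars_def split: if_splits)
  from sep[OF this] have "nat \<bar>y\<bar> = nat \<bar>z\<bar>" "xs = ys"
    using binary_inj by auto
  then show ?thesis using sign by linarith
qed

lemma encode_ints_inj: "encode_ints xs = encode_ints ys \<Longrightarrow> xs = ys"
proof -
  assume "encode_ints xs = encode_ints ys"
  then have "concat (map int_chars xs) = concat (map int_chars ys)"
    unfolding encode_ints_def by (rule char_codes_inj)
  then show "xs = ys"
  proof (induction xs arbitrary: ys)
    case Nil
    then show ?case by (cases ys) (auto simp: int_chars_def)
  next
    case (Cons x xs)
    then obtain y ys' where "ys = y # ys'"
      by (cases ys) (auto simp: int_chars_def)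
    then show ?case using Cons int_chars_prefix_free by fastforce
  qed
qed

lemma encode_ints_in_ConsComp:
  "encode_ints (C # es) \<in> ConsComp \<longleftrightarrow> conscomp_instance es C \<and> conscomp_solvable es C"
  using encode_ints_inj by (fastforce simp: ConsComp_def)

end

theory Submission
  imports Defs "HOL-Library.Countable"
begin

text \<open>Hardness.  A run of a verifier on an input \<open>x\<close> and a guessed certificate is written row by row
  as one word \<open>w\<close> in which every letter is related to its two neighbours and to the letter \<open>W\<close>
  places later.  Such a word is a tiling of a helical grid with finitely many tiles, and tilings are
  the solutions of a subset sum problem: the item for tile \<open>\<tau>\<close> at place \<open>p\<close> is a number of the form
  \<open>\<beta>\<^sup>p * (a + b * \<beta> + c * \<beta>\<^sup>W)\<close> with constants \<open>a\<close>, \<open>b\<close>, \<open>c\<close> depending on \<open>\<tau>\<close> only, so that the digits of the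
  sum check each place and each edge separately, and printing the items takes only nested loops.
  A subset with sum \<open>T\<close> of items with total \<open>S\<close> is found by
  ConsComp on the items together with \<open>Z - T\<close>, \<open>Z - S + T\<close>, \<open>- Z\<close>, \<open>- Z\<close> and the bound \<open>Z\<close>, as
  \<open>- Z\<close> is only applicable at the partial sum \<open>Z\<close>.

  Membership.  The certificate tells how to take the integers one by one out of a queue; the verifier
  keeps the partial sum \<open>\<sigma>\<close> and \<open>C - \<sigma>\<close> in binary, neither of which may become negative.

  Both machines are obtained from structured programs on stacks, whose loops run through a
  stack and are polynomially bounded by a syntactic credit discipline.\<close>

section \<open>Stack programs\<close>

text \<open>A fixed tile set suffices because the tapes of the verifier interact only through the
  symbols under their heads: each cell carries a guess of these symbols, equality with the left
  neighbour makes it common to the row, and every cell holding a head checks its entry. On the helix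
  every cell has a single index \<open>p\<close>, so an item is one fixed bit pattern shifted by
  \<open>p\<close> positions, in which only the distance \<open>W\<close> depends on the input. The
  number \<open>e\<close> of bits per digit depends on the verifier alone and is so large that even
  the sum of all items does not carry. Hence equality of sums is equality of digits, and every block
  of digits is a constant of the printing program. The numbers \<open>Z\<close>,
  \<open>Z - T\<close> and \<open>Z - S + T\<close> get a leading 1 and digits offset by a common
  bound, so that they too are printed digit by digit, without arithmetic. The number
  \<open>- Z\<close> occurs twice because the complement of the chosen subset has to be used up as
  well.\<close>

datatype com =
    Skip
  | Push nat nat
  | Pop nat
  | Seq com com  (infixr ";;" 60)
  | Case nat "nat \<Rightarrow> com"
  | For nat "nat \<Rightarrow> com"

type_synonym store = "nat \<Rightarrow> nat list"

text \<open>The value 0 for the empty stack is the blank that the compiled machine reads there.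
  Stored symbols are positive, so 0 tests for emptiness.\<close>

definition peek :: "nat list \<Rightarrow> nat" where
  "peek xs = (case xs of [] \<Rightarrow> 0 | x # _ \<Rightarrow> x)"

lemma peek_simps [simp]: "peek [] = 0" "peek (x # xs) = x"
  by (simp_all add: peek_def)

primrec sem :: "com \<Rightarrow> store \<Rightarrow> store" where
  "sem Skip s = s"
| "sem (Push i a) s = s(i := a # s i)"
| "sem (Pop i) s = s(i := tl (s i))"
| "sem (c ;; d) s = sem d (sem c s)"
| "sem (Case i f) s = sem (f (peek (s i))) s"
| "sem (For i f) s = fold (\<lambda>a. sem (f a)) (s i) (s(i := []))"

text \<open>Unlike \<open>sem\<close>, the operational semantics keeps the unread part of the loop stack in the store
  during an iteration; the two agree when the body does not mention that stack.\<close>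

inductive exec :: "com \<Rightarrow> store \<Rightarrow> nat \<Rightarrow> store \<Rightarrow> bool" where
  exec_Skip: "exec Skip s 1 s"
| exec_Push: "exec (Push i a) s 2 (s(i := a # s i))"
| exec_Pop: "exec (Pop i) s 1 (s(i := tl (s i)))"
| exec_Seq: "exec c s m s1 \<Longrightarrow> exec d s1 n s2 \<Longrightarrow> exec (c ;; d) s (Suc (m + n)) s2"
| exec_Case: "exec (f (peek (s i))) s n s1 \<Longrightarrow> exec (Case i f) s (Suc n) s1"
| exec_For_Nil: "s i = [] \<Longrightarrow> exec (For i f) s 1 s"
| exec_For_Cons: "s i = a # xs \<Longrightarrow> exec (f a) (s(i := xs)) m s1 \<Longrightarrow> exec (For i f) s1 n s2 \<Longrightarrow>
    exec (For i f) s (Suc (m + n)) s2"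

text \<open>\<open>Case\<close> has to provide for the value 0 because the stack may be empty,
  whereas a loop body only receives stored symbols.\<close>

primrec wfc :: "nat \<Rightarrow> nat \<Rightarrow> com \<Rightarrow> bool" where
  "wfc k S Skip = True"
| "wfc k S (Push i a) = (i < k \<and> 0 < a \<and> a < S)"
| "wfc k S (Pop i) = (i < k)"
| "wfc k S (c ;; d) = (wfc k S c \<and> wfc k S d)"
| "wfc k S (Case i f) = (i < k \<and> (\<forall>a < S. wfc k S (f a)))"
| "wfc k S (For i f) = (i < k \<and> (\<forall>a < S. 0 < a \<longrightarrow> wfc k S (f a)))"

primrec fresh :: "nat \<Rightarrow> com \<Rightarrow> bool" where
  "fresh i Skip = True"
| "fresh i (Push j a) = (i \<noteq> j)"
| "fresh i (Pop j) = (i \<noteq> j)"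
| "fresh i (c ;; d) = (fresh i c \<and> fresh i d)"
| "fresh i (Case j f) = (i \<noteq> j \<and> (\<forall>a. fresh i (f a)))"
| "fresh i (For j f) = (i \<noteq> j \<and> (\<forall>a. fresh i (f a)))"

text \<open>A frame rule. Through it the unread rest of a loop stack, which \<open>exec\<close>
  keeps in the store and \<open>sem\<close> removes, can be pulled out of the loop body.\<close>

lemma sem_fresh: "fresh i c \<Longrightarrow> sem c (s(i := v)) = (sem c s)(i := v)"
proof (induction c arbitrary: s)
  case (For j f)
  have *: "fold (\<lambda>a. sem (f a)) xs (s(i := v)) = (fold (\<lambda>a. sem (f a)) xs s)(i := v)" for xs s
    using For by (induction xs arbitrary: s) auto
  from For.prems have "(s(i := v))(j := []) = (s(j := []))(i := v)" "(s(i := v)) j = s j"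
    by (auto simp: fun_upd_twist)
  then show ?case by (simp only: sem.simps *)
qed (auto simp: fun_upd_twist)

lemma sem_fresh_at: "fresh i c \<Longrightarrow> sem c s i = s i"
  by (metis fun_upd_same fun_upd_triv sem_fresh)

definition wf_store :: "nat \<Rightarrow> store \<Rightarrow> bool" where
  "wf_store S s \<longleftrightarrow> (\<forall>i. set (s i) \<subseteq> {0<..<S})"

lemma wf_store_peek: "wf_store S s \<Longrightarrow> 0 < S \<Longrightarrow> peek (s i) < S"
  by (cases "s i") (auto simp: wf_store_def dest!: spec[of _ i])

lemma wf_store_upd: "wf_store S s \<Longrightarrow> set xs \<subseteq> {0<..<S} \<Longrightarrow> wf_store S (s(i := xs))"
  by (auto simp: wf_store_def)

lemma wf_store_sem: "wfc k S c \<Longrightarrow> 0 < S \<Longrightarrow> wf_store S s \<Longrightarrow> wf_store S (sem c s)"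
proof (induction c arbitrary: s)
  case (Pop i)
  then have "set (tl (s i)) \<subseteq> {0<..<S}"
    unfolding wf_store_def by (metis list.sel(2) list.set_sel(2) subsetD subsetI)
  then have "wf_store S (sem (Pop i) s)" using wf_store_upd[OF Pop.prems(3)] by simp
  then show ?case .
next
  case (Case i f)
  then show ?case by (simp add: wf_store_peek)
next
  case (For i f)
  have *: "wf_store S (fold (\<lambda>a. sem (f a)) xs s)" if "set xs \<subseteq> {0<..<S}" "wf_store S s" for xs s
    using that For by (induction xs arbitrary: s) auto
  have "wf_store S (s(i := []))" "set (s i) \<subseteq> {0<..<S}"
    using For.prems(3) by (auto simp: wf_store_def)
  then show ?case using * by (simp only: sem.simps)
qed (auto simp: wf_store_def)

definition vol :: "nat set \<Rightarrow> store \<Rightarrow> nat" where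
  "vol K s = (\<Sum>i\<in>K. length (s i))"

lemma vol_upd: "finite K \<Longrightarrow> i \<in> K \<Longrightarrow> vol K (s(i := xs)) + length (s i) = vol K s + length xs"
  by (simp add: vol_def sum.remove)

lemma vol_upd_notin: "i \<notin> K \<Longrightarrow> vol K (s(i := xs)) = vol K s"
  by (auto simp: vol_def intro!: sum.cong)

lemma vol_ge: "finite K \<Longrightarrow> i \<in> K \<Longrightarrow> length (s i) \<le> vol K s"
  unfolding vol_def by (rule member_le_sum) auto

text \<open>Only a push enlarges a stack, by one symbol. Running time therefore bounds growth even
  where no credit is kept, which is what \<open>ptime_Seq\<close> relies on.\<close>

lemma vol_exec: "exec c s n s' \<Longrightarrow> finite K \<Longrightarrow> vol K s' \<le> vol K s + n"
proof (induction rule: exec.induct)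
  case (exec_Push i a s)
  then show ?case
    using vol_upd[of K i s "a # s i"] vol_upd_notin[of i K s "a # s i"]
    by (cases "i \<in> K") (simp_all add: fun_upd_def)
next
  case (exec_Pop i s)
  then show ?case
    using vol_upd[of K i s "tl (s i)"] vol_upd_notin[of i K s "tl (s i)"]
    by (cases "i \<in> K") (simp_all add: fun_upd_def)
next
  case (exec_For_Cons s i a xs f m s1 n s2)
  then show ?case
    using vol_upd[of K i s xs] vol_upd_notin[of i K s xs]
    by (cases "i \<in> K") (simp_all add: fun_upd_def)
qed auto

text \<open>The credit discipline behind polynomial running time: \<open>K\<close> contains the stacks driving the
  loops, and \<open>g\<close> bounds the growth of their total size.  An iteration consumes one symbol of its
  loop stack and may therefore add one symbol elsewhere, so loops never enlarge the stacks in
  \<open>K\<close>; the stacks outside \<open>K\<close> may grow freely.\<close>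

primrec tame :: "nat set \<Rightarrow> com \<Rightarrow> nat \<Rightarrow> bool" where
  "tame K Skip g = True"
| "tame K (Push i a) g = (i \<in> K \<longrightarrow> 0 < g)"
| "tame K (Pop i) g = True"
| "tame K (c ;; d) g = (tame K c g \<and> tame K d 0 \<or> tame K c 0 \<and> tame K d g)"
| "tame K (Case i f) g = (\<forall>a. tame K (f a) g)"
| "tame K (For i f) g = (i \<in> K \<and> (\<forall>a. fresh i (f a) \<and> tame K (f a) 1))"

lemma poly_nat_mono:
  fixes p :: "nat poly"
  assumes "x \<le> y"
  shows "poly p x \<le> poly p y"
  using assms by (induction p) (auto intro!: mult_le_mono)

lemma poly_nat_bound_sum:
  fixes p :: "'a \<Rightarrow> nat poly"
  assumes "finite A" "a \<in> A"
  shows "poly (p a) x \<le> poly (\<Sum>a\<in>A. p a) x"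
  unfolding poly_sum using assms by (intro member_le_sum) auto

text \<open>A tame loop leaves the volume of \<open>K\<close> no larger than before. Nested loops
  hence see stacks of bounded volume, and a loop costs about that volume times the bound for its
  body.\<close>

lemma tame_exec:
  assumes "finite K" "0 < S"
  shows "tame K c g \<Longrightarrow> wfc k S c \<Longrightarrow> \<exists>p :: nat poly. \<forall>s. wf_store S s \<longrightarrow>
    (\<exists>n \<le> poly p (vol K s). exec c s n (sem c s) \<and> vol K (sem c s) \<le> vol K s + g)"
proof (induction c arbitrary: g)
  case Skip
  show ?case by (rule exI[of _ "[:1:]"]) (auto intro!: exI[of _ 1] exec_Skip[simplified])
next
  case (Push i a)
  have "vol K (s(i := a # s i)) \<le> vol K s + g" for s
    using Push.prems vol_upd[of K i s "a # s i"] vol_upd_notin[of i K s "a # s i"] assms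
    by (cases "i \<in> K") auto
  then have "2 \<le> poly [:2:] (vol K s) \<and> exec (Push i a) s 2 (sem (Push i a) s) \<and>
    vol K (sem (Push i a) s) \<le> vol K s + g" for s
    using exec_Push[of i a s] by simp
  then show ?case by (intro exI[of _ "[:2:]"] allI impI) (rule exI)
next
  case (Pop i)
  have "vol K (s(i := tl (s i))) \<le> vol K s + g" for s
    using vol_upd[of K i s "tl (s i)"] vol_upd_notin[of i K s "tl (s i)"] assms
    by (cases "i \<in> K") auto
  then have "1 \<le> poly [:1:] (vol K s) \<and> exec (Pop i) s 1 (sem (Pop i) s) \<and>
    vol K (sem (Pop i) s) \<le> vol K s + g" for s
    using exec_Pop[of i s] by simp
  then show ?case by (intro exI[of _ "[:1:]"] allI impI) (rule exI)
next
  case (Seq c d)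
  obtain g1 g2 where g: "g1 + g2 = g" "tame K c g1" "tame K d g2"
    using Seq.prems(1) by (metis add.right_neutral add_0 tame.simps(4))
  obtain p where p: "\<And>s. wf_store S s \<Longrightarrow>
    \<exists>n \<le> poly p (vol K s). exec c s n (sem c s) \<and> vol K (sem c s) \<le> vol K s + g1"
    using Seq.IH(1)[OF g(2)] Seq.prems by auto
  obtain q where q: "\<And>s. wf_store S s \<Longrightarrow>
    \<exists>n \<le> poly q (vol K s). exec d s n (sem d s) \<and> vol K (sem d s) \<le> vol K s + g2"
    using Seq.IH(2)[OF g(3)] Seq.prems by auto
  show ?case
  proof (rule exI, intro allI impI)
    fix s assume s: "wf_store S s"
    obtain n where n: "n \<le> poly p (vol K s)" "exec c s n (sem c s)" "vol K (sem c s) \<le> vol K s + g1"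
      using p[OF s] by auto
    have "wf_store S (sem c s)" using wf_store_sem s Seq.prems assms by auto
    from q[OF this] obtain m where m: "m \<le> poly q (vol K (sem c s))"
      "exec d (sem c s) m (sem d (sem c s))" "vol K (sem d (sem c s)) \<le> vol K (sem c s) + g2"
      by auto
    have "m \<le> poly q (vol K s + g1)" using m(1) poly_nat_mono[OF n(3)] le_trans by blast
    then show "\<exists>n \<le> poly (1 + p + pcompose q [:g1, 1:]) (vol K s).
        exec (c ;; d) s n (sem (c ;; d) s) \<and> vol K (sem (c ;; d) s) \<le> vol K s + g"
      using n m g(1) exec_Seq[OF n(2) m(2)]
      by (intro exI[of _ "Suc (n + m)"]) (auto simp: poly_pcompose add.commute[of g1])
  qed
next
  case (Case i f)
  have "\<forall>a. \<exists>p. a < S \<longrightarrow> (\<forall>s. wf_store S s \<longrightarrow>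
    (\<exists>n \<le> poly p (vol K s). exec (f a) s n (sem (f a) s) \<and> vol K (sem (f a) s) \<le> vol K s + g))"
    using Case by (metis (no_types, lifting) rangeI tame.simps(5) wfc.simps(5))
  then obtain p where p: "\<And>a s. a < S \<Longrightarrow> wf_store S s \<Longrightarrow>
     \<exists>n \<le> poly (p a) (vol K s). exec (f a) s n (sem (f a) s) \<and> vol K (sem (f a) s) \<le> vol K s + g"
    by metis
  show ?case
  proof (rule exI, intro allI impI)
    fix s assume s: "wf_store S s"
    define a where "a = peek (s i)"
    have a: "a < S" unfolding a_def using wf_store_peek s assms by auto
    obtain n where n: "n \<le> poly (p a) (vol K s)" "exec (f a) s n (sem (f a) s)"
      "vol K (sem (f a) s) \<le> vol K s + g"
      using p[OF a s] by auto
    have "n \<le> poly (\<Sum>a<S. p a) (vol K s)"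
      using n(1) poly_nat_bound_sum[of "{..<S}" a p "vol K s"] a by auto
    then show "\<exists>n \<le> poly (1 + (\<Sum>a<S. p a)) (vol K s).
        exec (Case i f) s n (sem (Case i f) s) \<and> vol K (sem (Case i f) s) \<le> vol K s + g"
      using n by (intro exI[of _ "Suc n"]) (auto simp: a_def intro: exec.intros)
  qed
next
  case (For i f)
  have i: "i \<in> K" and fr: "\<And>a. fresh i (f a)" using For.prems by auto
  have "\<forall>a. \<exists>p. 0 < a \<and> a < S \<longrightarrow> (\<forall>s. wf_store S s \<longrightarrow>
    (\<exists>n \<le> poly p (vol K s). exec (f a) s n (sem (f a) s) \<and> vol K (sem (f a) s) \<le> vol K s + 1))"
    using For by (metis (no_types, lifting) rangeI tame.simps(6) wfc.simps(6))
  then obtain p where p: "\<And>a s. 0 < a \<Longrightarrow> a < S \<Longrightarrow> wf_store S s \<Longrightarrow>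
     \<exists>n \<le> poly (p a) (vol K s). exec (f a) s n (sem (f a) s) \<and> vol K (sem (f a) s) \<le> vol K s + 1"
    by metis
  define q where "q = (\<Sum>a<S. p a)"
  \<comment> \<open>The symbol removed before an iteration pays for the growth of the body by at
    most one, so one \<open>v\<close> bounds the volume before every iteration.\<close>
  have *: "\<exists>n \<le> 1 + length xs * (1 + poly q v). exec (For i f) s n (fold (\<lambda>a. sem (f a)) xs (s(i := [])))
        \<and> vol K (fold (\<lambda>a. sem (f a)) xs (s(i := []))) \<le> vol K s"
    if "s i = xs" "wf_store S s" "vol K s \<le> v" for xs s v
    using that
  proof (induction xs arbitrary: s)
    case Nil
    then show ?case
      using exec_For_Nil[of s i f] by (intro exI[of _ 1]) (auto simp: fun_upd_idem)
  next
    case (Cons a xs)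
    then have a: "0 < a" "a < S" by (auto simp: wf_store_def dest!: spec[of _ i])
    have w: "wf_store S (s(i := xs))"
      using Cons.prems(1,2) by (auto simp: wf_store_def) (metis greaterThanLessThan_iff list.set_intros(2) subsetD)+
    have v1: "vol K (s(i := xs)) + 1 = vol K s"
      using vol_upd[of K i s xs] Cons.prems assms i by auto
    define s1 where "s1 = sem (f a) (s(i := xs))"
    have s1: "s1 = (sem (f a) (s(i := [])))(i := xs)"
      unfolding s1_def by (metis fr fun_upd_upd sem_fresh)
    obtain n where n: "n \<le> poly (p a) (vol K (s(i := xs)))" "exec (f a) (s(i := xs)) n s1"
      "vol K s1 \<le> vol K (s(i := xs)) + 1"
      using p[OF a w] unfolding s1_def by auto
    have n': "n \<le> poly q v"
      using n(1) poly_nat_bound_sum[of "{..<S}" a p v] a Cons.prems(3) v1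
        poly_nat_mono[of "vol K (s(i := xs))" v "p a"] unfolding q_def by auto
    have "wf_store S s1" unfolding s1_def using wf_store_sem w a For.prems assms by auto
    moreover have "s1 i = xs" using s1 by simp
    moreover have v2: "vol K s1 \<le> v" using n(3) v1 Cons.prems by simp
    ultimately obtain m where m: "m \<le> 1 + length xs * (1 + poly q v)"
      "exec (For i f) s1 m (fold (\<lambda>a. sem (f a)) xs (s1(i := [])))"
      "vol K (fold (\<lambda>a. sem (f a)) xs (s1(i := []))) \<le> vol K s1"
      using Cons.IH by blast
    have e: "fold (\<lambda>a. sem (f a)) (a # xs) (s(i := [])) = fold (\<lambda>a. sem (f a)) xs (s1(i := []))"
      using s1 by (simp add: fun_upd_idem sem_fresh_at[OF fr])
    show ?case
      unfolding e
      using exec_For_Cons[OF Cons.prems(1) n(2) m(2)] m n' n(3) v1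
      by (intro exI[of _ "Suc (n + m)"]) auto
  qed
  show ?case
  proof (rule exI, intro allI impI)
    fix s assume s: "wf_store S s"
    obtain n where n: "n \<le> 1 + length (s i) * (1 + poly q (vol K s))"
      "exec (For i f) s n (sem (For i f) s)" "vol K (sem (For i f) s) \<le> vol K s"
      using *[OF refl s, of "vol K s"] by auto
    have "n \<le> 1 + vol K s * (1 + poly q (vol K s))"
      using n(1) mult_le_mono1[OF vol_ge[OF assms(1) i, of s], of "1 + poly q (vol K s)"] by linarith
    then show "\<exists>n \<le> poly ([:1:] + [:0, 1:] * (1 + q)) (vol K s).
        exec (For i f) s n (sem (For i f) s) \<and> vol K (sem (For i f) s) \<le> vol K s + g"
      using n by (intro exI[of _ n]) auto
  qed
qed

text \<open>The bound refers to all \<open>k\<close> stacks and promises nothing about growth. This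
  forgets \<open>K\<close>, so that programs tame for different loop stacks can be composed.\<close>

definition ptime :: "nat \<Rightarrow> nat \<Rightarrow> com \<Rightarrow> bool" where
  "ptime k S c \<longleftrightarrow> wfc k S c \<and> (\<exists>p :: nat poly. \<forall>s. wf_store S s \<longrightarrow>
     (\<exists>n \<le> poly p (vol {..<k} s). exec c s n (sem c s)))"

lemma ptime_tame:
  assumes "tame K c g" "wfc k S c" "K \<subseteq> {..<k}" "0 < S"
  shows "ptime k S c"
proof -
  have fin: "finite K" using assms(3) finite_subset by blast
  obtain p :: "nat poly" where p: "\<And>s. wf_store S s \<Longrightarrow> \<exists>n \<le> poly p (vol K s). exec c s n (sem c s)"
    using tame_exec[OF fin assms(4,1,2)] by metis
  have "\<exists>n \<le> poly p (vol {..<k} s). exec c s n (sem c s)" if "wf_store S s" for s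
  proof -
    have "vol K s \<le> vol {..<k} s"
      unfolding vol_def using assms(3) by (intro sum_mono2) auto
    then show ?thesis using p[OF that] poly_nat_mono le_trans by blast
  qed
  then show ?thesis unfolding ptime_def using assms(2) by blast
qed

lemma ptime_Seq:
  assumes "ptime k S c" "ptime k S d" "0 < S"
  shows "ptime k S (c ;; d)"
proof -
  obtain p where p: "\<And>s. wf_store S s \<Longrightarrow> \<exists>n \<le> poly p (vol {..<k} s). exec c s n (sem c s)"
    using assms(1) unfolding ptime_def by blast
  obtain q where q: "\<And>s. wf_store S s \<Longrightarrow> \<exists>n \<le> poly q (vol {..<k} s). exec d s n (sem d s)"
    using assms(2) unfolding ptime_def by blast
  have "\<exists>n \<le> poly (1 + p + pcompose q ([:0, 1:] + p)) (vol {..<k} s). exec (c ;; d) s n (sem (c ;; d) s)"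
    if s: "wf_store S s" for s
  proof -
    let ?v = "vol {..<k} s"
    obtain n where n: "n \<le> poly p ?v" "exec c s n (sem c s)" using p[OF s] by auto
    have "wf_store S (sem c s)" using wf_store_sem s assms by (auto simp: ptime_def)
    from q[OF this] obtain m where m: "m \<le> poly q (vol {..<k} (sem c s))"
      "exec d (sem c s) m (sem d (sem c s))" by auto
    have "vol {..<k} (sem c s) \<le> ?v + poly p ?v" using vol_exec[OF n(2), of "{..<k}"] n(1) by simp
    then have "m \<le> poly q (?v + poly p ?v)" using m(1) poly_nat_mono le_trans by blast
    then show ?thesis
      using n m exec_Seq[OF n(2) m(2)]
      by (intro exI[of _ "Suc (n + m)"]) (auto simp: poly_pcompose)
  qed
  then show ?thesis using assms unfolding ptime_def by (metis wfc.simps(4))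
qed

section \<open>Compiling stack programs to Turing machines\<close>

text \<open>A stack occupies an initial segment of its tape, with the head on the topmost symbol, hence
  at position \<open>- 1\<close> if the stack is empty.\<close>

definition stk :: "nat list \<Rightarrow> tape" where
  "stk xs = (\<lambda>i. if 0 \<le> i \<and> i < int (length xs) then rev xs ! nat i else 0, int (length xs) - 1)"

definition tapes_of :: "nat \<Rightarrow> store \<Rightarrow> tape list" where
  "tapes_of k s = map (\<lambda>i. stk (s i)) [0..<k]"

lemma read_stk: "read (stk xs) = peek xs"
  by (cases xs) (auto simp: stk_def nth_append)

lemma pop_stk: "act (0, MoveLeft) (stk (a # xs)) = stk xs"
  by (auto simp: stk_def fun_eq_iff nth_append)

text \<open>A machine step writes before it moves, so a push takes two steps: rewrite the symbol
  just read and move right, then write \<open>a\<close>. This is why \<open>exec\<close> charges 2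
  for it.\<close>

lemma push_stk: "act (a, Stay) (act (read (stk xs), MoveRight) (stk xs)) = stk (a # xs)"
  by (auto simp: stk_def fun_eq_iff nth_append)

lemma length_tapes_of [simp]: "length (tapes_of k s) = k"
  by (simp add: tapes_of_def)

lemma nth_tapes_of: "i < k \<Longrightarrow> tapes_of k s ! i = stk (s i)"
  by (simp add: tapes_of_def)

lemma nth_reads: "i < k \<Longrightarrow> map read (tapes_of k s) ! i = peek (s i)"
  by (simp add: nth_tapes_of read_stk)

lemma tapes_of_upd: "(tapes_of k s)[i := stk xs] = tapes_of k (s(i := xs))"
  by (rule nth_equalityI) (auto simp: tapes_of_def nth_list_update)

definition keep :: "nat list \<Rightarrow> (nat \<times> move) list" where
  "keep as = map (\<lambda>a. (a, Stay)) as"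

lemma length_keep [simp]: "length (keep as) = length as"
  by (simp add: keep_def)

lemma act_keep: "map2 act (keep (map read ts)) ts = ts"
proof (induction ts)
  case (Cons t ts)
  then show ?case by (cases t) (auto simp: keep_def)
qed (simp add: keep_def)

lemma act_keep_upd:
  "i < length ts \<Longrightarrow> map2 act ((keep (map read ts))[i := x]) ts = ts[i := act x (ts ! i)]"
proof (rule nth_equalityI)
  fix j assume "i < length ts" "j < length (map2 act ((keep (map read ts))[i := x]) ts)"
  then show "map2 act ((keep (map read ts))[i := x]) ts ! j = ts[i := act x (ts ! i)] ! j"
    using act_keep[of ts] by (cases "ts ! j") (auto simp: nth_list_update keep_def)
qed simp

text \<open>\<open>Boot\<close> moves all heads to the ends of the arguments, which turns the tapes into stacks.  In
  \<open>At b ks\<close> the commands \<open>ks\<close> remain to be executed; \<open>b\<close> marks the second half of a \<open>Push\<close>.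
  At the end, stack 2 holds the verdict.\<close>

datatype ctl = Boot | At bool "com list" | Yes | No

fun nxt :: "com \<Rightarrow> ctl \<Rightarrow> nat list \<Rightarrow> ctl \<times> (nat \<times> move) list" where
  "nxt c Boot as =
    (if \<forall>a \<in> set as. a = 0 then (At False [c], map (\<lambda>a. (0, MoveLeft)) as)
     else (Boot, map (\<lambda>a. (a, if a = 0 then Stay else MoveRight)) as))"
| "nxt c (At b []) as = (if as ! 2 = 1 then Yes else No, keep as)"
| "nxt c (At b (Skip # ks)) as = (At False ks, keep as)"
| "nxt c (At b (Push i a # ks)) as =
    (if b then (At False ks, (keep as)[i := (a, Stay)])
     else (At True (Push i a # ks), (keep as)[i := (as ! i, MoveRight)]))"
| "nxt c (At b (Pop i # ks)) as =
    (At False ks, if as ! i = 0 then keep as else (keep as)[i := (0, MoveLeft)])"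
| "nxt c (At b ((c1 ;; c2) # ks)) as = (At False (c1 # c2 # ks), keep as)"
| "nxt c (At b (Case i f # ks)) as = (At False (f (as ! i) # ks), keep as)"
| "nxt c (At b (For i f # ks)) as =
    (if as ! i = 0 then (At False ks, keep as)
     else (At False (f (as ! i) # For i f # ks), (keep as)[i := (0, MoveLeft)]))"
| "nxt c Yes as = (Yes, keep as)"
| "nxt c No as = (No, keep as)"

text \<open>The continuations that can occur while \<open>c\<close> is executed with
  \<open>ks\<close> still to come. Restricting the branches to the alphabet makes them finitely
  many, so that they can serve as machine states.\<close>

primrec reach :: "nat \<Rightarrow> com \<Rightarrow> com list \<Rightarrow> com list set" where
  "reach S Skip ks = {Skip # ks}"
| "reach S (Push i a) ks = {Push i a # ks}"
| "reach S (Pop i) ks = {Pop i # ks}"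
| "reach S (c ;; d) ks = insert ((c ;; d) # ks) (reach S c (d # ks) \<union> reach S d ks)"
| "reach S (Case i f) ks = insert (Case i f # ks) (\<Union>a\<in>{..<S}. reach S (f a) ks)"
| "reach S (For i f) ks = insert (For i f # ks) (\<Union>a\<in>{0<..<S}. reach S (f a) (For i f # ks))"

lemma finite_reach: "finite (reach S c ks)"
  by (induction c arbitrary: ks) auto

lemma reach_self: "c # ks \<in> reach S c ks"
  by (cases c) auto

text \<open>The reason why \<open>nxt\<close> never leaves the state set: the continuations of a
  reachable head command, and the rest behind it, are again reachable.\<close>

lemma reach_closed:
  "ks' \<in> reach S c ks \<Longrightarrow> wfc k S c \<Longrightarrow>
    \<exists>d r. ks' = d # r \<and> wfc k S d \<and> reach S d r \<subseteq> reach S c ks \<and> r \<in> insert ks (reach S c ks)"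
proof (induction c arbitrary: ks)
  case (Seq c d)
  from Seq.prems(1) consider "ks' = (c ;; d) # ks" | "ks' \<in> reach S c (d # ks)" | "ks' \<in> reach S d ks"
    by auto
  then show ?case
  proof cases
    case 1 then show ?thesis using Seq.prems by auto
  next
    case 2
    then show ?thesis using Seq.IH(1)[of "d # ks"] Seq.prems reach_self[of d ks S] by fastforce
  next
    case 3
    then show ?thesis using Seq.IH(2)[of ks] Seq.prems by fastforce
  qed
next
  case (Case i f)
  show ?case
  proof (cases "ks' = Case i f # ks")
    case True then show ?thesis using Case.prems by auto
  next
    case False
    then obtain a where a: "a < S" "ks' \<in> reach S (f a) ks" using Case.prems by auto
    then have "wfc k S (f a)" using Case.prems by auto
    from Case.IH[OF _ a(2) this] show ?thesis using a(1) by fastforce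
  qed
next
  case (For i f)
  show ?case
  proof (cases "ks' = For i f # ks")
    case True then show ?thesis using For.prems by auto
  next
    case False
    then obtain a where a: "0 < a" "a < S" "ks' \<in> reach S (f a) (For i f # ks)" using For.prems by auto
    then have "wfc k S (f a)" using For.prems by auto
    from For.IH[OF _ a(3) this] show ?thesis using a(1,2) by fastforce
  qed
qed auto

definition conts :: "nat \<Rightarrow> com \<Rightarrow> com list set" where
  "conts S c = insert [] (reach S c [])"

definition ctls :: "nat \<Rightarrow> com \<Rightarrow> ctl set" where
  "ctls S c = {Boot, Yes, No} \<union> (\<lambda>(b, ks). At b ks) ` (UNIV \<times> conts S c)"

definition idx :: "nat \<Rightarrow> com \<Rightarrow> ctl \<Rightarrow> nat" where
  "idx S c = (SOME h. bij_betw h (ctls S c) {..<card (ctls S c)})"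

definition machine :: "nat \<Rightarrow> nat \<Rightarrow> com \<Rightarrow> tm" where
  "machine k S c =
    \<lparr>tapes = k, symbols = S, states = card (ctls S c),
     start = idx S c Boot, accept = idx S c Yes, reject = idx S c No,
     delta = (\<lambda>q as. map_prod (idx S c) id (nxt c (the_inv_into (ctls S c) (idx S c) q) as))\<rparr>"

lemma At_in_ctls: "At b ks \<in> ctls S c \<longleftrightarrow> ks \<in> conts S c"
  by (auto simp: ctls_def)

lemma special_in_ctls: "Boot \<in> ctls S c" "Yes \<in> ctls S c" "No \<in> ctls S c"
  by (auto simp: ctls_def)

lemma bij_idx: "bij_betw (idx S c) (ctls S c) {..<card (ctls S c)}"
proof -
  have "finite (ctls S c)" by (auto simp: ctls_def conts_def finite_reach)
  from ex_bij_betw_finite_nat[OF this] show ?thesis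
    unfolding idx_def by (metis (mono_tags, lifting) lessThan_atLeast0 someI_ex)
qed

lemma idx_eq_iff: "x \<in> ctls S c \<Longrightarrow> y \<in> ctls S c \<Longrightarrow> idx S c x = idx S c y \<longleftrightarrow> x = y"
  using bij_idx[of S c] by (auto simp: bij_betw_def inj_on_def)

lemma idx_less: "x \<in> ctls S c \<Longrightarrow> idx S c x < card (ctls S c)"
  using bij_idx[of S c] by (auto simp: bij_betw_def)

lemma the_inv_idx: "x \<in> ctls S c \<Longrightarrow> the_inv_into (ctls S c) (idx S c) (idx S c x) = x"
  using bij_idx[of S c] by (auto simp: bij_betw_def the_inv_into_f_f)

lemma nxt_wf:
  assumes "x \<in> ctls S c" "wfc k S c" "length as = k" "set as \<subseteq> {..<S}" "0 < S"
    and "nxt c x as = (x', acts)"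
  shows "x' \<in> ctls S c \<and> length acts = k \<and> (\<forall>(b, m) \<in> set acts. b < S)"
proof -
  have keep: "b < S" if "(b, m) \<in> set (keep as)" for b m
    using that assms(4) by (auto simp: keep_def)
  have upd: "b < S" if "(b, m) \<in> set ((keep as)[i := (y, mv)])" "y < S" for b m i y mv
    using that keep set_update_subset_insert[of "keep as" i "(y, mv)"] by blast
  show ?thesis
  proof (cases x)
    case Boot
    then show ?thesis using assms reach_self[of c "[]" S]
      by (auto simp: special_in_ctls At_in_ctls conts_def split: if_splits)
  next
    case (At b ks)
    show ?thesis
    proof (cases "ks = []")
      case True
      then show ?thesis using assms(3,6) At by (auto simp: special_in_ctls dest: keep)
    next
      case False
      then have "ks \<in> reach S c []" using assms(1) At by (simp add: At_in_ctls conts_def)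
      from reach_closed[OF this assms(2)] obtain d r where d: "ks = d # r" "wfc k S d"
        "reach S d r \<subseteq> conts S c" "r \<in> conts S c" by (auto simp: conts_def)
      have nth: "as ! i < S" if "i < k" for i using that assms(3,4) nth_mem by fastforce
      have self: "At b' (f # r') \<in> ctls S c" if "reach S f r' \<subseteq> conts S c" for b' f r'
        using reach_self[of f r' S] that by (auto simp: At_in_ctls)
      show ?thesis
        using assms(3,5,6) At d
        by (cases d)
          (auto simp: At_in_ctls nth UN_subset_iff split: if_splits dest: keep upd intro!: self)
    qed
  next
    case Yes
    then show ?thesis using assms by (auto simp: special_in_ctls dest: keep)
  next
    case No
    then show ?thesis using assms by (auto simp: special_in_ctls dest: keep)
  qed
qed

lemma wf_machine:
  assumes "wfc k S c" "1 \<le> k" "3 \<le> S"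
  shows "wf_tm (machine k S c)"
proof -
  have "case delta (machine k S c) q as of (q', acts) \<Rightarrow>
     q' < states (machine k S c) \<and> length acts = k \<and> (\<forall>(b, m) \<in> set acts. b < S)"
    if q: "q < states (machine k S c)" and as: "length as = k" "set as \<subseteq> {..<S}" for q as
  proof -
    obtain x where x: "x \<in> ctls S c" "q = idx S c x"
      using q bij_idx[of S c] by (auto simp: machine_def bij_betw_def)
    obtain x' acts where n: "nxt c x as = (x', acts)" by fastforce
    show ?thesis using nxt_wf[OF x(1) assms(1) as _ n] assms(3) n x
      by (auto simp: machine_def the_inv_idx idx_less)
  qed
  then show ?thesis using assms
    by (auto simp: wf_tm_def machine_def idx_less special_in_ctls idx_eq_iff)
qed

lemma step_machine:
  assumes "x \<in> ctls S c" "x \<noteq> Yes" "x \<noteq> No" "nxt c x (map read ts) = (x', acts)"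
  shows "step (machine k S c) (idx S c x, ts) = (idx S c x', map2 act acts ts)"
  using assms
  by (simp add: step_def halted_def machine_def idx_eq_iff special_in_ctls the_inv_idx)

lemma funpow_split: "(f ^^ Suc (m + n)) x = (f ^^ n) ((f ^^ m) (f x))"
  by (metis add.commute comp_apply funpow_Suc_right funpow_add)

text \<open>The simulation is exact: the costs in \<open>exec\<close> are the numbers of machine
  steps. The two hypotheses on \<open>conts\<close> keep all intermediate control states inside the
  finite state set.\<close>

lemma machine_exec:
  assumes "0 < S"
  shows "exec d s n s' \<Longrightarrow> wfc k S d \<Longrightarrow> wf_store S s \<Longrightarrow> reach S d ks \<subseteq> conts S c \<Longrightarrow> ks \<in> conts S c \<Longrightarrow>
    (step (machine k S c) ^^ n) (idx S c (At False (d # ks)), tapes_of k s) =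
      (idx S c (At False ks), tapes_of k s') \<and> wf_store S s'"
proof (induction arbitrary: ks rule: exec.induct)
  case (exec_Skip s)
  then show ?case
    by (simp add: step_machine At_in_ctls act_keep)
next
  case (exec_Push i a s)
  let ?x = "At False (Push i a # ks)" and ?y = "At True (Push i a # ks)"
  have xy: "?x \<in> ctls S c" "?y \<in> ctls S c" using exec_Push.prems by (auto simp: At_in_ctls)
  have i: "i < k" using exec_Push.prems by simp
  have "step (machine k S c) (idx S c ?x, tapes_of k s) =
      (idx S c ?y, (tapes_of k s)[i := act (read (stk (s i)), MoveRight) (stk (s i))])"
    using i by (simp add: step_machine[OF xy(1)] act_keep_upd nth_tapes_of)
  moreover have "step (machine k S c) (idx S c ?y, (tapes_of k s)[i := t]) =
      (idx S c (At False ks), (tapes_of k s)[i := act (a, Stay) t])" for t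
    using i by (simp add: step_machine[OF xy(2)] act_keep_upd)
  moreover have "wf_store S (s(i := a # s i))"
    using exec_Push.prems by (auto simp: wf_store_def)
  ultimately show ?case
    by (simp add: numeral_2_eq_2 push_stk tapes_of_upd fun_upd_def)
next
  case (exec_Pop i s)
  have x: "At False (Pop i # ks) \<in> ctls S c" using exec_Pop.prems by (auto simp: At_in_ctls)
  have i: "i < k" using exec_Pop.prems by simp
  have w: "wf_store S (s(i := tl (s i)))"
    using wf_store_sem[of k S "Pop i" s] exec_Pop.prems assms by simp
  have "step (machine k S c) (idx S c (At False (Pop i # ks)), tapes_of k s) =
      (idx S c (At False ks), tapes_of k (s(i := tl (s i))))"
  proof (cases "s i")
    case Nil
    then have "s(i := tl (s i)) = s" by auto
    then show ?thesis using i Nil by (simp add: step_machine[OF x] nth_tapes_of read_stk act_keep)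
  next
    case (Cons a xs)
    then have "0 < a" using exec_Pop.prems(2) by (auto simp: wf_store_def dest!: spec[of _ i])
    then show ?thesis
      using i Cons by (simp add: step_machine[OF x] nth_tapes_of read_stk act_keep_upd pop_stk tapes_of_upd)
  qed
  then show ?case using w by (simp add: fun_upd_def)
next
  case (exec_Seq c1 s m s1 d n s2)
  have "step (machine k S c) (idx S c (At False ((c1 ;; d) # ks)), tapes_of k s) =
      (idx S c (At False (c1 # d # ks)), tapes_of k s)"
    using exec_Seq.prems by (simp add: step_machine At_in_ctls act_keep)
  moreover have "d # ks \<in> conts S c" using reach_self[of d ks S] exec_Seq.prems by auto
  ultimately show ?case
    using exec_Seq.IH(1)[of "d # ks"] exec_Seq.IH(2)[of ks] exec_Seq.prems
    by (simp only: funpow_split) auto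
next
  case (exec_Case f s i n s1)
  have i: "i < k" using exec_Case.prems by simp
  have a: "peek (s i) < S" using wf_store_peek exec_Case.prems assms by auto
  have "step (machine k S c) (idx S c (At False (Case i f # ks)), tapes_of k s) =
      (idx S c (At False (f (peek (s i)) # ks)), tapes_of k s)"
    using exec_Case.prems i by (simp add: step_machine At_in_ctls act_keep nth_reads del: nth_map)
  then show ?case
    using exec_Case.IH[of ks] exec_Case.prems a by (auto simp: funpow_Suc_right simp del: funpow.simps)
next
  case (exec_For_Nil s i f)
  then show ?case
    by (simp add: step_machine At_in_ctls act_keep nth_tapes_of read_stk)
next
  case (exec_For_Cons s i a xs f m s1 n s2)
  have i: "i < k" using exec_For_Cons.prems by simp
  have a: "0 < a" "a < S"
    using exec_For_Cons.hyps(1) exec_For_Cons.prems(2) by (auto simp: wf_store_def dest!: spec[of _ i])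
  have x: "At False (For i f # ks) \<in> ctls S c" using exec_For_Cons.prems by (auto simp: At_in_ctls)
  have "step (machine k S c) (idx S c (At False (For i f # ks)), tapes_of k s) =
      (idx S c (At False (f a # For i f # ks)), tapes_of k (s(i := xs)))"
    using i a exec_For_Cons.hyps(1)
    by (simp add: step_machine[OF x] nth_tapes_of read_stk act_keep_upd pop_stk tapes_of_upd)
  moreover have "For i f # ks \<in> conts S c" using exec_For_Cons.prems by auto
  moreover have "wf_store S (s(i := xs))"
    using exec_For_Cons.prems(2) exec_For_Cons.hyps(1) unfolding wf_store_def
    by (metis fun_upd_apply set_subset_Cons subset_trans)
  moreover have "reach S (f a) (For i f # ks) \<subseteq> conts S c" "wfc k S (f a)"
    using exec_For_Cons.prems(1,3) a by (auto simp: UN_subset_iff)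
  ultimately show ?case
    using exec_For_Cons.IH(1)[of "For i f # ks"] exec_For_Cons.IH(2)[of ks] exec_For_Cons.prems
    by (simp only: funpow_split)
qed

definition bits :: "bool list \<Rightarrow> nat list" where
  "bits w = map (\<lambda>b. if b then 2 else 1) w"

text \<open>Booting leaves the last bit of every argument on top of its stack.\<close>

definition store_of :: "bool list list \<Rightarrow> store" where
  "store_of ws = (\<lambda>i. if i < length ws then rev (bits (ws ! i)) else [])"

lemma wf_store_of: "3 \<le> S \<Longrightarrow> wf_store S (store_of ws)"
  by (auto simp: wf_store_def store_of_def bits_def)

lemma stk_bits: "stk (rev (bits w)) = (contents w, int (length w) - 1)"
  by (auto simp: stk_def bits_def contents_def fun_eq_iff)

text \<open>A head that has reached its first blank waits there. After as many steps as the longest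
  argument has bits all heads read blanks, and one joint move to the left puts each on its last bit,
  or on position -1 if the argument is empty.\<close>

lemma machine_boot:
  assumes "length ws \<le> k"
  shows "\<exists>n \<le> Suc (input_size ws). run (machine k S c) ws n = (idx S c (At False [c]), tapes_of k (store_of ws))"
proof -
  let ?M = "machine k S c"
  define w where "w i = (if i < length ws then ws ! i else [])" for i
  define L where "L = Max (insert 0 ((\<lambda>i. length (w i)) ` {..<k}))"
  define ts where "ts t = map (\<lambda>i. (contents (w i), min (int t) (int (length (w i))))) [0..<k]" for t
  have reads: "map read (ts t) = map (\<lambda>i. if t < length (w i) then if w i ! t then 2 else 1 else 0) [0..<k]" for t
    unfolding ts_def map_map o_def by (intro map_cong refl) (auto simp: contents_def)
  have move: "act (if t < length v then if v ! t then 2 else 1 else 0,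
        if (if t < length v then if v ! t then 2 else 1 else 0) = (0 :: nat) then Stay else MoveRight)
      (contents v, min (int t) (int (length v))) = (contents v, min (int (Suc t)) (int (length v)))" for t v
    by (auto simp: contents_def fun_eq_iff)
  have le: "length (w i) \<le> L" if "i < k" for i
    unfolding L_def using that by (intro Max_ge) auto
  have boot: "run ?M ws t = (idx S c Boot, ts t)" if "t \<le> L" for t
    using that
  proof (induction t)
    case 0
    show ?case by (simp add: run_def init_def machine_def ts_def w_def)
  next
    case (Suc t)
    have "L \<in> insert 0 ((\<lambda>i. length (w i)) ` {..<k})" unfolding L_def by (intro Max_in) auto
    then obtain i where i: "i < k" "t < length (w i)" using Suc.prems by auto
    then have "map read (ts t) ! i \<noteq> 0" "i < length (map read (ts t))"
      unfolding reads by simp_all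
    then have "\<not> (\<forall>a \<in> set (map read (ts t)). a = 0)" by (meson nth_mem)
    then have "nxt c Boot (map read (ts t)) =
        (Boot, map (\<lambda>a. (a, if a = 0 then Stay else MoveRight)) (map read (ts t)))" by simp
    moreover have "map2 act (map (\<lambda>a. (a, if a = 0 then Stay else MoveRight)) (map read (ts t))) (ts t) = ts (Suc t)"
      unfolding reads
      by (rule nth_equalityI) (simp_all add: ts_def move del: act.simps)
    moreover have "run ?M ws (Suc t) = step ?M (run ?M ws t)" by (simp add: run_def)
    ultimately show ?case using Suc by (simp add: step_machine special_in_ctls)
  qed
  have zero: "map read (ts L) = replicate k 0"
    unfolding reads by (rule nth_equalityI) (use le in \<open>simp_all add: leD\<close>)
  have "nxt c Boot (map read (ts L)) = (At False [c], replicate k (0, MoveLeft))"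
    unfolding zero by simp
  moreover have "map2 act (replicate k (0, MoveLeft)) (ts L) = tapes_of k (store_of ws)"
  proof (rule nth_equalityI)
    fix i assume "i < length (map2 act (replicate k (0, MoveLeft)) (ts L))"
    then have i: "i < k" by (simp add: ts_def)
    have "store_of ws i = rev (bits (w i))" by (simp add: store_of_def w_def bits_def)
    then show "map2 act (replicate k (0, MoveLeft)) (ts L) ! i = tapes_of k (store_of ws) ! i"
      using i le[OF i] by (simp add: nth_tapes_of stk_bits ts_def contents_def fun_eq_iff)
  qed (simp add: ts_def)
  moreover have "run ?M ws (Suc L) = step ?M (run ?M ws L)" by (simp add: run_def)
  ultimately have "run ?M ws (Suc L) = (idx S c (At False [c]), tapes_of k (store_of ws))"
    using boot[of L] by (simp add: step_machine special_in_ctls)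
  moreover have "L \<le> input_size ws"
  proof -
    have "length (w i) \<le> input_size ws" for i
      using member_le_sum_list[of "length (ws ! i)" "map length ws"]
      by (auto simp: w_def input_size_def)
    then show ?thesis unfolding L_def by auto
  qed
  ultimately show ?thesis by blast
qed

lemma machine_run:
  assumes "wfc k S c" "3 \<le> k" "3 \<le> S" "length ws \<le> k" "exec c (store_of ws) n s'"
  shows "\<exists>t \<le> input_size ws + n + 2. run (machine k S c) ws t =
    (if peek (s' 2) = 1 then accept (machine k S c) else reject (machine k S c), tapes_of k s')"
proof -
  let ?M = "machine k S c"
  obtain m where m: "m \<le> Suc (input_size ws)"
    "run ?M ws m = (idx S c (At False [c]), tapes_of k (store_of ws))"
    using machine_boot[OF assms(4)] by blast
  have "(step ?M ^^ n) (idx S c (At False [c]), tapes_of k (store_of ws)) =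
      (idx S c (At False []), tapes_of k s')"
    using machine_exec[OF _ assms(5,1) wf_store_of, of "[]" c] assms(3) by (auto simp: conts_def)
  then have "run ?M ws (n + m) = (idx S c (At False []), tapes_of k s')"
    using m(2) by (simp add: run_def funpow_add)
  then have "run ?M ws (Suc (n + m)) =
    (if peek (s' 2) = 1 then idx S c Yes else idx S c No, tapes_of k s')"
    using assms(2) by (simp add: run_def step_machine At_in_ctls conts_def nth_tapes_of read_stk act_keep)
  then show ?thesis using m(1) by (intro exI[of _ "Suc (n + m)"]) (auto simp: machine_def)
qed

lemma run_add: "run M ws (m + n) = (step M ^^ n) (run M ws m)"
  by (simp add: run_def add.commute[of m] funpow_add)

lemma halted_fixed: "halted M cfg \<Longrightarrow> (step M ^^ n) cfg = cfg"
  by (induction n) (auto simp: step_def)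

lemma run_halted: "halted M (run M ws m) \<Longrightarrow> m \<le> n \<Longrightarrow> run M ws n = run M ws m"
  using run_add[of M ws m "n - m"] halted_fixed by simp

lemma halted_unique:
  "halted M (run M ws m) \<Longrightarrow> halted M (run M ws n) \<Longrightarrow> run M ws m = run M ws n"
  by (metis le_cases run_halted)

lemma ptime_machine:
  assumes "ptime k S c" "3 \<le> k" "3 \<le> S" "n \<le> k"
  shows "poly_time (machine k S c) n"
    and "length ws = n \<Longrightarrow> \<exists>t. run (machine k S c) ws t =
      (if peek (sem c (store_of ws) 2) = 1 then accept (machine k S c) else reject (machine k S c),
       tapes_of k (sem c (store_of ws)))"
proof -
  let ?M = "machine k S c"
  obtain p :: "nat poly" where
    p: "\<And>s. wf_store S s \<Longrightarrow> \<exists>n \<le> poly p (vol {..<k} s). exec c s n (sem c s)"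
    using assms(1) unfolding ptime_def by blast
  have wf: "wfc k S c" using assms(1) by (simp add: ptime_def)
  have *: "\<exists>t \<le> poly ([:2, 1:] + p) (input_size ws). run ?M ws t =
      (if peek (sem c (store_of ws) 2) = 1 then accept ?M else reject ?M, tapes_of k (sem c (store_of ws)))"
    if ws: "length ws = n" for ws
  proof -
    have "vol {..<k} (store_of ws) = (\<Sum>i<length ws. length (ws ! i))"
      unfolding vol_def using ws assms(4)
      by (intro sum.mono_neutral_cong_right) (auto simp: store_of_def bits_def)
    also have "\<dots> = input_size ws"
      by (simp add: input_size_def sum_list_sum_nth atLeast0LessThan)
    finally have v: "vol {..<k} (store_of ws) = input_size ws" .
    obtain l where l: "l \<le> poly p (input_size ws)" "exec c (store_of ws) l (sem c (store_of ws))"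
      using p[OF wf_store_of[OF assms(3)], of ws] v by auto
    obtain t where t: "t \<le> input_size ws + l + 2" "run ?M ws t =
      (if peek (sem c (store_of ws) 2) = 1 then accept ?M else reject ?M, tapes_of k (sem c (store_of ws)))"
      using machine_run[OF wf assms(2,3) _ l(2)] ws assms(4) by auto
    then show ?thesis using l(1) by (intro exI[of _ t] conjI) auto
  qed
  then show "length ws = n \<Longrightarrow> \<exists>t. run ?M ws t =
      (if peek (sem c (store_of ws) 2) = 1 then accept ?M else reject ?M, tapes_of k (sem c (store_of ws)))"
    by blast
  show "poly_time ?M n"
    unfolding poly_time_def
  proof (intro exI allI impI)
    fix ws :: "bool list list" assume "length ws = n"
    from *[OF this] obtain t where t: "t \<le> poly ([:2, 1:] + p) (input_size ws)" "halted ?M (run ?M ws t)"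
      by (auto simp: halted_def)
    then show "halted ?M (run ?M ws (poly ([:2, 1:] + p) (input_size ws)))"
      using run_halted by metis
  qed
qed

theorem ptime_computable:
  assumes "ptime k S c" "3 \<le> k" "3 \<le> S"
    and "\<And>x. sem c (store_of [x]) 1 = rev (bits (f x))"
  shows "poly_time_computable f"
proof -
  have "outputs (machine k S c) [x] (f x)" for x
  proof -
    let ?M = "machine k S c"
    obtain t where t: "run ?M [x] t = (if peek (sem c (store_of [x]) 2) = 1 then accept ?M else reject ?M,
        tapes_of k (sem c (store_of [x])))"
      using ptime_machine(2)[OF assms(1-3), of 1 "[x]"] assms(2) by auto
    then have "halted ?M (run ?M [x] t)" by (auto simp: halted_def)
    moreover have "fst (snd (run ?M [x] t) ! 1) = contents (f x)"
      using t assms(2) assms(4)[of x] by (simp add: nth_tapes_of stk_bits)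
    ultimately show ?thesis unfolding outputs_def by blast
  qed
  moreover have "wf_tm (machine k S c)" "tapes (machine k S c) \<ge> 2"
    using wf_machine[of k S c] assms by (auto simp: ptime_def machine_def)
  moreover have "poly_time (machine k S c) 1"
    using ptime_machine(1)[OF assms(1-3)] assms(2) by simp
  ultimately show ?thesis unfolding poly_time_computable_def by blast
qed

theorem ptime_verifier:
  assumes "ptime k S c" "3 \<le> k" "3 \<le> S"
    and "\<And>x. x \<in> L \<longleftrightarrow> (\<exists>u. length u \<le> poly q (length x) \<and> peek (sem c (store_of [x, u]) 2) = 1)"
  shows "L \<in> NP"
proof -
  let ?M = "machine k S c"
  have wf: "wf_tm ?M" "tapes ?M \<ge> 2"
    using wf_machine[of k S c] assms(1-3) by (auto simp: ptime_def machine_def)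
  have "accepts ?M [x, u] \<longleftrightarrow> peek (sem c (store_of [x, u]) 2) = 1" for x u
  proof -
    obtain t where t: "run ?M [x, u] t =
      (if peek (sem c (store_of [x, u]) 2) = 1 then accept ?M else reject ?M, tapes_of k (sem c (store_of [x, u])))"
      using ptime_machine(2)[OF assms(1-3), of 2 "[x, u]"] assms(2) by auto
    then have h: "halted ?M (run ?M [x, u] t)" by (auto simp: halted_def)
    have "fst (run ?M [x, u] t) = accept ?M" if "fst (run ?M [x, u] t') = accept ?M" for t'
      using halted_unique[OF h, of t'] that by (simp add: halted_def)
    then have "accepts ?M [x, u] \<longleftrightarrow> fst (run ?M [x, u] t) = accept ?M"
      unfolding accepts_def by blast
    then show ?thesis using t wf(1) by (auto simp: wf_tm_def)
  qed
  moreover have "poly_time ?M 2" using ptime_machine(1)[OF assms(1-3)] assms(2) by simp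
  ultimately show ?thesis unfolding NP_def mem_Collect_eq using wf assms(4)
    by (intro exI[of _ ?M] exI[of _ q]) simp
qed

section \<open>Subset sums and consistent compositions\<close>

fun walk :: "int \<Rightarrow> int \<Rightarrow> int list \<Rightarrow> bool" where
  "walk C s [] = True"
| "walk C s (e # es) = (0 \<le> s + e \<and> s + e \<le> C \<and> walk C (s + e) es)"

lemma walk_append: "walk C s (xs @ ys) \<longleftrightarrow> walk C s xs \<and> walk C (s + sum_list xs) ys"
  by (induction xs arbitrary: s) (auto simp: algebra_simps)

lemma walk_iff_take:
  "walk C s es \<longleftrightarrow>
    (\<forall>i < length es. 0 \<le> s + sum_list (take (Suc i) es) \<and> s + sum_list (take (Suc i) es) \<le> C)"
proof (induction es arbitrary: s)
  case (Cons e es)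
  show ?case
    by (simp only: walk.simps Cons.IH length_Cons All_less_Suc2 take_Suc_Cons sum_list.Cons)
      (simp add: add.assoc)
qed simp

lemma walk_nonneg: "0 \<le> s \<Longrightarrow> (\<And>e. e \<in> set es \<Longrightarrow> 0 \<le> e) \<Longrightarrow> s + sum_list es \<le> C \<Longrightarrow> walk C s es"
proof (induction es arbitrary: s)
  case (Cons e es)
  have "0 \<le> sum_list es" using Cons.prems(2) by (intro sum_list_nonneg) auto
  then show ?case using Cons.prems by (auto intro!: Cons.IH simp: add.assoc)
qed simp

lemma conscomp_solvable_iff_walk:
  "conscomp_solvable es C \<longleftrightarrow> (\<exists>es'. mset es' = mset es \<and> walk C 0 es')"
proof -
  have *: "sum_list (take (Suc i) (permute_list \<pi> es)) = (\<Sum>j\<le>i. es ! \<pi> j)"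
    if "\<pi> permutes {..<length es}" "i < length es" for \<pi> i
    using that by (simp add: sum_list_sum_nth permute_list_def lessThan_Suc_atMost atLeast0LessThan
        min.absorb2 Suc_leI)
  show ?thesis
  proof
    assume "conscomp_solvable es C"
    then obtain \<pi> where p: "\<pi> permutes {..<length es}"
      "\<forall>i < length es. 0 \<le> (\<Sum>j\<le>i. es ! \<pi> j) \<and> (\<Sum>j\<le>i. es ! \<pi> j) \<le> C"
      unfolding conscomp_solvable_def by blast
    then have "walk C 0 (permute_list \<pi> es)"
      by (simp add: walk_iff_take *)
    then show "\<exists>es'. mset es' = mset es \<and> walk C 0 es'" using p(1) by (metis mset_permute_list)
  next
    assume "\<exists>es'. mset es' = mset es \<and> walk C 0 es'"
    then obtain es' where e: "mset es' = mset es" "walk C 0 es'" by blast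
    obtain \<pi> where p: "\<pi> permutes {..<length es}" "permute_list \<pi> es = es'"
      using mset_eq_permutation[OF e(1)] by blast
    show "conscomp_solvable es C"
      unfolding conscomp_solvable_def
    proof (intro exI conjI)
      have "walk C 0 (permute_list \<pi> es)" using e(2) p(2) by simp
      then show "\<forall>i < length es. 0 \<le> (\<Sum>j\<le>i. es ! \<pi> j) \<and> (\<Sum>j\<le>i. es ! \<pi> j) \<le> C"
        using *[OF p(1)] by (simp add: walk_iff_take)
    qed (rule p(1))
  qed
qed

lemma subseteq_add_mset_notin: "M \<subseteq># add_mset x N \<Longrightarrow> x \<notin># M \<Longrightarrow> M \<subseteq># N"
  by (metis diff_single_trivial subset_eq_diff_conv add_mset_add_single)

lemma sum_mset_ge_0:
  fixes M :: "int multiset"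
  shows "(\<And>x. x \<in># M \<Longrightarrow> 0 \<le> x) \<Longrightarrow> 0 \<le> sum_mset M"
  by (induction M) auto

lemma sum_mset_nonneg_mono:
  fixes M N :: "int multiset"
  assumes "M \<subseteq># N" "\<And>x. x \<in># N \<Longrightarrow> 0 \<le> x"
  shows "sum_mset M \<le> sum_mset N"
proof -
  obtain R where R: "N = M + R" using assms(1) mset_subset_eq_exists_conv by blast
  have "0 \<le> sum_mset R" using assms(2) R by (intro sum_mset_ge_0) auto
  then show ?thesis using R by simp
qed

text \<open>Every \<open>- Z\<close> must be taken exactly when the partial sum is \<open>Z\<close>.  As \<open>Z - T\<close> and
  \<open>Z - sum_list xs + T\<close> together exceed \<open>Z\<close>, just one of them occurs before the first \<open>- Z\<close>,
  and then a submultiset of \<open>xs\<close> or its complement has sum \<open>T\<close>.\<close>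

lemma conscomp_subset_sum:
  fixes xs :: "int list"
  assumes xs: "\<And>x. x \<in> set xs \<Longrightarrow> 0 < x" and T: "0 \<le> T" "T < Z" and Z: "sum_list xs < Z"
  defines "b1 \<equiv> Z - T" and "b2 \<equiv> Z - sum_list xs + T"
  shows "conscomp_solvable (xs @ [b1, b2, - Z, - Z]) Z \<longleftrightarrow> (\<exists>M. M \<subseteq># mset xs \<and> sum_mset M = T)"
proof
  assume "\<exists>M. M \<subseteq># mset xs \<and> sum_mset M = T"
  then obtain M where M: "M \<subseteq># mset xs" "sum_mset M = T" by blast
  obtain ys where ys: "mset ys = M" using ex_mset by blast
  obtain zs where zs: "mset zs = mset xs - M" using ex_mset by blast
  have s: "sum_list ys = T" using M ys by (metis sum_mset_sum_list)
  have "mset xs = mset ys + mset zs" using M ys zs by simp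
  then have eq: "mset xs = mset (ys @ zs)" by simp
  then have "sum_list xs = sum_list ys + sum_list zs"
    by (metis sum_list_append sum_mset_sum_list)
  then have s': "sum_list zs = sum_list xs - T" using s by simp
  have pos: "0 \<le> x" if "x \<in> set ys \<union> set zs" for x
    using xs that eq by (metis less_imp_le mset_eq_setD set_append)
  have "0 \<le> sum_list zs" using pos by (intro sum_list_nonneg) auto
  \<comment> \<open>The subset leads from 0 to \<open>T\<close>, \<open>b1\<close> on to
    \<open>Z\<close>, and \<open>- Z\<close> back to 0; the complement leads to
    \<open>sum_list xs - T\<close>, \<open>b2\<close> to \<open>Z\<close> again, and the second
    \<open>- Z\<close> back to 0.\<close>
  have "walk Z 0 (ys @ [b1, - Z] @ zs @ [b2, - Z])"
    using T Z s s' pos \<open>0 \<le> sum_list zs\<close>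
    by (auto simp: walk_append b1_def b2_def intro!: walk_nonneg)
  moreover have "mset (ys @ [b1, - Z] @ zs @ [b2, - Z]) = mset (xs @ [b1, b2, - Z, - Z])"
    using eq by simp
  ultimately show "conscomp_solvable (xs @ [b1, b2, - Z, - Z]) Z"
    unfolding conscomp_solvable_iff_walk by blast
next
  assume "conscomp_solvable (xs @ [b1, b2, - Z, - Z]) Z"
  then obtain es where es: "mset es = mset (xs @ [b1, b2, - Z, - Z])" "walk Z 0 es"
    unfolding conscomp_solvable_iff_walk by blast
  let ?P = "mset xs + {#b1, b2#}"
  have Z0: "0 < Z" using T by simp
  have "- Z \<in> set es" using mset_eq_setD[OF es(1)] by simp
  then obtain ps qs where split: "es = ps @ (- Z) # qs" "- Z \<notin> set ps"
    by (meson split_list_first)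
  have "walk Z 0 ps" "0 \<le> sum_list ps - Z" using es(2) split by (auto simp: walk_append)
  \<comment> \<open>\<open>walk\<close> does not test the empty prefix; in that case
    \<open>0 < Z\<close> is what is needed.\<close>
  moreover have "sum_list ps \<le> Z"
    using \<open>walk Z 0 ps\<close> Z0 by (cases ps rule: rev_cases) (auto simp: walk_append)
  ultimately have ps: "sum_mset (mset ps) = Z" by (simp add: sum_mset_sum_list)
  have "mset ps + {# - Z #} + mset qs = ?P + {# - Z, - Z #}" using es(1) split by simp
  then have "add_mset (- Z) (add_mset (- Z) ?P) = mset ps + ({# - Z #} + mset qs)" by simp
  then have "mset ps \<subseteq># add_mset (- Z) (add_mset (- Z) ?P)" by (simp only: mset_subset_eq_add_left)
  then have "mset ps \<subseteq># add_mset (- Z) ?P"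
    by (rule subseteq_add_mset_notin) (use split(2) in simp)
  then have sub: "mset ps \<subseteq># ?P"
    by (rule subseteq_add_mset_notin) (use split(2) in simp)
  have nonneg: "0 \<le> x" if "x \<in># mset xs" for x using xs that by (auto intro: less_imp_le)
  \<comment> \<open>Here \<open>c\<close> is the filler that occurs before the first
    \<open>- Z\<close> and \<open>d\<close> the other one. If \<open>d\<close> occurred as well, the
    partial sum would exceed \<open>Z\<close>, so what remains of \<open>ps\<close> consists of
    items only.\<close>
  have one: "\<exists>M. M \<subseteq># mset xs \<and> sum_mset M = Z - c"
    if c: "c \<in># mset ps" and cd: "{#b1, b2#} = {#c, d#}" for c d
  proof -
    define M where "M = mset ps - {#c#}"
    have M: "mset ps = add_mset c M" using c by (simp add: M_def)
    have "add_mset c M \<subseteq># add_mset c (add_mset d (mset xs))"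
      using sub M cd by (simp add: add_mset_commute union_commute)
    then have sub': "M \<subseteq># add_mset d (mset xs)" by simp
    have sumM: "sum_mset M = Z - c" using ps M by simp
    have "c + d = b1 + b2" using arg_cong[OF cd, of sum_mset] by simp
    then have cd': "c + d > Z" using Z by (simp add: b1_def b2_def)
    have "d \<notin># M"
    proof
      assume "d \<in># M"
      then obtain M' where M': "M = add_mset d M'" by (meson multi_member_split)
      then have "M' \<subseteq># mset xs" using sub' by simp
      then have "0 \<le> sum_mset M'" using nonneg by (intro sum_mset_ge_0) (meson mset_subset_eqD)
      then show False using sumM M' cd' by simp
    qed
    then have "M \<subseteq># mset xs" by (rule subseteq_add_mset_notin[OF sub'])
    then show ?thesis using sumM by blast
  qed
  have "b1 \<in># mset ps \<or> b2 \<in># mset ps"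
  proof (rule ccontr)
    assume n: "\<not> (b1 \<in># mset ps \<or> b2 \<in># mset ps)"
    have "mset ps \<subseteq># add_mset b1 (add_mset b2 (mset xs))"
      using sub by (simp add: union_commute)
    then have "mset ps \<subseteq># add_mset b2 (mset xs)"
      by (rule subseteq_add_mset_notin) (use n in simp)
    then have "mset ps \<subseteq># mset xs"
      by (rule subseteq_add_mset_notin) (use n in simp)
    then have "sum_mset (mset ps) \<le> sum_mset (mset xs)" using nonneg by (rule sum_mset_nonneg_mono)
    then show False using ps Z by (simp add: sum_mset_sum_list)
  qed
  then show "\<exists>M. M \<subseteq># mset xs \<and> sum_mset M = T"
  proof
    assume "b1 \<in># mset ps"
    from one[OF this refl] show ?thesis by (simp add: b1_def)
  next
    assume "b2 \<in># mset ps"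
    from one[OF this, of b1] obtain M where M: "M \<subseteq># mset xs" "sum_mset M = Z - b2"
      by (auto simp: add_mset_commute)
    \<comment> \<open>In this case \<open>M\<close> has the sum \<open>sum_list xs - T\<close>, and
      the complement is the wanted subset.\<close>
    then have "sum_mset (mset xs - M) = sum_list xs - (Z - b2)"
      by (metis add_diff_cancel_left' subset_mset.add_diff_inverse sum_mset.union sum_mset_sum_list)
    then show ?thesis by (intro exI[of _ "mset xs - M"]) (auto simp: b2_def)
  qed
qed

section \<open>Digit expansions, and submultisets indexed by sets\<close>

lemma digits_unique:
  fixes f g :: "nat \<Rightarrow> nat"
  assumes "\<And>p. p < D \<Longrightarrow> f p < b" "\<And>p. p < D \<Longrightarrow> g p < b"
    and "(\<Sum>p<D. b ^ p * f p) = (\<Sum>p<D. b ^ p * g p)" "p < D"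
  shows "f p = g p"
  using assms
proof (induction D arbitrary: f g p)
  case (Suc D)
  have shift: "(\<Sum>p<Suc D. b ^ p * h p) = h 0 + b * (\<Sum>p<D. b ^ p * h (Suc p))" for h
    by (simp add: sum.lessThan_Suc_shift sum_distrib_left mult.assoc del: sum.lessThan_Suc)
  have eq: "f 0 + b * (\<Sum>p<D. b ^ p * f (Suc p)) = g 0 + b * (\<Sum>p<D. b ^ p * g (Suc p))"
    using Suc.prems(3) by (simp only: shift)
  have b: "f 0 < b" "g 0 < b" using Suc.prems(1,2)[of 0] by auto
  have f0: "f 0 = g 0"
    using arg_cong[OF eq, of "\<lambda>x. x mod b"] b by simp
  then have "(\<Sum>p<D. b ^ p * f (Suc p)) = (\<Sum>p<D. b ^ p * g (Suc p))"
    using eq b by simp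
  then have "f (Suc q) = g (Suc q)" if "q < D" for q
    using Suc.IH[of "\<lambda>q. f (Suc q)" "\<lambda>q. g (Suc q)" q] Suc.prems(1,2) that by auto
  then show ?case using f0 Suc.prems(4) by (cases p) auto
qed simp

lemma digits_less:
  fixes f :: "nat \<Rightarrow> nat"
  assumes "\<And>p. p < D \<Longrightarrow> f p < b"
  shows "(\<Sum>p<D. b ^ p * f p) < b ^ D"
  using assms
proof (induction D)
  case (Suc D)
  have "b ^ D * Suc (f D) \<le> b ^ D * b" using Suc.prems[of D] by (intro mult_le_mono2) auto
  moreover have "(\<Sum>p<D. b ^ p * f p) < b ^ D" using Suc by auto
  ultimately show ?case by (simp add: mult.commute[of b "b ^ D"])
qed simp

text \<open>Different items may be equal as numbers. Every choice of values can nevertheless be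
  lifted to a set of indices, adding an index whenever its value is needed once more.\<close>

lemma subset_image_mset_ex:
  assumes "finite A" "M \<subseteq># image_mset f (mset_set A)"
  shows "\<exists>X \<subseteq> A. M = image_mset f (mset_set X)"
  using assms
proof (induction A arbitrary: M rule: finite_induct)
  case (insert a A)
  show ?case
  proof (cases "M \<subseteq># image_mset f (mset_set A)")
    case True then show ?thesis using insert.IH by blast
  next
    case False
    have sub: "M \<subseteq># add_mset (f a) (image_mset f (mset_set A))" using insert by simp
    then have "f a \<in># M" using False subseteq_add_mset_notin[OF sub] by argo
    then obtain M' where M': "M = add_mset (f a) M'" by (meson multi_member_split)
    then obtain X where X: "X \<subseteq> A" "M' = image_mset f (mset_set X)"
      using sub insert.IH by auto
    moreover have "finite X" "a \<notin> X" using X(1) insert.hyps finite_subset by auto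
    ultimately show ?thesis using M' by (intro exI[of _ "insert a X"]) auto
  qed
qed auto

section \<open>Tilings as subset sums\<close>

text \<open>A Wang tile: the colours of its left, right, lower and upper edges.\<close>

type_synonym tile = "nat \<times> nat \<times> nat \<times> nat"

definition lf :: "tile \<Rightarrow> nat" where "lf \<tau> = fst \<tau>"
definition rt :: "tile \<Rightarrow> nat" where "rt \<tau> = fst (snd \<tau>)"
definition dn :: "tile \<Rightarrow> nat" where "dn \<tau> = fst (snd (snd \<tau>))"
definition up :: "tile \<Rightarrow> nat" where "up \<tau> = snd (snd (snd \<tau>))"

definition trip :: "nat \<Rightarrow> nat \<Rightarrow> nat \<Rightarrow> nat \<Rightarrow> nat" where
  "trip e x y z = x + 2 ^ e * y + 2 ^ (2 * e) * z"

lemma trip_inj: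
  assumes "trip e x y z = trip e x' y' z'" "x < 2 ^ e" "y < 2 ^ e" "x' < 2 ^ e" "y' < 2 ^ e"
  shows "x = x' \<and> y = y' \<and> z = z'"
proof -
  have t: "trip e a b c = a + 2 ^ e * (b + 2 ^ e * c)" for a b c
    by (simp add: trip_def mult_2 power_add distrib_left mult.assoc)
  have "trip e x y z mod 2 ^ e = trip e x' y' z' mod 2 ^ e" using assms(1) by simp
  then have x: "x = x'" unfolding t using assms(2,4) by simp
  then have eq: "y + 2 ^ e * z = y' + 2 ^ e * z'" using assms(1) unfolding t by simp
  then have "(y + 2 ^ e * z) mod 2 ^ e = (y' + 2 ^ e * z') mod 2 ^ e" by simp
  then have "y = y'" using assms(3,5) by simp
  then show ?thesis using x eq by simp
qed

lemma trip_less: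
  assumes "x < 2 ^ e" "y < 2 ^ e" "z < 2 ^ e"
  shows "trip e x y z < 2 ^ (3 * e)"
proof -
  define b :: nat where "b = 2 ^ e"
  have b: "x < b" "y < b" "z < b" using assms by (simp_all add: b_def)
  have "b * Suc z \<le> b * b" using b by (intro mult_le_mono2) simp
  then have "Suc (y + b * z) \<le> b * b" using b by simp
  then have "b * Suc (y + b * z) \<le> b * (b * b)" by (rule mult_le_mono2)
  then have "x + b * (y + b * z) < b * (b * b)" using b by simp
  moreover have "2 ^ (3 * e) = b * (b * b)"
    unfolding b_def power_add[symmetric] by (intro arg_cong[of _ _ "power 2"]) simp
  moreover have "trip e x y z = x + b * (y + b * z)"
    by (simp add: trip_def b_def mult_2 power_add distrib_left mult.assoc)
  ultimately show ?thesis by simp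
qed

lemma trip_sum: "(\<Sum>x\<in>X. trip e (f x) (g x) (h x)) = trip e (\<Sum>x\<in>X. f x) (\<Sum>x\<in>X. g x) (\<Sum>x\<in>X. h x)"
  by (simp add: trip_def sum.distrib sum_distrib_left)

lemma trip_add: "trip e x y z + trip e x' y' z' = trip e (x + x') (y + y') (z + z')"
  by (simp add: trip_def algebra_simps)

lemma sum_shift_delta:
  fixes f :: "nat \<Rightarrow> 'a :: comm_monoid_add"
  shows "(\<Sum>p<N. if q = p + k then f p else 0) = (if k \<le> q \<and> q - k < N then f (q - k) else 0)"
proof (cases "k \<le> q")
  case True
  then have "q = p + k \<longleftrightarrow> p = q - k" for p by auto
  then show ?thesis using True by (simp add: sum.delta)
qed auto

text \<open>The cells \<open>0, \<dots>, N - 1\<close> are arranged helically: cell \<open>p + 1\<close> is to the right of cell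
  \<open>p\<close>, and cell \<open>p + W\<close> is above it.\<close>

locale tiling =
  fixes G :: "tile list" and m e W N l0 r0 t0 :: nat and dn0 :: "nat \<Rightarrow> nat"
  assumes distinct_G: "distinct G"
    and G: "\<tau> \<in> set G \<Longrightarrow> lf \<tau> \<le> m \<and> rt \<tau> \<le> m \<and> dn \<tau> \<le> m \<and> up \<tau> \<le> m"
    and bounds: "l0 \<le> m" "r0 \<le> m" "t0 \<le> m" "\<And>p. p < W \<Longrightarrow> dn0 p \<le> m"
    and W: "2 \<le> W" "W \<le> N"
    and e: "2 * ((2 * length G + 1) * (m + 1)) < 2 ^ e"
begin

definition tiles :: "(nat \<Rightarrow> tile) \<Rightarrow> bool" where
  "tiles \<gamma> \<longleftrightarrow> (\<forall>p < N. \<gamma> p \<in> set G) \<and>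
     lf (\<gamma> 0) = l0 \<and> (\<forall>p. 0 < p \<and> p < N \<longrightarrow> lf (\<gamma> p) = rt (\<gamma> (p - 1))) \<and> rt (\<gamma> (N - 1)) = r0 \<and>
     (\<forall>p < N. dn (\<gamma> p) = (if p < W then dn0 p else up (\<gamma> (p - W)))) \<and>
     (\<forall>p. N - W \<le> p \<and> p < N \<longrightarrow> up (\<gamma> p) = t0)"

text \<open>A bound for every digit of the sum of all items: in each digit at most two sides of
  tiles meet, and each side contributes at most \<open>length G * m\<close>. Twice
  \<open>cap\<close> is still below the base, so none of the sums formed here carries.\<close>

definition cap :: nat where
  "cap = (2 * length G + 1) * (m + 1)"

abbreviation weigh :: "(nat \<Rightarrow> nat) \<Rightarrow> (nat \<Rightarrow> nat) \<Rightarrow> (nat \<Rightarrow> nat) \<Rightarrow> nat" where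
  "weigh f g h \<equiv> (\<Sum>p<N + W. (2 ^ (3 * e)) ^ p * trip e (f p) (g p) (h p))"

text \<open>Each position carries three digits in base \<open>2 ^ e\<close>.  The first counts the tiles of the cell;
  the others compare the colours on the left and on the bottom edge: one side contributes the
  colour, the other its complement to \<open>m\<close>.\<close>

definition item :: "nat \<times> tile \<Rightarrow> nat" where
  "item = (\<lambda>(p, \<tau>). (2 ^ (3 * e)) ^ p * trip e 1 (m - lf \<tau>) (m - dn \<tau>) +
     (2 ^ (3 * e)) ^ (p + 1) * trip e 0 (rt \<tau>) 0 + (2 ^ (3 * e)) ^ (p + W) * trip e 0 0 (up \<tau>))"

text \<open>The initials \<open>i\<close>, \<open>t\<close> and \<open>s\<close> stand for an item,
  the target and the sum of all items; \<open>k\<close>, \<open>h\<close> and \<open>v\<close> for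
  the digit that counts tiles and the digits for horizontal and vertical matching. The form
  \<open>p + 0\<close> makes \<open>sum_shift_delta\<close> applicable to every summand.\<close>

definition ik :: "nat \<times> tile \<Rightarrow> nat \<Rightarrow> nat" where
  "ik = (\<lambda>(p, \<tau>) q. if q = p + 0 then 1 else 0)"
definition ih :: "nat \<times> tile \<Rightarrow> nat \<Rightarrow> nat" where
  "ih = (\<lambda>(p, \<tau>) q. (if q = p + 0 then m - lf \<tau> else 0) + (if q = p + 1 then rt \<tau> else 0))"
definition iv :: "nat \<times> tile \<Rightarrow> nat \<Rightarrow> nat" where
  "iv = (\<lambda>(p, \<tau>) q. (if q = p + 0 then m - dn \<tau> else 0) + (if q = p + W then up \<tau> else 0))"

definition tk :: "nat \<Rightarrow> nat" where
  "tk q = (if q < N then 1 else 0)"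
text \<open>At an inner edge a colour and a complement add up to \<open>m\<close> exactly if the
  colours agree. At the two ends of the word only one side is present, and the target prescribes the
  boundary colour, once in complemented form.\<close>

definition th :: "nat \<Rightarrow> nat" where
  "th q = (if q = 0 then m - l0 else if q < N then m else if q = N then r0 else 0)"
definition tv :: "nat \<Rightarrow> nat" where
  "tv q = (if q < W then m - dn0 q else if q < N then m else t0)"

definition sk :: "nat \<Rightarrow> nat" where
  "sk q = (if q < N then length G else 0)"
definition sh :: "nat \<Rightarrow> nat" where
  "sh q = (if q < N then \<Sum>\<tau>\<leftarrow>G. m - lf \<tau> else 0) + (if 0 < q \<and> q \<le> N then \<Sum>\<tau>\<leftarrow>G. rt \<tau> else 0)"
definition sv :: "nat \<Rightarrow> nat" where
  "sv q = (if q < N then \<Sum>\<tau>\<leftarrow>G. m - dn \<tau> else 0) + (if W \<le> q then \<Sum>\<tau>\<leftarrow>G. up \<tau> else 0)"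

definition target :: nat where
  "target = weigh tk th tv"

abbreviation all_items :: "(nat \<times> tile) set" where
  "all_items \<equiv> {..<N} \<times> set G"

lemma item_digits:
  assumes "fst x < N"
  shows "item x = weigh (ik x) (ih x) (iv x)"
proof -
  obtain p \<tau> where x: "x = (p, \<tau>)" by (cases x)
  let ?b = "2 ^ (3 * e) :: nat"
  have "?b ^ q * trip e (ik x q) (ih x q) (iv x q) =
      (if q = p then ?b ^ p * trip e 1 (m - lf \<tau>) (m - dn \<tau>) else 0) +
      ((if q = p + 1 then ?b ^ (p + 1) * trip e 0 (rt \<tau>) 0 else 0) +
       (if q = p + W then ?b ^ (p + W) * trip e 0 0 (up \<tau>) else 0))" for q
    using W by (auto simp: x ik_def ih_def iv_def trip_def)
  then have "weigh (ik x) (ih x) (iv x) = item x"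
    using assms W by (simp only: sum.distrib) (simp add: x item_def sum.delta)
  then show ?thesis by simp
qed

lemma sum_items:
  assumes "X \<subseteq> all_items"
  shows "(\<Sum>x\<in>X. item x) = weigh (\<lambda>q. \<Sum>x\<in>X. ik x q) (\<lambda>q. \<Sum>x\<in>X. ih x q) (\<lambda>q. \<Sum>x\<in>X. iv x q)"
proof -
  have "(\<Sum>x\<in>X. item x) = (\<Sum>x\<in>X. weigh (ik x) (ih x) (iv x))"
    using assms by (intro sum.cong refl item_digits) auto
  also have "\<dots> = (\<Sum>q<N + W. \<Sum>x\<in>X. (2 ^ (3 * e)) ^ q * trip e (ik x q) (ih x q) (iv x q))"
    by (rule sum.swap)
  finally show ?thesis by (simp add: trip_sum flip: sum_distrib_left)
qed

lemma sum_G: "(\<Sum>\<tau>\<in>set G. f \<tau>) = (\<Sum>\<tau>\<leftarrow>G. f \<tau>)"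
  using distinct_G by (simp add: sum_list_distinct_conv_sum_set)

lemma sum_all:
  assumes "q < N + W"
  shows "(\<Sum>x\<in>all_items. ik x q) = sk q" "(\<Sum>x\<in>all_items. ih x q) = sh q" "(\<Sum>x\<in>all_items. iv x q) = sv q"
proof -
  have split: "(\<Sum>x\<in>all_items. f x) = (\<Sum>p<N. \<Sum>\<tau>\<leftarrow>G. f (p, \<tau>))" for f :: "nat \<times> tile \<Rightarrow> nat"
    by (simp add: sum.cartesian_product' sum_G)
  have pull: "(\<Sum>\<tau>\<leftarrow>G. if b then f \<tau> else (0 :: nat)) = (if b then \<Sum>\<tau>\<leftarrow>G. f \<tau> else 0)" for b f
    by simp
  show "(\<Sum>x\<in>all_items. ik x q) = sk q"
    by (simp only: split ik_def case_prod_conv pull sum_shift_delta) (simp add: sk_def sum_list_triv)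
  show "(\<Sum>x\<in>all_items. ih x q) = sh q"
    by (simp only: split ih_def case_prod_conv pull sum_list_addf sum.distrib sum_shift_delta)
      (auto simp: sh_def)
  show "(\<Sum>x\<in>all_items. iv x q) = sv q"
    using assms
    by (simp only: split iv_def case_prod_conv pull sum_list_addf sum.distrib sum_shift_delta)
      (auto simp: sv_def)
qed

lemma sum_graph:
  assumes "q < N + W"
  defines "X \<equiv> \<lambda>\<gamma>. (\<lambda>p. (p, \<gamma> p)) ` {..<N}"
  shows "(\<Sum>x\<in>X \<gamma>. ik x q) = tk q"
    and "(\<Sum>x\<in>X \<gamma>. ih x q) = (if q < N then m - lf (\<gamma> q) else 0) + (if 0 < q \<and> q \<le> N then rt (\<gamma> (q - 1)) else 0)"
    and "(\<Sum>x\<in>X \<gamma>. iv x q) = (if q < N then m - dn (\<gamma> q) else 0) + (if W \<le> q then up (\<gamma> (q - W)) else 0)"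
proof -
  have split: "(\<Sum>x\<in>X \<gamma>. f x) = (\<Sum>p<N. f (p, \<gamma> p))" for f :: "nat \<times> tile \<Rightarrow> nat"
    unfolding X_def by (subst sum.reindex) (auto simp: inj_on_def)
  show "(\<Sum>x\<in>X \<gamma>. ik x q) = tk q"
    by (simp only: split ik_def case_prod_conv sum_shift_delta) (simp add: tk_def)
  show "(\<Sum>x\<in>X \<gamma>. ih x q) = (if q < N then m - lf (\<gamma> q) else 0) + (if 0 < q \<and> q \<le> N then rt (\<gamma> (q - 1)) else 0)"
    by (simp only: split ih_def case_prod_conv sum.distrib sum_shift_delta) auto
  show "(\<Sum>x\<in>X \<gamma>. iv x q) = (if q < N then m - dn (\<gamma> q) else 0) + (if W \<le> q then up (\<gamma> (q - W)) else 0)"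
    using assms(1) by (simp only: split iv_def case_prod_conv sum.distrib sum_shift_delta) auto
qed

lemma digit_bounds:
  "sk q \<le> cap" "sh q \<le> cap" "sv q \<le> cap" "tk q \<le> cap" "q < N + W \<Longrightarrow> th q \<le> m" "q < N + W \<Longrightarrow> tv q \<le> m"
  and cap_bounds: "m < cap" "2 * cap < 2 ^ e" "1 \<le> cap"
proof -
  have s: "(\<Sum>\<tau>\<leftarrow>G. f \<tau>) \<le> length G * m" if "\<And>\<tau>. \<tau> \<in> set G \<Longrightarrow> f \<tau> \<le> m" for f
  proof -
    have "(\<Sum>\<tau>\<leftarrow>G. f \<tau>) \<le> (\<Sum>\<tau>\<leftarrow>G. m)" using that by (rule sum_list_mono)
    then show ?thesis by (simp add: sum_list_triv)
  qed
  have "(\<Sum>\<tau>\<leftarrow>G. m - lf \<tau>) \<le> length G * m" "(\<Sum>\<tau>\<leftarrow>G. m - dn \<tau>) \<le> length G * m"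
    "(\<Sum>\<tau>\<leftarrow>G. rt \<tau>) \<le> length G * m" "(\<Sum>\<tau>\<leftarrow>G. up \<tau>) \<le> length G * m"
    using G by (auto intro: s)
  moreover have c: "cap = 2 * (length G * m) + 2 * length G + m + 1"
    by (simp add: cap_def algebra_simps)
  ultimately show "sk q \<le> cap" "sh q \<le> cap" "sv q \<le> cap" "tk q \<le> cap" "m < cap" "1 \<le> cap"
    by (auto simp: sk_def sh_def sv_def tk_def)
  show "q < N + W \<Longrightarrow> th q \<le> m" "q < N + W \<Longrightarrow> tv q \<le> m"
    using bounds by (auto simp: th_def tv_def)
  show "2 * cap < 2 ^ e" using e by (simp add: cap_def)
qed

lemma weigh_unique:
  assumes "weigh f g h = weigh f' g' h'" "q < N + W"
    and "\<And>q. q < N + W \<Longrightarrow> f q < 2 ^ e \<and> g q < 2 ^ e \<and> h q < 2 ^ e"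
    and "\<And>q. q < N + W \<Longrightarrow> f' q < 2 ^ e \<and> g' q < 2 ^ e \<and> h' q < 2 ^ e"
  shows "f q = f' q \<and> g q = g' q \<and> h q = h' q"
proof -
  have "trip e (f q) (g q) (h q) = trip e (f' q) (g' q) (h' q)"
    by (rule digits_unique[OF _ _ assms(1,2)]; rule trip_less) (use assms(3,4) in auto)
  then show ?thesis by (rule trip_inj) (use assms(2-4) in auto)
qed

lemma target_less: "q < N + W \<Longrightarrow> tk q < 2 ^ e \<and> th q < 2 ^ e \<and> tv q < 2 ^ e"
  using digit_bounds[of q] cap_bounds by linarith

text \<open>With one tile per cell no digit exceeds \<open>2 * m\<close>, so equality of the numbers
  splits into one equation per digit, and each equation says that one edge matches its neighbour or
  the boundary.\<close>

lemma sum_graph_target_iff: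
  assumes "\<And>p. p < N \<Longrightarrow> \<gamma> p \<in> set G"
  shows "(\<Sum>x\<in>(\<lambda>p. (p, \<gamma> p)) ` {..<N}. item x) = target \<longleftrightarrow> tiles \<gamma>"
proof -
  let ?X = "(\<lambda>p. (p, \<gamma> p)) ` {..<N}"
  let ?h = "\<lambda>q. (if q < N then m - lf (\<gamma> q) else 0) + (if 0 < q \<and> q \<le> N then rt (\<gamma> (q - 1)) else 0)"
  let ?v = "\<lambda>q. (if q < N then m - dn (\<gamma> q) else 0) + (if W \<le> q then up (\<gamma> (q - W)) else 0)"
  have X: "?X \<subseteq> all_items" using assms by auto
  have eq: "(\<Sum>x\<in>?X. item x) = weigh tk ?h ?v"
    unfolding sum_items[OF X] by (intro sum.cong refl) (simp add: sum_graph)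
  have G': "lf (\<gamma> p) \<le> m" "rt (\<gamma> p) \<le> m" "dn (\<gamma> p) \<le> m" "up (\<gamma> p) \<le> m" if "p < N" for p
    using G[OF assms[OF that]] by auto
  have small: "tk q < 2 ^ e \<and> ?h q < 2 ^ e \<and> ?v q < 2 ^ e" if q: "q < N + W" for q
  proof -
    have "rt (\<gamma> (q - 1)) \<le> m" if "0 < q" "q \<le> N" using G'(2)[of "q - 1"] that by simp
    then have "?h q \<le> 2 * m" by (auto simp: mult_2 intro: add_mono)
    moreover have "up (\<gamma> (q - W)) \<le> m" if "W \<le> q" using G'(4)[of "q - W"] that q by simp
    then have "?v q \<le> 2 * m" by (auto simp: mult_2 intro: add_mono)
    ultimately show ?thesis using cap_bounds target_less[OF q] by linarith
  qed
  have "(\<Sum>x\<in>?X. item x) = target \<longleftrightarrow> (\<forall>q < N + W. ?h q = th q \<and> ?v q = tv q)"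
    unfolding eq target_def
  proof
    assume "weigh tk ?h ?v = weigh tk th tv"
    from weigh_unique[OF this _ small target_less] show "\<forall>q < N + W. ?h q = th q \<and> ?v q = tv q"
      by blast
  qed (auto intro!: sum.cong)
  also have "\<dots> \<longleftrightarrow> tiles \<gamma>"
  proof
    assume *: "\<forall>q < N + W. ?h q = th q \<and> ?v q = tv q"
    have h: "?h q = th q" and v: "?v q = tv q" if "q < N + W" for q using * that by auto
    have "m - lf (\<gamma> 0) = m - l0" using h[of 0] W by (simp add: th_def)
    then have "lf (\<gamma> 0) = l0" using G'(1)[of 0] bounds(1) W by linarith
    moreover have "lf (\<gamma> p) = rt (\<gamma> (p - 1))" if "0 < p" "p < N" for p
    proof -
      have "m - lf (\<gamma> p) + rt (\<gamma> (p - 1)) = m" using h[of p] that by (simp add: th_def)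
      then show ?thesis using G'(1)[OF that(2)] by linarith
    qed
    moreover have "rt (\<gamma> (N - 1)) = r0" using h[of N] W by (simp add: th_def)
    moreover have "dn (\<gamma> p) = (if p < W then dn0 p else up (\<gamma> (p - W)))" if "p < N" for p
    proof (cases "p < W")
      case True
      then have "m - dn (\<gamma> p) = m - dn0 p" using v[of p] that by (simp add: tv_def)
      then show ?thesis using G'(3)[OF that] bounds(4)[OF True] True by simp
    next
      case False
      then have "m - dn (\<gamma> p) + up (\<gamma> (p - W)) = m" using v[of p] that by (simp add: tv_def)
      then show ?thesis using G'(3)[OF that] False by simp
    qed
    moreover have "up (\<gamma> p) = t0" if "N - W \<le> p" "p < N" for p
    proof -
      have "p + W < N + W" "\<not> p + W < N" "\<not> p + W < W" using that W by linarith+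
      then show ?thesis using v[of "p + W"] by (simp add: tv_def)
    qed
    ultimately show "tiles \<gamma>" using assms by (simp add: tiles_def)
  next
    assume t: "tiles \<gamma>"
    show "\<forall>q < N + W. ?h q = th q \<and> ?v q = tv q"
    proof (intro allI impI conjI)
      fix q assume q: "q < N + W"
      show "?h q = th q"
        using t W G'[of q] by (auto simp: tiles_def th_def)
      show "?v q = tv q"
      proof (cases "q < N")
        case True
        then have d: "dn (\<gamma> q) = (if q < W then dn0 q else up (\<gamma> (q - W)))"
          using t unfolding tiles_def by blast
        show ?thesis using G'(3)[OF True] True d by (cases "q < W") (simp_all add: tv_def)
      next
        case False
        then have "N - W \<le> q - W" "q - W < N" using q W by linarith+
        then have "up (\<gamma> (q - W)) = t0" using t unfolding tiles_def by blast
        then show ?thesis using False W by (simp add: tv_def)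
      qed
    qed
  qed
  finally show ?thesis .
qed

text \<open>No subset of the items causes a carry. The counting digits of the target therefore force
  exactly one item per cell, and the subset is the graph of a placement.\<close>

lemma subset_target_iff: "(\<exists>X \<subseteq> all_items. (\<Sum>x\<in>X. item x) = target) \<longleftrightarrow> (\<exists>\<gamma>. tiles \<gamma>)"
proof
  assume "\<exists>\<gamma>. tiles \<gamma>"
  then obtain \<gamma> where t: "tiles \<gamma>" by blast
  then have g: "\<gamma> p \<in> set G" if "p < N" for p using that by (simp add: tiles_def)
  then have "(\<lambda>p. (p, \<gamma> p)) ` {..<N} \<subseteq> all_items" by auto
  moreover have "(\<Sum>x\<in>(\<lambda>p. (p, \<gamma> p)) ` {..<N}. item x) = target"
    using t sum_graph_target_iff[of \<gamma>] g by simp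
  ultimately show "\<exists>X \<subseteq> all_items. (\<Sum>x\<in>X. item x) = target" by (intro exI conjI)
next
  assume "\<exists>X \<subseteq> all_items. (\<Sum>x\<in>X. item x) = target"
  then obtain X where X: "X \<subseteq> all_items" "(\<Sum>x\<in>X. item x) = target" by blast
  have fin: "finite X" using X(1) finite_subset by blast
  have small: "(\<Sum>x\<in>X. ik x q) < 2 ^ e \<and> (\<Sum>x\<in>X. ih x q) < 2 ^ e \<and> (\<Sum>x\<in>X. iv x q) < 2 ^ e"
    if q: "q < N + W" for q
  proof -
    have "(\<Sum>x\<in>X. f x) \<le> (\<Sum>x\<in>all_items. f x)" for f :: "nat \<times> tile \<Rightarrow> nat"
      using X(1) by (intro sum_mono2) auto
    from this[of "\<lambda>x. ik x q"] this[of "\<lambda>x. ih x q"] this[of "\<lambda>x. iv x q"]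
    show ?thesis using sum_all[OF q] digit_bounds[of q] cap_bounds by linarith
  qed
  have eq: "weigh (\<lambda>q. \<Sum>x\<in>X. ik x q) (\<lambda>q. \<Sum>x\<in>X. ih x q) (\<lambda>q. \<Sum>x\<in>X. iv x q) = weigh tk th tv"
    using X(2) unfolding sum_items[OF X(1)] target_def .
  have one: "\<exists>!\<tau>. (p, \<tau>) \<in> X" if p: "p < N" for p
  proof -
    have "(\<Sum>x\<in>X. ik x p) = tk p"
      using weigh_unique[OF eq _ small target_less, of p] p by simp
    moreover have "(\<Sum>x\<in>X. ik x p) = card {x \<in> X. fst x = p}"
      using fin by (simp add: ik_def split_def sum.If_cases Int_def eq_commute[of p])
    ultimately have "card {x \<in> X. fst x = p} = 1" using p by (simp add: tk_def)
    then obtain x where x: "{x \<in> X. fst x = p} = {x}" by (rule card_1_singletonE)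
    show ?thesis
    proof (rule ex1I[of _ "snd x"])
      show "(p, snd x) \<in> X" using x by force
      show "\<tau> = snd x" if "(p, \<tau>) \<in> X" for \<tau> using x that by force
    qed
  qed
  define \<gamma> where "\<gamma> p = (THE \<tau>. (p, \<tau>) \<in> X)" for p
  have \<gamma>: "(p, \<gamma> p) \<in> X" if "p < N" for p
    unfolding \<gamma>_def using theI'[OF one[OF that]] .
  have Xeq: "X = (\<lambda>p. (p, \<gamma> p)) ` {..<N}"
  proof
    show "X \<subseteq> (\<lambda>p. (p, \<gamma> p)) ` {..<N}"
    proof
      fix x assume x: "x \<in> X"
      then have p: "fst x < N" using X(1) by auto
      have "snd x = \<gamma> (fst x)" using one[OF p] \<gamma>[OF p] x by (metis prod.collapse)
      then show "x \<in> (\<lambda>p. (p, \<gamma> p)) ` {..<N}" using p by (intro image_eqI[of _ _ "fst x"]) (auto simp: prod_eq_iff)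
    qed
  qed (use \<gamma> in auto)
  have g: "\<gamma> p \<in> set G" if "p < N" for p using subsetD[OF X(1) \<gamma>[OF that]] by simp
  have "sum item ((\<lambda>p. (p, \<gamma> p)) ` {..<N}) = target" using arg_cong[OF Xeq, of "sum item"] X(2) by metis
  moreover have "sum item ((\<lambda>p. (p, \<gamma> p)) ` {..<N}) = target \<longleftrightarrow> tiles \<gamma>"
    by (rule sum_graph_target_iff) (rule g)
  ultimately have "tiles \<gamma>" by (rule iffD1[rotated])
  then show "\<exists>\<gamma>. tiles \<gamma>" by blast
qed

section \<open>The ConsComp instance belonging to a tiling problem\<close>

definition items :: "int list" where
  "items = map (\<lambda>x. int (item x)) (List.product [0..<N] G)"

text \<open>These are \<open>Z\<close>, \<open>Z - T\<close> and \<open>Z - S + T\<close>. The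
  leading power makes \<open>Z\<close> exceed both \<open>S\<close> and \<open>T\<close> and gives
  all three numbers the same leading 1; the offset \<open>cap\<close> lets target and total be
  subtracted digit by digit without borrowing.\<close>

definition big :: nat where
  "big = (2 ^ (3 * e)) ^ (N + W) + weigh (\<lambda>_. cap) (\<lambda>_. cap) (\<lambda>_. cap)"
definition fill1 :: nat where
  "fill1 = (2 ^ (3 * e)) ^ (N + W) + weigh (\<lambda>q. cap - tk q) (\<lambda>q. cap - th q) (\<lambda>q. cap - tv q)"
definition fill2 :: nat where
  "fill2 = (2 ^ (3 * e)) ^ (N + W) +
     weigh (\<lambda>q. cap - sk q + tk q) (\<lambda>q. cap - sh q + th q) (\<lambda>q. cap - sv q + tv q)"

definition family :: "int list" where
  "family = items @ [int fill1, int fill2, - int big, - int big]"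

lemma weigh_add: "weigh f g h + weigh f' g' h' = weigh (\<lambda>q. f q + f' q) (\<lambda>q. g q + g' q) (\<lambda>q. h q + h' q)"
  by (simp only: trip_add flip: sum.distrib distrib_left)

lemma sum_list_items: "sum_list items = int (weigh sk sh sv)"
proof -
  have "sum_list items = int (\<Sum>x\<in>all_items. item x)"
    using distinct_G unfolding items_def
    by (subst sum_list_distinct_conv_sum_set) (auto simp: distinct_product atLeast0LessThan)
  also have "(\<Sum>x\<in>all_items. item x) = weigh sk sh sv"
    by (subst sum_items) (auto intro!: sum.cong simp: sum_all)
  finally show ?thesis .
qed

lemma fill1: "fill1 + target = big"
proof -
  have "th q \<le> cap \<and> tv q \<le> cap \<and> tk q \<le> cap" if "q < N + W" for q
    using digit_bounds[of q] cap_bounds that by linarith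
  then show ?thesis unfolding fill1_def target_def big_def
    by (auto simp: weigh_add add.assoc intro!: sum.cong)
qed

lemma fill2: "fill2 + weigh sk sh sv = big + target"
proof -
  have "cap - sk q + (tk q + sk q) = cap + tk q \<and> cap - sh q + (th q + sh q) = cap + th q \<and>
      cap - sv q + (tv q + sv q) = cap + tv q" for q
    using digit_bounds(1-3)[of q] by linarith
  then show ?thesis unfolding fill2_def target_def big_def by (simp only: weigh_add add.assoc)
qed

theorem conscomp_family: "conscomp_instance family (int big) \<and> (conscomp_solvable family (int big) \<longleftrightarrow> (\<exists>\<gamma>. tiles \<gamma>))"
proof -
  let ?b = "2 ^ (3 * e) :: nat"
  have less: "weigh f g h < ?b ^ (N + W)"
    if "\<And>q. q < N + W \<Longrightarrow> f q < 2 ^ e \<and> g q < 2 ^ e \<and> h q < 2 ^ e" for f g h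
    by (rule digits_less) (use that trip_less in auto)
  have T: "target < big" using less[of tk th tv] target_less by (simp add: target_def big_def)
  have S: "weigh sk sh sv < big"
  proof -
    have "weigh sk sh sv < ?b ^ (N + W)"
    proof (rule less)
      fix q
      show "sk q < 2 ^ e \<and> sh q < 2 ^ e \<and> sv q < 2 ^ e"
        using digit_bounds(1-3)[of q] cap_bounds by linarith
    qed
    then show ?thesis by (simp add: big_def)
  qed
  have S': "sum_list items < int big" using S sum_list_items by linarith
  have f: "int fill1 = int big - int target" "int fill2 = int big - sum_list items + int target"
    using fill1 fill2 sum_list_items by linarith+
  have pos: "0 < x" if "x \<in> set items" for x
  proof -
    from that obtain y where "x = int (item y)" by (auto simp: items_def)
    moreover have "0 < item y" by (auto simp: item_def trip_def split: prod.split)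
    ultimately show ?thesis by simp
  qed
  have "mset items = image_mset (\<lambda>x. int (item x)) (mset_set (set (List.product [0..<N] G)))"
    using distinct_G mset_set_set[of "List.product [0..<N] G"]
    by (simp add: items_def distinct_product del: set_product)
  then have ms: "mset items = image_mset (\<lambda>x. int (item x)) (mset_set all_items)"
    by (simp add: atLeast0LessThan)
  have sub: "(\<exists>M. M \<subseteq># mset items \<and> sum_mset M = int target) \<longleftrightarrow> (\<exists>X \<subseteq> all_items. (\<Sum>x\<in>X. item x) = target)"
  proof
    assume "\<exists>M. M \<subseteq># mset items \<and> sum_mset M = int target"
    then obtain M where M: "M \<subseteq># mset items" "sum_mset M = int target" by blast
    then obtain X where X: "X \<subseteq> all_items" "M = image_mset (\<lambda>x. int (item x)) (mset_set X)"
      using subset_image_mset_ex[of all_items M] unfolding ms by auto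
    have "sum_mset M = int (\<Sum>x\<in>X. item x)" unfolding X(2) by (simp add: sum_unfold_sum_mset image_mset.compositionality comp_def)
    then have "(\<Sum>x\<in>X. item x) = target" using M(2) by linarith
    then show "\<exists>X \<subseteq> all_items. (\<Sum>x\<in>X. item x) = target" using X(1) by (intro exI[of _ X] conjI)
  next
    assume "\<exists>X \<subseteq> all_items. (\<Sum>x\<in>X. item x) = target"
    then obtain X where X: "X \<subseteq> all_items" "(\<Sum>x\<in>X. item x) = target" by blast
    have "image_mset (\<lambda>x. int (item x)) (mset_set X) \<subseteq># mset items"
      unfolding ms using X(1) by (intro image_mset_subseteq_mono subset_imp_msubset_mset_set) auto
    moreover have "sum_mset (image_mset (\<lambda>x. int (item x)) (mset_set X)) = int target"
      using X(2) by (simp flip: sum_unfold_sum_mset of_nat_sum)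
    ultimately show "\<exists>M. M \<subseteq># mset items \<and> sum_mset M = int target" by blast
  qed
  have "conscomp_solvable family (int big) \<longleftrightarrow> (\<exists>M. M \<subseteq># mset items \<and> sum_mset M = int target)"
    unfolding family_def f
    by (rule conscomp_subset_sum) (use pos T S' in auto)
  moreover have "conscomp_instance family (int big)"
    using T f by (simp add: conscomp_instance_def family_def)
  ultimately show ?thesis using sub subset_target_iff by simp
qed

end

section \<open>Computations as locally constrained words\<close>

text \<open>A computation is written row by row, each row ending with \<open>Hash\<close>.  A letter
  \<open>Pre x f o\<close> shows the symbol \<open>x\<close> of the input, whether the certificate may extend over this
  position and whether the position is the origin; \<open>Guess\<close> adds the guessed symbol of the
  certificate.  In \<open>Cell q as cs\<close> every tape contributes its symbol and the presence of its head,
  \<open>q\<close> is the state, and \<open>as\<close> is a guess, shared by the whole row, of the symbols under the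
  heads.\<close>

datatype letter =
    Hash
  | Done
  | Pre nat bool bool
  | Guess nat nat bool
  | Cell nat "nat list" "(nat \<times> bool) list"

instance letter :: countable
  by countable_datatype

locale ntm =
  fixes M :: tm
  assumes wf: "wf_tm M" and tapes: "2 \<le> tapes M"
begin

text \<open>With halting states made stationary, one local rule describes a run of any prescribed
  length.\<close>

definition eff :: "nat \<Rightarrow> nat list \<Rightarrow> nat \<times> (nat \<times> move) list" where
  "eff q as = (if q \<in> {accept M, reject M} then (q, keep as) else delta M q as)"

lemma step_eff:
  "step M (q, ts) = (fst (eff q (map read ts)), map2 act (snd (eff q (map read ts))) ts)"
  by (simp add: step_def halted_def eff_def act_keep split: prod.split)

lemma eff_wf:
  assumes "q < states M" "length as = tapes M" "set as \<subseteq> {..<symbols M}"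
  shows "fst (eff q as) < states M \<and> length (snd (eff q as)) = tapes M \<and>
    (\<forall>(b, m) \<in> set (snd (eff q as)). b < symbols M)"
proof (cases "q \<in> {accept M, reject M}")
  case True
  then have "eff q as = (q, keep as)" by (simp add: eff_def)
  moreover have "\<forall>(b, m) \<in> set (keep as). b < symbols M" using assms(3) by (auto simp: keep_def)
  ultimately show ?thesis using assms(1,2) by simp
next
  case False
  have "case delta M q as of (q', acts) \<Rightarrow>
      q' < states M \<and> length acts = tapes M \<and> (\<forall>(b, m) \<in> set acts. b < symbols M)"
    using wf[unfolded wf_tm_def] assms by simp
  moreover have "eff q as = delta M q as" using False by (simp add: eff_def)
  ultimately show ?thesis by (simp add: split_def)
qed

fun flag :: "letter \<Rightarrow> nat \<Rightarrow> bool" where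
  "flag (Cell q as cs) j = snd (cs ! j)"
| "flag _ j = False"

definition newcell :: "letter \<Rightarrow> letter \<Rightarrow> (nat \<times> bool) list \<Rightarrow> (nat \<times> move) list \<Rightarrow> nat \<Rightarrow> nat \<times> bool" where
  "newcell l r cs acts j =
    (if snd (cs ! j) then fst (acts ! j) else fst (cs ! j),
     snd (cs ! j) \<and> snd (acts ! j) = Stay \<or> flag l j \<and> snd (acts ! j) = MoveRight \<or>
     flag r j \<and> snd (acts ! j) = MoveLeft)"

definition initcells :: "nat \<Rightarrow> nat \<Rightarrow> bool \<Rightarrow> (nat \<times> bool) list" where
  "initcells x y o' = map (\<lambda>j. (if j = 0 then x else if j = 1 then y else 0, o')) [0..<tapes M]"

text \<open>The rows are one of \<open>Pre\<close>, one of \<open>Guess\<close>, then the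
  configurations, and \<open>Done\<close> on top. A nonblank guess must stand at the origin or to
  the right of another one, so the guesses form a single word. \<open>Done\<close> appears in the
  tape columns only above an accepting configuration and nothing may stand above it, which fixes it
  to the top.\<close>

fun R :: "letter \<Rightarrow> letter \<Rightarrow> letter \<Rightarrow> letter \<Rightarrow> bool" where
  "R l Hash r u \<longleftrightarrow> u = Hash \<or> u = Done"
| "R l Done r u \<longleftrightarrow> False"
| "R l (Pre x f o') r u \<longleftrightarrow> (\<exists>y. u = Guess x y o' \<and> (\<not> f \<longrightarrow> y = 0))"
| "R l (Guess x y o') r u \<longleftrightarrow>
    (y \<noteq> 0 \<longrightarrow> o' \<or> (\<exists>x' y' o''. l = Guess x' y' o'' \<and> y' \<noteq> 0)) \<and>
    (\<exists>as. u = Cell (start M) as (initcells x y o'))"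
| "R l (Cell q as cs) r u \<longleftrightarrow>
    (\<forall>j < tapes M. snd (cs ! j) \<longrightarrow> fst (cs ! j) = as ! j) \<and>
    (\<forall>q' as' cs'. l = Cell q' as' cs' \<longrightarrow> as' = as) \<and>
    (u = Done \<and> q = accept M \<or>
     (\<exists>as'. u = Cell (fst (eff q as)) as' (map (newcell l r cs (snd (eff q as))) [0..<tapes M])))"

definition letters :: "letter set" where
  "letters = {Hash, Done} \<union> (\<lambda>(x, f, b). Pre x f b) ` ({..<3} \<times> UNIV) \<union>
     (\<lambda>(x, y, b). Guess x y b) ` ({..<3} \<times> {..<3} \<times> UNIV) \<union>
     (\<lambda>(q, as, cs). Cell q as cs) ` ({..<states M} \<times> {as. set as \<subseteq> {..<symbols M} \<and> length as = tapes M} \<times>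
       {cs. set cs \<subseteq> {..<symbols M} \<times> UNIV \<and> length cs = tapes M})"

lemma finite_letters: "finite letters"
  unfolding letters_def by (intro finite_UnI finite_imageI finite_cartesian_product finite_lists_length_eq) auto

definition cells :: "tape list \<Rightarrow> int \<Rightarrow> (nat \<times> bool) list" where
  "cells ts i = map (\<lambda>(c, h). (c i, h = i)) ts"

text \<open>The bound on the head positions keeps the heads within the margins of \<open>T\<close>
  columns on either side, so that cutting the tapes off to finite rows loses no head.\<close>

definition good :: "nat \<Rightarrow> config \<Rightarrow> bool" where
  "good t cfg \<longleftrightarrow> fst cfg < states M \<and> length (snd cfg) = tapes M \<and>
     (\<forall>(c, h) \<in> set (snd cfg). (\<forall>i. c i < symbols M) \<and> \<bar>h\<bar> \<le> int t)"

lemma good_reads: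
  assumes "good t cfg"
  shows "length (map read (snd cfg)) = tapes M" "set (map read (snd cfg)) \<subseteq> {..<symbols M}"
  using assms by (auto simp: good_def)

lemma good_step:
  assumes "good t cfg"
  shows "good (Suc t) (step M cfg)"
proof -
  obtain q ts where cfg: "cfg = (q, ts)" by (cases cfg)
  obtain q' acts where e: "eff q (map read ts) = (q', acts)" by fastforce
  have w: "q' < states M" "length acts = tapes M" "\<And>b m. (b, m) \<in> set acts \<Longrightarrow> b < symbols M"
    using eff_wf[of q "map read ts"] good_reads[OF assms] assms e by (auto simp: good_def cfg)
  have "(\<forall>i. c i < symbols M) \<and> \<bar>h\<bar> \<le> int (Suc t)" if "(c, h) \<in> set (map2 act acts ts)" for c h
  proof -
    from that obtain a tp where a: "(a, tp) \<in> set (zip acts ts)" "(c, h) = act a tp" by auto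
    obtain b m c' h' where p: "a = (b, m)" "tp = (c', h')" by (meson surj_pair)
    have b: "b < symbols M" using w(3) a(1) p by (meson set_zip_leftD)
    have "(\<forall>i. c' i < symbols M) \<and> \<bar>h'\<bar> \<le> int t"
      using assms a(1) p unfolding good_def cfg by (fastforce dest: set_zip_rightD)
    then show ?thesis using a(2) p b by (cases m) auto
  qed
  then have "\<forall>(c, h) \<in> set (map2 act acts ts). (\<forall>i. c i < symbols M) \<and> \<bar>h\<bar> \<le> int (Suc t)" by blast
  then show ?thesis using w(1,2) e assms by (simp add: good_def cfg step_eff del: set_map)
qed

lemma good_run: "good t (run M ws t)"
proof (induction t)
  case 0
  show ?case using wf by (auto simp: good_def run_def init_def contents_def wf_tm_def)
next
  case (Suc t)
  then show ?case using good_step by (simp add: run_def)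
qed

lemma cells_step:
  assumes "length ts = tapes M" "length (snd (eff q (map read ts))) = tapes M"
    and "\<And>j. j < tapes M \<Longrightarrow> flag l j \<longleftrightarrow> snd (ts ! j) = i - 1"
    and "\<And>j. j < tapes M \<Longrightarrow> flag r j \<longleftrightarrow> snd (ts ! j) = i + 1"
  shows "map (newcell l r (cells ts i) (snd (eff q (map read ts)))) [0..<tapes M] =
    cells (snd (step M (q, ts))) i"
proof (rule nth_equalityI)
  let ?a = "snd (eff q (map read ts))"
  fix j assume "j < length (map (newcell l r (cells ts i) ?a) [0..<tapes M])"
  then have j: "j < tapes M" by simp
  obtain c h b m where p: "ts ! j = (c, h)" "?a ! j = (b, m)" by (meson surj_pair)
  have "newcell l r (cells ts i) ?a j = (\<lambda>(c, h). (c i, h = i)) (act (b, m) (c, h))"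
    using assms j p by (cases m) (auto simp: newcell_def cells_def)
  then show "map (newcell l r (cells ts i) ?a) [0..<tapes M] ! j = cells (snd (step M (q, ts))) i ! j"
    using assms(1,2) j p by (simp add: cells_def step_eff)
qed (use assms in \<open>simp add: cells_def step_eff\<close>)

end

lemma (in ntm) letters_intros:
  "Hash \<in> letters" "Done \<in> letters"
  "a < 3 \<Longrightarrow> Pre a f b \<in> letters"
  "a < 3 \<Longrightarrow> a' < 3 \<Longrightarrow> Guess a a' b \<in> letters"
  unfolding letters_def
  by (simp, simp, intro UnI1 UnI2[of _ _ "{Hash, Done}"] image_eqI[of _ _ "(a, f, b)"], simp, simp,
    intro UnI1 UnI2[of _ "(\<lambda>(x, y, b). Guess x y b) ` ({..<3} \<times> {..<3} \<times> UNIV)"]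
      image_eqI[of _ _ "(a, a', b)"]) auto

lemma (in ntm) good_head:
  assumes "good t cfg" "j < tapes M"
  shows "\<bar>snd (snd cfg ! j)\<bar> \<le> int t"
proof -
  have "snd cfg ! j \<in> set (snd cfg)" using assms by (simp add: good_def)
  then have "case snd cfg ! j of (c, h) \<Rightarrow> (\<forall>i. c i < symbols M) \<and> \<bar>h\<bar> \<le> int t"
    using assms(1) unfolding good_def by (elim conjE) (rule bspec)
  then show ?thesis by (simp add: split_def)
qed

text \<open>\<open>T\<close> is the number of steps and \<open>n\<close> the maximal length of the certificate; column \<open>V\<close>
  is the origin and column \<open>E\<close> contains the separators.\<close>

locale history = ntm +
  fixes x :: "bool list" and n T V E :: nat
  assumes V: "T < V" and E: "V + T < E" "V + n < E"
begin

abbreviation W :: nat where "W \<equiv> Suc E"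
abbreviation N :: nat where "N \<equiv> (T + 3) * W"

definition bot :: "nat \<Rightarrow> letter" where
  "bot c = (if c < E then Pre (contents x (int c - int V)) (V \<le> c \<and> c < V + n) (c = V) else Hash)"

text \<open>Position 0 is treated as if a separator preceded it, as is the case at the start of
  every later row of the helix.\<close>

definition prev :: "(nat \<Rightarrow> letter) \<Rightarrow> nat \<Rightarrow> letter" where
  "prev w p = (if p = 0 then Hash else w (p - 1))"

definition word :: "(nat \<Rightarrow> letter) \<Rightarrow> bool" where
  "word w \<longleftrightarrow> (\<forall>c < W. w c = bot c) \<and> w (N - 1) = Hash \<and> (\<forall>p. N \<le> p \<and> p < N + W \<longrightarrow> w p = Done) \<and>
     (\<forall>p < N + W. w p \<in> letters) \<and> (\<forall>p < N. R (prev w p) (w p) (w (Suc p)) (w (p + W)))"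

lemma row_less: "r < T + 3 \<Longrightarrow> c < W \<Longrightarrow> r * W + c < N"
proof -
  assume "r < T + 3" "c < W"
  then have "Suc r * W \<le> N" by (intro mult_le_mono1) simp
  then show ?thesis using \<open>c < W\<close> by simp
qed

text \<open>The certificate is read off row 1; induction on \<open>t\<close> shows that row
  \<open>t + 2\<close> displays configuration \<open>t\<close> of the run with this certificate, and
  the \<open>Done\<close> above row \<open>T + 2\<close> shows acceptance.\<close>

lemma word_sound:
  assumes "word w"
  shows "\<exists>u. length u \<le> n \<and> fst (run M [x, u] T) = accept M"
proof -
  define cell where "cell r c = w (r * W + c)" for r c
  define left where "left r c = (if c = 0 then Hash else cell r (c - 1))" for r c
  have R0: "R (prev w (r * W + c)) (cell r c) (w (Suc (r * W + c))) (cell (Suc r) c)"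
    if "r < T + 3" "c < W" for r c
  proof -
    have "r * W + c + W = Suc r * W + c" by simp
    then show ?thesis using assms row_less[OF that] unfolding word_def cell_def by metis
  qed
  have not_Done: "cell r c \<noteq> Done" if "r < T + 3" "c < W" for r c
    using R0[OF that] by auto
  have hash: "cell r E = Hash" if "r < T + 3" for r
    using that
  proof (induction r)
    case 0
    then show ?case using assms by (simp add: cell_def word_def bot_def)
  next
    case (Suc r)
    then show ?case using R0[of r E] not_Done[of "Suc r" E] by simp
  qed
  have Rc: "R (left r c) (cell r c) (cell r (Suc c)) (cell (Suc r) c)" if "r < T + 3" "c < E" for r c
  proof -
    have "prev w (r * W + c) = left r c"
    proof (cases "c = 0")
      case True
      show ?thesis
      proof (cases r)
        case (Suc r')
        have "w (r' * W + E) = Hash" using hash[of r'] that Suc by (simp add: cell_def)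
        then show ?thesis using True Suc by (simp add: prev_def left_def add_ac)
      qed (use True in \<open>simp add: prev_def left_def\<close>)
    qed (simp add: prev_def left_def cell_def)
    then show ?thesis using R0[of r c] that by (simp add: cell_def)
  qed
  have letters: "cell r c \<in> letters" if "r < T + 3" "c < W" for r c
    using assms row_less[OF that] by (simp add: word_def cell_def)
  define pos where "pos c = int c - int V" for c
  have row0: "cell 0 c = Pre (contents x (pos c)) (V \<le> c \<and> c < V + n) (c = V)" if "c < E" for c
    using assms that by (simp add: word_def cell_def bot_def pos_def)
  have "\<exists>y. cell 1 c = Guess (contents x (pos c)) y (c = V) \<and> (\<not> (V \<le> c \<and> c < V + n) \<longrightarrow> y = 0)"
    if "c < E" for c
    using Rc[of 0 c] row0[OF that] that by simp
  then obtain y where y: "\<And>c. c < E \<Longrightarrow> cell 1 c = Guess (contents x (pos c)) (y c) (c = V)"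
    "\<And>c. c < E \<Longrightarrow> \<not> (V \<le> c \<and> c < V + n) \<Longrightarrow> y c = 0" by metis
  have y3: "y c < 3" if "c < E" for c
    using letters[of 1 c] y(1)[OF that] that by (auto simp: letters_def)
  have R1: "(y c \<noteq> 0 \<longrightarrow> c = V \<or> (\<exists>x' y' o'. left 1 c = Guess x' y' o' \<and> y' \<noteq> 0)) \<and>
      (\<exists>as. cell 2 c = Cell (start M) as (initcells (contents x (pos c)) (y c) (c = V)))" if "c < E" for c
    using Rc[of 1 c] y(1)[OF that] that by (simp add: numeral_2_eq_2)
  \<comment> \<open>The first blank among the guesses, counted from the origin, ends the
    certificate; it occurs at \<open>n\<close> at the latest, where guessing is no longer
    allowed.\<close>
  define L where "L = (LEAST d. y (V + d) = 0)"
  have "y (V + n) = 0" using y(2)[of "V + n"] E by simp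
  then have L0: "y (V + L) = 0" and Ln: "L \<le> n" unfolding L_def by (auto intro: LeastI Least_le)
  have below: "y (V + d) \<noteq> 0" if "d < L" for d using not_less_Least that unfolding L_def by blast
  have above: "y (V + d) = 0" if "L \<le> d" "V + d < E" for d
    using that
  proof (induction d rule: dec_induct)
    case base
    then show ?case using L0 by simp
  next
    case (step d)
    then have "y (V + d) = 0" "cell 1 (V + d) = Guess (contents x (pos (V + d))) (y (V + d)) (V + d = V)"
      using y(1)[of "V + d"] by auto
    then show ?case using R1[of "V + Suc d"] step.prems by (auto simp: left_def)
  qed
  define u where "u = map (\<lambda>d. y (V + d) = 2) [0..<L]"
  have cu: "contents u (pos c) = y c" if c: "c < E" for c
  proof (cases "V \<le> c \<and> c < V + L")
    case True
    then obtain d where d: "c = V + d" "d < L" using less_imp_add_positive[of c "V + L"] by (metis le_Suc_ex nat_add_left_cancel_less)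
    then have "y c = 1 \<or> y c = 2" using below[of d] y3[OF c] by (auto simp: less_Suc_eq numeral_3_eq_3)
    then show ?thesis using d by (auto simp: contents_def u_def pos_def)
  next
    case False
    then have "y c = 0" using above[of "c - V"] y(2)[OF c] c by (cases "V \<le> c") auto
    then show ?thesis using False by (auto simp: contents_def u_def pos_def)
  qed
  let ?cfg = "\<lambda>t. run M [x, u] t"
  have main: "\<exists>as. cell (t + 2) c = Cell (fst (?cfg t)) as (cells (snd (?cfg t)) (pos c)) \<and> length as = tapes M"
    if "t \<le> T" "c < E" for t c
    using that
  proof (induction t arbitrary: c)
    case 0
    obtain as where as: "cell 2 c = Cell (start M) as (initcells (contents x (pos c)) (y c) (c = V))"
      using R1[OF 0(2)] by blast
    have "length as = tapes M" using letters[of 2 c] as 0 by (auto simp: letters_def)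
    moreover have "initcells (contents x (pos c)) (y c) (c = V) = cells (snd (?cfg 0)) (pos c)"
      using cu[OF 0(2)]
      by (auto simp: initcells_def cells_def run_def init_def nth_Cons' contents_def pos_def)
    moreover have "fst (?cfg 0) = start M" by (simp add: run_def init_def)
    ultimately show ?case using as unfolding add_0 by simp
  next
    case (Suc t)
    let ?q = "fst (?cfg t)" and ?ts = "snd (?cfg t)" and ?r = "t + 2"
    have g: "good t (?cfg t)" by (rule good_run)
    then have len: "length ?ts = tapes M" by (simp add: good_def)
    have IH: "\<exists>as. cell ?r c = Cell ?q as (cells ?ts (pos c)) \<and> length as = tapes M" if "c < E" for c
      using Suc.IH that Suc.prems by auto
    \<comment> \<open>The comparison with the left neighbour carries the guess of column 0 through
      the whole row.\<close>
    have "\<exists>as. \<forall>c < E. cell ?r c = Cell ?q as (cells ?ts (pos c)) \<and> length as = tapes M"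
    proof -
      obtain as where as: "cell ?r 0 = Cell ?q as (cells ?ts (pos 0))" "length as = tapes M"
        using IH[of 0] E by auto
      have "cell ?r c = Cell ?q as (cells ?ts (pos c))" if "c < E" for c
        using that
      proof (induction c)
        case (Suc c)
        obtain as' where as': "cell ?r (Suc c) = Cell ?q as' (cells ?ts (pos (Suc c)))"
          using IH[of "Suc c"] Suc.prems by auto
        then have "as = as'"
          using Rc[of ?r "Suc c"] Suc \<open>Suc t \<le> T\<close> by (simp add: left_def)
        then show ?case using as' by simp
      qed (use as in simp)
      then show ?thesis using as(2) by blast
    qed
    then obtain as where as: "\<And>c. c < E \<Longrightarrow> cell ?r c = Cell ?q as (cells ?ts (pos c))"
      "length as = tapes M" using E by auto
    have head: "\<bar>snd (?ts ! j)\<bar> \<le> int t" if "j < tapes M" for j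
      using good_head[OF g that] .
    have reads: "as = map read ?ts"
    proof (rule nth_equalityI)
      fix j assume "j < length as"
      then have j: "j < tapes M" using as(2) by simp
      obtain c h where ch: "?ts ! j = (c, h)" by fastforce
      \<comment> \<open>The column of the head of tape \<open>j\<close>. It lies in the row because
        \<open>\<bar>h\<bar> \<le> t\<close>, and there the rule compares the guess with the symbol
        actually read.\<close>
      define d where "d = nat (h + int V)"
      have d: "d < E" "pos d = h" using head[OF j] ch V E Suc.prems by (auto simp: d_def pos_def)
      have "cells ?ts (pos d) ! j = (c h, True)" using ch len j d by (simp add: cells_def)
      then have "c h = as ! j"
        using Rc[of ?r d] as(1)[OF d(1)] d(1) j Suc.prems by auto
      then show "as ! j = map read ?ts ! j" using ch len j by simp
    qed (use as(2) len in simp)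
    have flags: "flag (left ?r c) j \<longleftrightarrow> snd (?ts ! j) = pos c - 1"
      "flag (cell ?r (Suc c)) j \<longleftrightarrow> snd (?ts ! j) = pos c + 1" if j: "j < tapes M" for j
    proof -
      have fl: "flag (cell ?r d) j \<longleftrightarrow> snd (?ts ! j) = pos d" if "d < E" for d
        using as(1)[OF that] len j by (auto simp: cells_def split: prod.splits)
      show "flag (left ?r c) j \<longleftrightarrow> snd (?ts ! j) = pos c - 1"
      proof (cases c)
        case 0
        then have "snd (?ts ! j) \<noteq> pos c - 1" using head[OF j] V Suc.prems by (auto simp: pos_def)
        then show ?thesis using 0 by (simp add: left_def)
      next
        case (Suc c')
        then show ?thesis using fl[of c'] \<open>c < E\<close> by (simp add: left_def pos_def)
      qed
      show "flag (cell ?r (Suc c)) j \<longleftrightarrow> snd (?ts ! j) = pos c + 1"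
      proof (cases "Suc c < E")
        case True
        then show ?thesis using fl[of "Suc c"] by (simp add: pos_def algebra_simps)
      next
        case False
        then have c: "Suc c = E" using Suc.prems by simp
        then have "snd (?ts ! j) \<noteq> pos c + 1" using head[OF j] E Suc.prems by (auto simp: pos_def)
        then show ?thesis using hash[of ?r] c Suc.prems by simp
      qed
    qed
    have st: "?cfg (Suc t) = step M (?q, ?ts)" by (simp add: run_def)
    have "length (snd (eff ?q as)) = tapes M"
      using eff_wf[of ?q as] good_reads[OF g] g reads by (auto simp: good_def)
    then have new: "map (newcell (left ?r c) (cell ?r (Suc c)) (cells ?ts (pos c)) (snd (eff ?q as))) [0..<tapes M] =
        cells (snd (?cfg (Suc t))) (pos c)"
      unfolding st reads using len flags by (intro cells_step) auto
    \<comment> \<open>Row \<open>t + 3\<close> is still below the top layer and no letter may stand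
      above \<open>Done\<close>, so the accepting alternative of \<open>R\<close> is excluded
      here.\<close>
    have nd: "cell (Suc ?r) c \<noteq> Done" using not_Done Suc.prems by simp
    obtain as' where as': "cell (Suc ?r) c = Cell (fst (eff ?q as)) as' (cells (snd (?cfg (Suc t))) (pos c))"
      using Rc[of ?r c] as(1)[of c] nd Suc.prems unfolding new[symmetric] by auto
    then have "length as' = tapes M" using letters[of "Suc ?r" c] Suc.prems by (auto simp: letters_def)
    moreover have "fst (?cfg (Suc t)) = fst (eff ?q as)" unfolding st step_eff reads by simp
    ultimately show ?case using as' by simp
  qed
  have "fst (?cfg T) = accept M"
  proof -
    obtain as where as: "cell (T + 2) 0 = Cell (fst (?cfg T)) as (cells (snd (?cfg T)) (pos 0))"
      using main[of T 0] E by auto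
    have "w (N + 0) = Done" using assms unfolding word_def by simp
    moreover have "Suc (T + 2) = T + 3" by simp
    then have "cell (Suc (T + 2)) 0 = w (N + 0)" by (simp only: cell_def)
    ultimately have "cell (Suc (T + 2)) 0 = Done" by simp
    then show ?thesis using Rc[of "T + 2" 0] as E by simp
  qed
  then show ?thesis using Ln by (intro exI[of _ u]) (simp add: u_def)
qed

lemma cell_in_letters:
  assumes "good t cfg"
  shows "Cell (fst cfg) (map read (snd cfg)) (cells (snd cfg) i) \<in> letters"
proof -
  have "set (cells (snd cfg) i) \<subseteq> {..<symbols M} \<times> UNIV"
    using assms by (auto simp: cells_def good_def)
  moreover have "fst cfg < states M" "length (snd cfg) = tapes M" using assms by (auto simp: good_def)
  ultimately show ?thesis using good_reads[OF assms] unfolding letters_def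
    by (intro UnI2 image_eqI[of _ _ "(fst cfg, map read (snd cfg), cells (snd cfg) i)"])
      (auto simp: cells_def)
qed

lemma contents_less: "contents v i < 3"
  by (simp add: contents_def)

lemma word_complete:
  assumes "length u \<le> n" "fst (run M [x, u] T) = accept M"
  shows "\<exists>w. word w"
proof -
  let ?cfg = "\<lambda>t. run M [x, u] t"
  define pos where "pos c = int c - int V" for c
  \<comment> \<open>The history of the accepting run, in which all guesses are the symbols actually
    read.\<close>
  define cell where "cell r c =
    (if T + 3 \<le> r then Done else if c = E then Hash
     else if r = 0 then bot c
     else if r = 1 then Guess (contents x (pos c)) (contents u (pos c)) (c = V)
     else Cell (fst (?cfg (r - 2))) (map read (snd (?cfg (r - 2)))) (cells (snd (?cfg (r - 2))) (pos c)))" for r c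
  define w where "w p = cell (p div W) (p mod W)" for p
  have w: "w (r * W + c) = cell r c" if "c < W" for r c
    using that unfolding w_def by (simp add: div_mult_self3 del: mult_Suc_right)
  have Rc: "R (if c = 0 then Hash else cell r (c - 1)) (cell r c) (cell r (Suc c)) (cell (Suc r) c)"
    if r: "r < T + 3" and c: "c < E" for r c
  proof -
    have "r = 0 \<or> r = 1 \<or> r = (r - 2) + 2 \<and> r - 2 \<le> T" using r by linarith
    then consider "r = 0" | "r = 1" | t where "r = t + 2" "t \<le> T" by blast
    then show ?thesis
    proof cases
      case 1
      have "contents u (pos c) = 0" if "\<not> (V \<le> c \<and> c < V + n)"
        using that assms(1) by (auto simp: contents_def pos_def)
      then show ?thesis using 1 c by (simp add: cell_def bot_def pos_def)
    next
      case 2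
      have "c = V \<or> c \<noteq> 0 \<and> contents u (pos (c - 1)) \<noteq> 0" if "contents u (pos c) \<noteq> 0"
        using that by (auto simp: contents_def pos_def split: if_splits)
      moreover have "initcells (contents x (pos c)) (contents u (pos c)) (c = V) = cells (snd (?cfg 0)) (pos c)"
        by (auto simp: initcells_def cells_def run_def init_def nth_Cons' contents_def pos_def)
      moreover have "fst (?cfg 0) = start M" by (simp add: run_def init_def)
      ultimately show ?thesis using 2 c by (auto simp: cell_def)
    next
      case 3
      let ?q = "fst (?cfg t)" and ?ts = "snd (?cfg t)" and ?r = "t + 2"
      let ?l = "if c = 0 then Hash else cell r (c - 1)"
      have g: "good t (?cfg t)" by (rule good_run)
      then have len: "length ?ts = tapes M" by (simp add: good_def)
      have here: "cell r d = Cell ?q (map read ?ts) (cells ?ts (pos d))" if "d < E" for d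
        using 3 that by (simp add: cell_def)
      have head: "\<bar>snd (?ts ! j)\<bar> \<le> int t" if "j < tapes M" for j
        using good_head[OF g that] .
      have flags: "flag ?l j \<longleftrightarrow> snd (?ts ! j) = pos c - 1"
        "flag (cell r (Suc c)) j \<longleftrightarrow> snd (?ts ! j) = pos c + 1" if j: "j < tapes M" for j
      proof -
        have fl: "flag (cell r d) j \<longleftrightarrow> snd (?ts ! j) = pos d" if "d < E" for d
          using here[OF that] len j by (auto simp: cells_def split: prod.splits)
        show "flag ?l j \<longleftrightarrow> snd (?ts ! j) = pos c - 1"
        proof (cases c)
          case 0
          then have "snd (?ts ! j) \<noteq> pos c - 1" using head[OF j] V 3 by (auto simp: pos_def)
          then show ?thesis using 0 by simp
        next
          case (Suc c')
          then show ?thesis using fl[of c'] c by (simp add: pos_def)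
        qed
        show "flag (cell r (Suc c)) j \<longleftrightarrow> snd (?ts ! j) = pos c + 1"
        proof (cases "Suc c < E")
          case True
          then show ?thesis using fl[of "Suc c"] by (simp add: pos_def algebra_simps)
        next
          case False
          then have e: "Suc c = E" using c by simp
          then have "snd (?ts ! j) \<noteq> pos c + 1" using head[OF j] E 3 by (auto simp: pos_def)
          then show ?thesis using e 3 by (simp add: cell_def)
        qed
      qed
      have "length (snd (eff ?q (map read ?ts))) = tapes M"
        using eff_wf[of ?q "map read ?ts"] good_reads[OF g] g by (auto simp: good_def)
      moreover have st: "?cfg (Suc t) = step M (?q, ?ts)" by (simp add: run_def)
      ultimately have new: "map (newcell ?l (cell r (Suc c)) (cells ?ts (pos c)) (snd (eff ?q (map read ?ts)))) [0..<tapes M] =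
          cells (snd (?cfg (Suc t))) (pos c)"
        unfolding st using len flags by (intro cells_step) auto
      have "\<forall>j < tapes M. snd (cells ?ts (pos c) ! j) \<longrightarrow> fst (cells ?ts (pos c) ! j) = map read ?ts ! j"
        using len by (auto simp: cells_def split: prod.splits)
      moreover have "as' = map read ?ts" if "?l = Cell q' as' cs'" for q' as' cs'
        using that here[of "c - 1"] c by (auto split: if_splits)
      moreover have "cell (Suc r) c = Done \<and> ?q = accept M \<or>
          (\<exists>as'. cell (Suc r) c = Cell (fst (eff ?q (map read ?ts))) as'
             (map (newcell ?l (cell r (Suc c)) (cells ?ts (pos c)) (snd (eff ?q (map read ?ts)))) [0..<tapes M]))"
      proof (cases "t = T")
        case True
        then show ?thesis using 3 assms(2) by (simp add: cell_def)
      next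
        case False
        moreover have "fst (?cfg (Suc t)) = fst (eff ?q (map read ?ts))" unfolding st step_eff by simp
        ultimately show ?thesis unfolding new using 3 c by (simp add: cell_def)
      qed
      ultimately show ?thesis unfolding here[OF c] R.simps by blast
    qed
  qed
  have "word w"
    unfolding word_def
  proof (intro conjI allI impI)
    fix c assume "c < W"
    then show "w c = bot c" using w[of c 0] by (auto simp: cell_def bot_def)
  next
    have "N - 1 = (T + 2) * W + E" by (simp add: algebra_simps)
    then have "w (N - 1) = cell (T + 2) E" using w[of E "T + 2"] by (simp only: lessI)
    then show "w (N - 1) = Hash" by (simp add: cell_def)
  next
    fix p assume "N \<le> p \<and> p < N + W"
    then have "T + 3 \<le> p div W" by (metis div_le_mono nonzero_mult_div_cancel_right nat.distinct(1))
    then show "w p = Done" by (simp add: w_def cell_def)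
  next
    fix p assume "p < N + W"
    have "p mod W < W" by simp
    have "Cell (fst (?cfg t)) (map read (snd (?cfg t))) (cells (snd (?cfg t)) i) \<in> letters" for t i
      by (rule cell_in_letters[OF good_run])
    moreover have "bot c \<in> letters" for c
      using contents_less by (simp add: bot_def letters_intros)
    moreover have "Guess (contents x i) (contents u i) b \<in> letters" for i b
      using contents_less by (simp add: letters_intros)
    moreover note letters_intros(1,2)
    ultimately show "w p \<in> letters" unfolding w_def cell_def by auto
  next
    fix p assume p: "p < N"
    define r c where "r = p div W" and "c = p mod W"
    have pe: "p = r * W + c" unfolding r_def c_def by (rule div_mult_mod_eq[symmetric])
    have c: "c < W" by (simp add: c_def)
    have r: "r < T + 3" using p unfolding r_def by (simp add: less_mult_imp_div_less)
    have up: "w (p + W) = cell (Suc r) c" using w[OF c, of "Suc r"] pe by (simp add: algebra_simps)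
    show "R (prev w p) (w p) (w (Suc p)) (w (p + W))"
    proof (cases "c = E")
      case True
      then have "w p = Hash" using w[OF c, of r] r pe by (simp add: cell_def)
      moreover have "w (p + W) = Hash \<or> w (p + W) = Done" unfolding up using True by (simp add: cell_def)
      ultimately show ?thesis by simp
    next
      case False
      then have cE: "c < E" using c by simp
      have "w (Suc p) = cell r (Suc c)" using w[of "Suc c" r] cE pe by simp
      moreover have "prev w p = (if c = 0 then Hash else cell r (c - 1))"
      proof (cases "c = 0")
        case True
        show ?thesis
        proof (cases r)
          case (Suc r')
          then have "p - 1 = r' * W + E" using True pe by simp
          then have "w (p - 1) = Hash" using w[of E r'] Suc r by (simp add: cell_def)
          then show ?thesis using True Suc pe by (simp add: prev_def)
        qed (use True pe in \<open>simp add: prev_def\<close>)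
      next
        case False
        then have "p - 1 = r * W + (c - 1)" "p \<noteq> 0" using pe by auto
        then show ?thesis using False w[of "c - 1" r] c by (simp add: prev_def)
      qed
      ultimately show ?thesis using Rc[OF r cE] w[OF c, of r] pe up by simp
    qed
  qed
  then show ?thesis by blast
qed

theorem word_iff: "(\<exists>w. word w) \<longleftrightarrow> (\<exists>u. length u \<le> n \<and> fst (run M [x, u] T) = accept M)"
  using word_sound word_complete by blast

end

section \<open>Locally constrained words as tilings\<close>

context ntm
begin

text \<open>The successor makes every vertical colour positive, so that the binary form of an item
  can start with the upper colour of its tile.\<close>

definition code :: "letter \<Rightarrow> nat" where
  "code l = Suc (to_nat l)"

text \<open>Horizontal colours are pairs of adjacent letters: a tile sees the letters on both sides
  of its own, and matching colours make these views overlap consistently.\<close>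

definition hcode :: "letter \<Rightarrow> letter \<Rightarrow> nat" where
  "hcode a b = prod_encode (code a, code b)"

lemma code_eq_iff [simp]: "code a = code b \<longleftrightarrow> a = b"
  by (simp add: code_def)

lemma hcode_eq_iff [simp]: "hcode a b = hcode a' b' \<longleftrightarrow> a = a' \<and> b = b'"
  by (simp add: hcode_def prod_encode_eq)

definition tile_of :: "letter \<times> letter \<times> letter \<times> letter \<Rightarrow> tile" where
  "tile_of = (\<lambda>(a, b, c, u). (hcode a b, hcode b c, code b, code u))"

definition quads :: "(letter \<times> letter \<times> letter \<times> letter) set" where
  "quads = {(a, b, c, u). a \<in> letters \<and> b \<in> letters \<and> c \<in> letters \<and> u \<in> letters \<and> R a b c u}"

definition G :: "tile list" where
  "G = (SOME ts. set ts = tile_of ` quads \<and> distinct ts)"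

definition m :: nat where
  "m = Max (code ` letters \<union> (\<lambda>(a, b). hcode a b) ` (letters \<times> letters))"

text \<open>Since every number is below its power of two, this exponent satisfies the size condition
  of \<open>tiling\<close>. It depends on the machine only, so digit blocks have constant
  length.\<close>

definition e :: nat where
  "e = 2 * ((2 * length G + 1) * (m + 1))"

lemma G: "set G = tile_of ` quads" "distinct G"
proof -
  have "quads \<subseteq> letters \<times> letters \<times> letters \<times> letters" by (auto simp: quads_def)
  then have "finite quads" using finite_letters by (meson finite_SigmaI finite_subset)
  then have "\<exists>ts. set ts = tile_of ` quads \<and> distinct ts"
    using finite_distinct_list[of "tile_of ` quads"] by auto
  from someI_ex[OF this] show "set G = tile_of ` quads" "distinct G" unfolding G_def by auto
qed

lemma code_le_m: "a \<in> letters \<Longrightarrow> code a \<le> m"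
  unfolding m_def using finite_letters by (intro Max_ge) auto

lemma hcode_le_m: "a \<in> letters \<Longrightarrow> b \<in> letters \<Longrightarrow> hcode a b \<le> m"
  unfolding m_def using finite_letters by (intro Max_ge) auto

lemma G_bounds:
  assumes "\<tau> \<in> set G"
  shows "lf \<tau> \<le> m \<and> rt \<tau> \<le> m \<and> dn \<tau> \<le> m \<and> up \<tau> \<le> m" "0 < up \<tau>"
proof -
  obtain a b c u where q: "(a, b, c, u) \<in> quads" "\<tau> = tile_of (a, b, c, u)" using assms G by auto
  then have "a \<in> letters" "b \<in> letters" "c \<in> letters" "u \<in> letters" by (auto simp: quads_def)
  then show "lf \<tau> \<le> m \<and> rt \<tau> \<le> m \<and> dn \<tau> \<le> m \<and> up \<tau> \<le> m" "0 < up \<tau>"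
    by (auto simp: q(2) tile_of_def lf_def rt_def dn_def up_def code_le_m hcode_le_m) (simp add: code_def)
qed

end

context history
begin

lemma WN: "W \<le> N" "0 < W" "0 < N"
proof -
  have "1 * W \<le> N" by (intro mult_le_mono1) simp
  then show "W \<le> N" "0 < W" "0 < N" by simp_all
qed

lemma bot_in_letters: "bot c \<in> letters"
  using contents_less by (simp add: bot_def letters_intros)

lemma bot_0: "bot 0 = Pre 0 False False"
  using V E by (auto simp: bot_def contents_def)

text \<open>The left boundary colour is the imagined separator followed by the first letter of row
  0; the right one is the last separator followed by the first \<open>Done\<close> of the top
  layer.\<close>

sublocale til: tiling G m e W N "hcode Hash (Pre 0 False False)" "hcode Hash Done" "code Done" "\<lambda>c. code (bot c)"
proof
  show "2 * ((2 * length G + 1) * (m + 1)) < 2 ^ e" unfolding e_def by (rule less_exp)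
  show "2 \<le> W" using E by simp
  show "W \<le> N" by (rule WN)
qed (use G G_bounds code_le_m hcode_le_m letters_intros bot_in_letters in auto)

text \<open>The word consists of the middle letters of the tiles, continued by \<open>Done\<close>.
  The pair colours force the outer letters of each tile to be its neighbours in the word, and the
  vertical colours do the same for the letter \<open>W\<close> places later.\<close>

lemma tiles_iff_word: "(\<exists>\<gamma>. til.tiles \<gamma>) \<longleftrightarrow> (\<exists>w. word w)"
proof
  assume "\<exists>w. word w"
  then obtain w where w: "word w" by blast
  define \<gamma> where "\<gamma> p = tile_of (prev w p, w p, w (Suc p), w (p + W))" for p
  have sel: "lf (\<gamma> p) = hcode (prev w p) (w p)" "rt (\<gamma> p) = hcode (w p) (w (Suc p))"
    "dn (\<gamma> p) = code (w p)" "up (\<gamma> p) = code (w (p + W))" for p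
    by (simp_all add: \<gamma>_def tile_of_def lf_def rt_def dn_def up_def)
  have L: "w p \<in> letters" if "p < N + W" for p using w that unfolding word_def by blast
  have Rw: "R (prev w p) (w p) (w (Suc p)) (w (p + W))" if "p < N" for p
    using w that unfolding word_def by blast
  have top: "w p = Done" if "N \<le> p" "p < N + W" for p using w that unfolding word_def by blast
  have base: "w c = bot c" if "c < W" for c using w that unfolding word_def by blast
  have last: "w (N - 1) = Hash" using w unfolding word_def by blast
  show "\<exists>\<gamma>. til.tiles \<gamma>"
  proof (intro exI, unfold til.tiles_def, intro conjI allI impI)
    fix p assume p: "p < N"
    have "prev w p \<in> letters" using L[of "p - 1"] p letters_intros by (simp add: prev_def)
    then have "(prev w p, w p, w (Suc p), w (p + W)) \<in> quads"
      using L[of p] L[of "Suc p"] L[of "p + W"] Rw[OF p] p WN unfolding quads_def by simp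
    then show "\<gamma> p \<in> set G" unfolding \<gamma>_def G(1) by (rule imageI)
  next
    show "lf (\<gamma> 0) = hcode Hash (Pre 0 False False)"
      using base[of 0] by (simp add: sel prev_def bot_0)
  next
    fix p assume "0 < p \<and> p < N"
    then show "lf (\<gamma> p) = rt (\<gamma> (p - 1))" by (simp add: sel prev_def)
  next
    have "Suc (N - 1) = N" using WN by simp
    moreover have "w N = Done" using top WN by simp
    ultimately show "rt (\<gamma> (N - 1)) = hcode Hash Done" unfolding sel last by (simp only: last)
  next
    fix p assume "p < N"
    show "dn (\<gamma> p) = (if p < W then code (bot p) else up (\<gamma> (p - W)))"
      unfolding sel using base by auto
  next
    fix p assume p: "N - W \<le> p \<and> p < N"
    have "w (p + W) = Done" by (rule top) (use p WN in linarith)+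
    then show "up (\<gamma> p) = code Done" by (simp only: sel)
  qed
next
  assume "\<exists>\<gamma>. til.tiles \<gamma>"
  then obtain \<gamma> where t: "til.tiles \<gamma>" by blast
  have "\<exists>a b c u. p < N \<longrightarrow> (a, b, c, u) \<in> quads \<and> \<gamma> p = tile_of (a, b, c, u)" for p
    using t G(1) unfolding til.tiles_def by fastforce
  then obtain a b c u where q: "\<And>p. p < N \<Longrightarrow> (a p, b p, c p, u p) \<in> quads"
    "\<And>p. p < N \<Longrightarrow> \<gamma> p = tile_of (a p, b p, c p, u p)" by metis
  have sel: "lf (\<gamma> p) = hcode (a p) (b p)" "rt (\<gamma> p) = hcode (b p) (c p)"
    "dn (\<gamma> p) = code (b p)" "up (\<gamma> p) = code (u p)" if "p < N" for p
    using q(2)[OF that] by (simp_all add: tile_of_def lf_def rt_def dn_def up_def)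
  define w where "w p = (if p < N then b p else Done)" for p
  have t1: "lf (\<gamma> 0) = hcode Hash (Pre 0 False False)" using t unfolding til.tiles_def by blast
  have t2: "lf (\<gamma> p) = rt (\<gamma> (p - 1))" if "0 < p" "p < N" for p
    using t that unfolding til.tiles_def by blast
  have t3: "rt (\<gamma> (N - 1)) = hcode Hash Done" using t unfolding til.tiles_def by blast
  have t4: "dn (\<gamma> p) = (if p < W then code (bot p) else up (\<gamma> (p - W)))" if "p < N" for p
    using t that unfolding til.tiles_def by blast
  have t5: "up (\<gamma> p) = code Done" if "N - W \<le> p" "p < N" for p
    using t that unfolding til.tiles_def by blast
  have a: "prev w p = a p" if "p < N" for p
  proof (cases "p = 0")
    case True
    then show ?thesis using t1 sel(1)[of 0] WN by (simp add: prev_def)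
  next
    case False
    then have "p - 1 < N" using that by linarith
    then have "w (p - 1) = b (p - 1)" "hcode (a p) (b p) = hcode (b (p - 1)) (c (p - 1))"
      using t2[of p] sel(1)[of p] sel(2)[of "p - 1"] that False by (auto simp: w_def)
    then show ?thesis using False by (simp add: prev_def)
  qed
  have c: "w (Suc p) = c p" if "p < N" for p
  proof (cases "Suc p < N")
    case True
    then show ?thesis using t2[of "Suc p"] sel(1)[of "Suc p"] sel(2)[of p] by (simp add: w_def)
  next
    case False
    then have pe: "p = N - 1" using that by linarith
    have "rt (\<gamma> p) = hcode Hash Done" unfolding pe by (rule t3)
    then have "c p = Done" unfolding sel(2)[OF that] by simp
    then show ?thesis using False by (simp add: w_def)
  qed
  have u: "w (p + W) = u p" if "p < N" for p
  proof (cases "p + W < N")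
    case True
    then have "code (b (p + W)) = code (u p)" using t4[of "p + W"] sel(3)[of "p + W"] sel(4)[of p] by simp
    then show ?thesis using True by (simp add: w_def)
  next
    case False
    then have "N - W \<le> p" by linarith
    then have "u p = Done" using t5[of p] sel(4)[of p] that by simp
    then show ?thesis using False by (simp add: w_def)
  qed
  have "word w"
    unfolding word_def
  proof (intro conjI allI impI)
    fix p assume p: "p < W"
    then have "p < N" using WN by linarith
    then show "w p = bot p" using t4[of p] sel(3)[of p] p by (simp add: w_def)
  next
    have "N - 1 < N" using WN by linarith
    moreover have "hcode (b (N - 1)) (c (N - 1)) = hcode Hash Done"
      by (rule trans[OF sel(2)[OF calculation, symmetric] t3])
    ultimately show "w (N - 1) = Hash" unfolding w_def by simp
  next
    fix p assume "N \<le> p \<and> p < N + W"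
    then show "w p = Done" by (simp add: w_def)
  next
    fix p
    show "w p \<in> letters" using q(1)[of p] letters_intros by (simp add: w_def quads_def)
  next
    fix p assume p: "p < N"
    then show "R (prev w p) (w p) (w (Suc p)) (w (p + W))"
      unfolding a[OF p] c[OF p] u[OF p] using q(1)[OF p] by (simp add: quads_def w_def)
  qed
  then show "\<exists>w. word w" by blast
qed

theorem conscomp_history:
  "conscomp_instance til.family (int til.big)"
  "conscomp_solvable til.family (int til.big) \<longleftrightarrow> (\<exists>v. length v \<le> n \<and> fst (run M [x, v] T) = accept M)"
  using til.conscomp_family tiles_iff_word word_iff by auto

end

section \<open>Programming with stacks\<close>

definition pushes :: "nat \<Rightarrow> nat list \<Rightarrow> com" where
  "pushes i as = foldr (\<lambda>a c. Push i a ;; c) as Skip"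

definition seqs :: "com list \<Rightarrow> com" where
  "seqs cs = foldr Seq cs Skip"

text \<open>A loop that restores its stack, through \<open>t\<close>. Saving a symbol uses up the
  credit of the iteration, which is why \<open>tame_Each\<close> demands credit 0 of the
  body.\<close>

definition Each :: "nat \<Rightarrow> nat \<Rightarrow> (nat \<Rightarrow> com) \<Rightarrow> com" where
  "Each i t f = For i (\<lambda>a. Push t a ;; f a) ;; For t (\<lambda>a. Push i a)"

lemma sem_pushes: "sem (pushes i as) s = s(i := rev as @ s i)"
  unfolding pushes_def by (induction as arbitrary: s) auto

lemma fresh_pushes [simp]: "j \<noteq> i \<Longrightarrow> fresh j (pushes i as)"
  unfolding pushes_def by (induction as) auto

lemma wfc_pushes [simp]: "wfc k S (pushes i as) \<longleftrightarrow> (\<forall>a \<in> set as. i < k \<and> 0 < a \<and> a < S)"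
  unfolding pushes_def by (induction as) auto

lemma tame_pushes [simp]: "i \<notin> K \<Longrightarrow> tame K (pushes i as) g"
  unfolding pushes_def by (induction as arbitrary: g) auto

lemma sem_seqs [simp]: "sem (seqs []) s = s" "sem (seqs (c # cs)) s = sem (seqs cs) (sem c s)"
  by (simp_all add: seqs_def)

lemma fresh_seqs [simp]: "fresh j (seqs cs) \<longleftrightarrow> (\<forall>c \<in> set cs. fresh j c)"
  unfolding seqs_def by (induction cs) auto

lemma wfc_seqs [simp]: "wfc k S (seqs cs) \<longleftrightarrow> (\<forall>c \<in> set cs. wfc k S c)"
  unfolding seqs_def by (induction cs) auto

lemma tame_seqs [simp]: "\<forall>c \<in> set cs. tame K c 0 \<Longrightarrow> tame K (seqs cs) 0"
  unfolding seqs_def by (induction cs) auto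

lemma fold_sem_fresh:
  "(\<And>a. fresh i (f a)) \<Longrightarrow> fold (\<lambda>a. sem (f a)) xs (s(i := v)) = (fold (\<lambda>a. sem (f a)) xs s)(i := v)"
  by (induction xs arbitrary: s) (simp_all add: sem_fresh)

lemma fold_Push: "fold (\<lambda>a. sem (Push j a)) xs s = s(j := rev xs @ s j)"
  by (induction xs arbitrary: s) auto

lemma sem_move: "i \<noteq> j \<Longrightarrow> sem (For i (\<lambda>a. Push j a)) s = s(i := [], j := rev (s i) @ s j)"
  by (simp only: sem.simps(6) fold_Push) simp

lemma fold_record:
  assumes "\<And>a. fresh t (f a)"
  shows "fold (\<lambda>a. sem (Push t a ;; f a)) xs s = (fold (\<lambda>a. sem (f a)) xs s)(t := rev xs @ s t)"
proof (induction xs arbitrary: s)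
  case (Cons a xs)
  have "sem (Push t a ;; f a) s = (sem (f a) s)(t := a # s t)"
    by (simp only: sem.simps sem_fresh[OF assms])
  then have "fold (\<lambda>a. sem (Push t a ;; f a)) (a # xs) s =
      fold (\<lambda>a. sem (Push t a ;; f a)) xs ((sem (f a) s)(t := a # s t))"
    by (simp only: fold_simps)
  also have "\<dots> = (fold (\<lambda>a. sem (f a)) xs ((sem (f a) s)(t := a # s t)))(t := rev xs @ a # s t)"
    by (simp only: Cons.IH fun_upd_same)
  finally show ?case
    by (simp only: fold_sem_fresh[OF assms] fold_simps fun_upd_upd rev.simps append_assoc append_Cons append_Nil)
qed simp

lemma sem_Each:
  assumes "i \<noteq> t" "\<And>a. fresh i (f a)" "\<And>a. fresh t (f a)" "s t = []"
  shows "sem (Each i t f) s = fold (\<lambda>a. sem (f a)) (s i) s"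
proof -
  define F where "F = fold (\<lambda>a. sem (f a)) (s i) s"
  have "(s(i := s i, t := s t)) = s" by simp
  then have FF: "F = F(i := s i, t := [])"
    using fold_sem_fresh[OF assms(2), where xs = "s i" and s = s and v = "s i"]
      fold_sem_fresh[OF assms(3), where xs = "s i" and s = s and v = "s t"] assms(4)
    by (simp add: F_def)
  have "sem (For i (\<lambda>a. Push t a ;; f a)) s = F(i := [], t := rev (s i))"
    using assms(1,4) by (simp only: sem.simps(6) fold_record[OF assms(3)] fold_sem_fresh[OF assms(2)])
      (simp add: F_def)
  then have "sem (Each i t f) s = sem (For t (\<lambda>a. Push i a)) (F(i := [], t := rev (s i)))"
    by (simp only: Each_def sem.simps(4))
  also have "\<dots> = F(i := s i, t := [])"
    using assms(1) by (subst sem_move) (auto simp: fun_eq_iff)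
  finally show ?thesis using FF by (simp add: F_def)
qed

lemma fresh_Each [simp]: "j \<noteq> i \<Longrightarrow> j \<noteq> t \<Longrightarrow> (\<And>a. fresh j (f a)) \<Longrightarrow> fresh j (Each i t f)"
  by (simp add: Each_def)

lemma wfc_Each [simp]: "i < k \<Longrightarrow> t < k \<Longrightarrow> (\<And>a. 0 < a \<Longrightarrow> a < S \<Longrightarrow> wfc k S (f a)) \<Longrightarrow> wfc k S (Each i t f)"
  by (simp add: Each_def)

lemma tame_Each [simp]:
  "i \<in> K \<Longrightarrow> t \<in> K \<Longrightarrow> i \<noteq> t \<Longrightarrow> (\<And>a. fresh i (f a)) \<Longrightarrow> (\<And>a. fresh t (f a)) \<Longrightarrow> (\<And>a. tame K (f a) 0) \<Longrightarrow>
    tame K (Each i t f) g"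
  by (simp add: Each_def)

lemma fold_const: "fold (\<lambda>a. g) xs s = (g ^^ length xs) s"
  by (induction xs arbitrary: s) (simp_all add: funpow_swap1)

lemma sem_Each_const:
  assumes "i \<noteq> t" "fresh i c" "fresh t c" "s t = []"
  shows "sem (Each i t (\<lambda>_. c)) s = (sem c ^^ length (s i)) s"
  using assms by (simp add: sem_Each fold_const)

lemma sem_Push_funpow: "(sem (Push i a) ^^ n) s = s(i := replicate n a @ s i)"
  by (induction n arbitrary: s) (auto simp: fun_eq_iff)

lemma sem_Push2_funpow:
  "i \<noteq> j \<Longrightarrow> (sem (Push i a ;; Push j b) ^^ n) s = s(i := replicate n a @ s i, j := replicate n b @ s j)"
  by (induction n arbitrary: s) (auto simp: fun_eq_iff)

text \<open>Quantifying over the earlier output \<open>v\<close> makes this composable. The output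
  is reversed since its last bit lies on top of stack 1.\<close>

definition emits :: "store \<Rightarrow> com \<Rightarrow> nat list \<Rightarrow> bool" where
  "emits s c w \<longleftrightarrow> (\<forall>v. sem c (s(1 := v)) = s(1 := rev w @ v))"

lemma emits_pushes: "emits s (pushes 1 w) w"
  by (simp add: emits_def sem_pushes)

lemma emits_Seq: "emits s c v \<Longrightarrow> emits s d w \<Longrightarrow> emits s (c ;; d) (v @ w)"
  by (simp add: emits_def)

lemma emits_seqs:
  assumes "\<And>x. x \<in> set xs \<Longrightarrow> emits s (f x) (g x)"
  shows "emits s (seqs (map f xs)) (concat (map g xs))"
  using assms
proof (induction xs)
  case Nil
  show ?case by (simp add: emits_def)
next
  case (Cons x xs)
  have "emits s (f x ;; seqs (map f xs)) (g x @ concat (map g xs))"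
    using Cons by (intro emits_Seq) auto
  then show ?case by (simp add: emits_def)
qed

lemma emits_fold:
  assumes "\<And>a. a \<in> set xs \<Longrightarrow> emits s (f a) (g a)"
  shows "fold (\<lambda>a. sem (f a)) xs (s(1 := v)) = s(1 := rev (concat (map g xs)) @ v)"
  using assms by (induction xs arbitrary: v) (auto simp: emits_def)

lemma emits_Each:
  assumes "i \<noteq> t" "i \<noteq> 1" "t \<noteq> 1" "\<And>a. fresh i (f a)" "\<And>a. fresh t (f a)" "s t = []"
    and "\<And>a. a \<in> set (s i) \<Longrightarrow> emits s (f a) (g a)"
  shows "emits s (Each i t f) (concat (map g (s i)))"
  unfolding emits_def
proof
  fix v
  have "(s(1 := v)) t = []" "(s(1 := v)) i = s i" using assms by auto
  then show "sem (Each i t f) (s(1 := v)) = s(1 := rev (concat (map g (s i))) @ v)"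
    using sem_Each[of i t f "s(1 := v)"] emits_fold[of "s i" s f g v] assms by simp
qed

text \<open>Horner's scheme in unary, with the argument on stack 4. The product is collected on
  stack 7, which drives no loop meanwhile, and only then moved to \<open>r\<close>; so each piece is
  tame for its own loop stacks, and the fixed number of pieces composes by
  \<open>ptime_Seq\<close>.\<close>

primrec horner :: "nat \<Rightarrow> nat list \<Rightarrow> com" where
  "horner r [] = Skip"
| "horner r (a # cs) = horner r cs ;; For r (\<lambda>_. Each 4 6 (\<lambda>_. Push 7 1)) ;; For 7 (\<lambda>_. Push r 1) ;;
     pushes r (replicate a 1)"

lemma sem_horner:
  assumes "r \<notin> {4, 6, 7}" "s r = []" "s 6 = []" "s 7 = []"
  shows "sem (horner r cs) s = s(r := replicate (foldr (\<lambda>a v. a + length (s 4) * v) cs 0) 1)"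
proof (induction cs)
  case Nil
  then show ?case using assms by (simp add: fun_upd_idem)
next
  case (Cons a cs)
  let ?n = "length (s 4)" and ?v = "foldr (\<lambda>a v. a + length (s 4) * v) cs 0"
  have mul: "(sem (Each 4 6 (\<lambda>_. Push 7 1)) ^^ j) s' = s'(7 := replicate (length (s' 4) * j) 1 @ s' 7)"
    if "s' 6 = []" for j s'
    using that
  proof (induction j arbitrary: s')
    case (Suc j)
    define s1 where "s1 = sem (Each 4 6 (\<lambda>_. Push 7 1)) s'"
    have s1: "s1 = s'(7 := replicate (length (s' 4)) 1 @ s' 7)"
      unfolding s1_def using Suc.prems by (simp add: sem_Each_const sem_Push_funpow del: sem.simps)
    then have "s1 6 = []" using Suc.prems by simp
    then have "(sem (Each 4 6 (\<lambda>_. Push 7 1)) ^^ Suc j) s' = s1(7 := replicate (length (s1 4) * j) 1 @ s1 7)"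
      unfolding funpow_Suc_right comp_apply s1_def[symmetric] by (rule Suc.IH)
    moreover have "replicate (l * j) 1 @ replicate l (1 :: nat) @ xs = replicate (l * Suc j) 1 @ xs" for l xs
      by (simp add: add.commute flip: append_assoc replicate_add)
    moreover have "s1 4 = s' 4" "s1 7 = replicate (length (s' 4)) 1 @ s' 7" by (simp_all add: s1)
    ultimately have "(sem (Each 4 6 (\<lambda>_. Push 7 1)) ^^ Suc j) s' = s1(7 := replicate (length (s' 4) * Suc j) 1 @ s' 7)"
      by (simp only:)
    then show ?case unfolding s1 fun_upd_upd .
  qed auto
  have fill: "sem (For 7 (\<lambda>_. Push r 1)) s' = s'(7 := [], r := replicate (length (s' 7)) 1 @ s' r)" for s'
    using assms(1) by (simp add: fold_const sem_Push_funpow del: sem.simps(2))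
  have loop: "sem (For r (\<lambda>_. Each 4 6 (\<lambda>_. Push 7 1))) s' = s'(r := [], 7 := replicate (length (s' 4) * length (s' r)) 1 @ s' 7)"
    if "s' 6 = []" for s'
    using that assms(1) mul[of "s'(r := [])" "length (s' r)"] by (simp only: sem.simps(6) fold_const) simp
  define s1 where "s1 = s(r := replicate ?v 1)"
  define s2 where "s2 = s1(r := [], 7 := replicate (?n * ?v) 1)"
  have 1: "sem (For r (\<lambda>_. Each 4 6 (\<lambda>_. Push 7 1))) s1 = s2"
    using loop[of s1] assms by (simp add: s1_def s2_def del: sem.simps)
  have 2: "sem (For 7 (\<lambda>_. Push r 1)) s2 = s2(7 := [], r := replicate (?n * ?v) 1)"
    using fill[of s2] assms by (simp add: s1_def s2_def del: sem.simps)
  show ?case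
    unfolding horner.simps sem.simps(4) Cons.IH s1_def[symmetric] 1 2
    using assms by (auto simp: s1_def s2_def sem_pushes fun_eq_iff replicate_add)
qed

lemma poly_foldr: "poly p x = foldr (\<lambda>a v. a + x * v) (coeffs p) 0"
  by (simp add: poly_def horner_sum_foldr)

lemma ptime_horner:
  assumes "r \<notin> {4, 6, 7}" "r < k" "8 \<le> k" "3 \<le> S"
  shows "ptime k S (horner r cs)"
proof (induction cs)
  case Nil
  show ?case using assms by (auto intro: ptime_tame[of "{}" _ 0])
next
  case (Cons a cs)
  have "ptime k S (For r (\<lambda>_. Each 4 6 (\<lambda>_. Push 7 1)))"
    using assms by (intro ptime_tame[of "{r, 4, 6}" _ 0]) auto
  moreover have "ptime k S (For 7 (\<lambda>_. Push r 1))"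
    using assms by (intro ptime_tame[of "{7}" _ 0]) auto
  moreover have "ptime k S (pushes r (replicate a 1))"
    using assms by (intro ptime_tame[of "{}" _ 0]) auto
  ultimately show ?case using Cons assms by (auto intro!: ptime_Seq)
qed

section \<open>Binary notation\<close>

text \<open>\<open>bv a bs\<close> is the value of \<open>bs\<close> written behind the binary digits of \<open>a\<close>.\<close>

fun bv :: "nat \<Rightarrow> bool list \<Rightarrow> nat" where
  "bv a [] = a"
| "bv a (b # bs) = bv (2 * a + of_bool b) bs"

lemma bv_append: "bv a (xs @ ys) = bv (bv a xs) ys"
  by (induction xs arbitrary: a) auto

lemma bv_replicate: "bv a (replicate k False) = a * 2 ^ k"
  by (induction k arbitrary: a) auto

lemma bv_ge: "a \<le> bv a bs"
proof (induction bs arbitrary: a)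
  case (Cons b bs)
  have "a \<le> 2 * a + of_bool b" by simp
  then show ?case using Cons[of "2 * a + of_bool b"] by simp
qed simp

lemma binary_bv_1: "binary (bv 1 bs) = True # bs"
proof (induction bs rule: rev_induct)
  case Nil
  show ?case by (simp add: binary.simps)
next
  case (snoc b bs)
  have "bv 1 bs \<ge> 1" by (rule bv_ge)
  then have "binary (2 * bv 1 bs + of_bool b) = binary (bv 1 bs) @ [b]"
    by (subst binary.simps) auto
  then show ?case using snoc by (simp add: bv_append)
qed

lemma bv_binary: "0 < n \<Longrightarrow> \<exists>bs. binary n = True # bs \<and> bv 1 bs = n"
proof (induction n rule: binary.induct)
  case (1 n)
  show ?case
  proof (cases "n < 2")
    case True
    then have "n = 1" using 1 by simp
    then show ?thesis by (simp add: binary.simps)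
  next
    case False
    then have "0 < n div 2" by simp
    then obtain bs where bs: "binary (n div 2) = True # bs" "bv 1 bs = n div 2"
      using 1 False by blast
    have "binary n = True # bs @ [odd n]" using bs False by (subst binary.simps) simp
    moreover have "bv 1 (bs @ [odd n]) = n" using bs by (simp add: bv_append)
    ultimately show ?thesis by blast
  qed
qed

lemma binary_bv:
  assumes "0 < n"
  shows "binary (bv n bs) = binary n @ bs"
proof -
  obtain cs where "binary n = True # cs" "bv 1 cs = n" using bv_binary[OF assms] by blast
  then show ?thesis using binary_bv_1[of "cs @ bs"] by (simp add: bv_append)
qed

fun bw :: "nat \<Rightarrow> nat \<Rightarrow> bool list" where
  "bw 0 n = []"
| "bw (Suc k) n = bw k (n div 2) @ [odd n]"

lemma bv_bw: "n < 2 ^ k \<Longrightarrow> bv a (bw k n) = a * 2 ^ k + n"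
proof (induction k arbitrary: n)
  case (Suc k)
  then have "n div 2 < 2 ^ k" by simp
  from Suc.IH[OF this] have "bv a (bw (Suc k) n) = 2 * (a * 2 ^ k + n div 2) + of_bool (odd n)"
    by (simp add: bv_append)
  also have "\<dots> = a * 2 ^ Suc k + (2 * (n div 2) + n mod 2)" by (simp add: of_bool_odd_eq_mod_2)
  finally show ?case by simp
qed simp

text \<open>The digits of \<open>trip\<close> in reverse order, as the most significant bit is
  written first.\<close>

definition blk :: "nat \<Rightarrow> nat \<Rightarrow> nat \<Rightarrow> nat \<Rightarrow> bool list" where
  "blk e x y z = bw e z @ bw e y @ bw e x"

lemma bv_blk:
  assumes "x < 2 ^ e" "y < 2 ^ e" "z < 2 ^ e"
  shows "bv a (blk e x y z) = a * 2 ^ (3 * e) + trip e x y z"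
proof -
  have "3 * e = e + (e + e)" "2 * e = e + e" by simp_all
  then have "(2 :: nat) ^ (3 * e) = 2 ^ e * (2 ^ e * 2 ^ e)" "(2 :: nat) ^ (2 * e) = 2 ^ e * 2 ^ e"
    by (simp_all only: power_add)
  then show ?thesis
    unfolding trip_def blk_def using assms by (simp only: bv_append bv_bw) (simp add: algebra_simps)
qed

lemma bv_blocks:
  assumes "\<And>q. q < D \<Longrightarrow> f q < 2 ^ e \<and> g q < 2 ^ e \<and> h q < 2 ^ e"
  shows "bv a (concat (map (\<lambda>q. blk e (f q) (g q) (h q)) (rev [0..<D]))) =
    a * (2 ^ (3 * e)) ^ D + (\<Sum>q<D. (2 ^ (3 * e)) ^ q * trip e (f q) (g q) (h q))"
  using assms
proof (induction D arbitrary: a)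
  case (Suc D)
  have "bv a (concat (map (\<lambda>q. blk e (f q) (g q) (h q)) (rev [0..<Suc D]))) =
      bv (bv a (blk e (f D) (g D) (h D))) (concat (map (\<lambda>q. blk e (f q) (g q) (h q)) (rev [0..<D])))"
    by (simp add: bv_append)
  also have "\<dots> = (a * 2 ^ (3 * e) + trip e (f D) (g D) (h D)) * (2 ^ (3 * e)) ^ D +
      (\<Sum>q<D. (2 ^ (3 * e)) ^ q * trip e (f q) (g q) (h q))"
    using Suc.prems by (subst Suc.IH) (auto simp: bv_blk)
  finally show ?case by (simp add: algebra_simps)
qed simp

lemma binary_blocks:
  assumes "\<And>q. q < D \<Longrightarrow> f q < 2 ^ e \<and> g q < 2 ^ e \<and> h q < 2 ^ e"
  shows "binary ((2 ^ (3 * e)) ^ D + (\<Sum>q<D. (2 ^ (3 * e)) ^ q * trip e (f q) (g q) (h q))) =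
    True # concat (map (\<lambda>q. blk e (f q) (g q) (h q)) (rev [0..<D]))"
  using binary_bv_1[of "concat (map (\<lambda>q. blk e (f q) (g q) (h q)) (rev [0..<D]))"] bv_blocks[of D f e g h 1, OF assms]
  by simp

definition cbits :: "char4 list \<Rightarrow> nat list" where
  "cbits cs = bits (concat (map char_code cs))"

definition dbits :: "bool list \<Rightarrow> nat list" where
  "dbits bs = cbits (map Digit bs)"

lemma cbits_append: "cbits (xs @ ys) = cbits xs @ cbits ys"
  by (simp add: cbits_def bits_def)

lemma dbits_append: "dbits (xs @ ys) = dbits xs @ dbits ys"
  by (simp add: dbits_def cbits_append)

lemma dbits_concat: "dbits (concat xss) = concat (map dbits xss)"
  by (induction xss) (simp_all add: dbits_append, simp add: dbits_def cbits_def bits_def)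

lemma set_cbits: "set (cbits cs) \<subseteq> {1, 2}"
  by (auto simp: cbits_def bits_def)

lemma set_dbits: "set (dbits bs) \<subseteq> {1, 2}"
  unfolding dbits_def by (rule set_cbits)

lemma bits_encode_ints: "bits (encode_ints zs) = concat (map (\<lambda>z. cbits (int_chars z)) zs)"
  by (induction zs) (auto simp: encode_ints_def cbits_def bits_def)

lemma cbits_nat: "cbits (int_chars (int n)) = dbits (binary n) @ cbits [Comma]"
  by (simp add: int_chars_def dbits_def flip: cbits_append)

lemma cbits_neg: "0 < n \<Longrightarrow> cbits (int_chars (- int n)) = cbits [Minus] @ dbits (binary n) @ cbits [Comma]"
  by (simp add: int_chars_def dbits_def flip: cbits_append)

context tiling
begin

abbreviation blocks :: "(nat \<Rightarrow> nat) \<Rightarrow> (nat \<Rightarrow> nat) \<Rightarrow> (nat \<Rightarrow> nat) \<Rightarrow> bool list" where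
  "blocks f g h \<equiv> True # concat (map (\<lambda>q. blk e (f q) (g q) (h q)) (rev [0..<N + W]))"

lemma binary_big: "binary big = blocks (\<lambda>_. cap) (\<lambda>_. cap) (\<lambda>_. cap)"
  unfolding big_def by (rule binary_blocks) (use cap_bounds in auto)

lemma binary_fill1: "binary fill1 = blocks (\<lambda>q. cap - tk q) (\<lambda>q. cap - th q) (\<lambda>q. cap - tv q)"
proof -
  have "cap - x < 2 ^ e" for x using cap_bounds by linarith
  then show ?thesis unfolding fill1_def by (intro binary_blocks) auto
qed

lemma binary_fill2:
  "binary fill2 = blocks (\<lambda>q. cap - sk q + tk q) (\<lambda>q. cap - sh q + th q) (\<lambda>q. cap - sv q + tv q)"
  unfolding fill2_def
proof (rule binary_blocks)
  fix q assume "q < N + W"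
  then show "cap - sk q + tk q < 2 ^ e \<and> cap - sh q + th q < 2 ^ e \<and> cap - sv q + tv q < 2 ^ e"
    using digit_bounds[of q] cap_bounds by linarith
qed

text \<open>From the top: the upper colour in the highest digit of position \<open>p + W\<close>,
  the two zero digits below it, the \<open>W - 2\<close> empty positions down to
  \<open>p + 1\<close>, the blocks of positions \<open>p + 1\<close> and \<open>p\<close>, and
  \<open>p\<close> empty positions. A positive upper colour supplies the leading bit.\<close>

lemma binary_item:
  assumes "\<tau> \<in> set G" "0 < up \<tau>"
  shows "binary (item (p, \<tau>)) = binary (up \<tau>) @ replicate (2 * e) False @
    concat (replicate (W - 2) (replicate (3 * e) False)) @
    blk e 0 (rt \<tau>) 0 @ blk e 1 (m - lf \<tau>) (m - dn \<tau>) @ concat (replicate p (replicate (3 * e) False))"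
proof -
  let ?b = "2 ^ (3 * e) :: nat"
  let ?bs = "replicate (2 * e) False @ concat (replicate (W - 2) (replicate (3 * e) False)) @
      blk e 0 (rt \<tau>) 0 @ blk e 1 (m - lf \<tau>) (m - dn \<tau>) @ concat (replicate p (replicate (3 * e) False))"
  have cr: "concat (replicate j (replicate (3 * e) False)) = replicate (3 * e * j) False" for j
    by (induction j) (auto simp: replicate_add)
  have "rt \<tau> < 2 ^ e" "m - lf \<tau> < 2 ^ e" "m - dn \<tau> < 2 ^ e" "1 < (2 :: nat) ^ e"
    using G[OF assms(1)] cap_bounds by linarith+
  then have "bv (up \<tau>) ?bs =
     ((up \<tau> * 2 ^ (2 * e) * ?b ^ (W - 2) * ?b + trip e 0 (rt \<tau>) 0) * ?b + trip e 1 (m - lf \<tau>) (m - dn \<tau>)) * ?b ^ p"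
    by (simp add: bv_append bv_replicate bv_blk cr power_mult)
  also have "\<dots> = ?b ^ p * trip e 1 (m - lf \<tau>) (m - dn \<tau>) + ?b ^ (p + 1) * trip e 0 (rt \<tau>) 0 +
      ?b ^ p * (?b ^ (W - 2) * ?b * ?b) * trip e 0 0 (up \<tau>)"
    by (simp add: trip_def algebra_simps)
  also have "?b ^ (W - 2) * ?b * ?b = ?b ^ Suc (Suc (W - 2))" by (simp add: mult_ac)
  also have "Suc (Suc (W - 2)) = W" using W by simp
  also have "?b ^ p * ?b ^ W = ?b ^ (p + W)" by (simp add: power_add)
  finally have eq: "bv (up \<tau>) ?bs = item (p, \<tau>)" unfolding item_def case_prod_conv .
  show ?thesis using binary_bv[OF assms(2), of ?bs] unfolding eq .
qed

end

section \<open>The reduction\<close>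

text \<open>The digits of the numbers \<open>Z\<close>, \<open>Z - T\<close> and \<open>Z - S + T\<close> are described by a word of
  position types: 1 for position 0, 2 for the positions between \<open>W\<close> and \<open>N\<close>, 3 for position
  \<open>N\<close>, 4 for the higher ones; the positions of the bottom row are described by their letters.\<close>

fun sy :: "letter \<Rightarrow> nat" where
  "sy (Pre a f b) = 6 + a + (if f then 3 else 0) + (if b then 6 else 0)"
| "sy _ = 5"

definition unsy :: "nat \<Rightarrow> letter" where
  "unsy y = (if y = 5 then Hash else Pre ((y - 6) mod 3) ((y - 6) div 3 mod 2 = 1) ((y - 6) div 6 = 1))"

lemma unsy_sy: "unsy (sy Hash) = Hash" "a < 3 \<Longrightarrow> unsy (sy (Pre a f b)) = Pre a f b"
proof -
  assume "a < 3"
  then consider "a = 0" | "a = 1" | "a = 2" by linarith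
  then show "unsy (sy (Pre a f b)) = Pre a f b"
    by cases (cases f; cases b; simp add: unsy_def)+
qed (simp add: unsy_def)

lemma sy_bounds: "5 \<le> sy l" "a < 3 \<Longrightarrow> sy (Pre a f b) < 18"
  by (cases l) auto

text \<open>Use of the stacks: 3 holds the input (first bit on top) and 4 its length in unary; 5 the length
  \<open>n\<close> of the certificate, with a copy in 14; 8 the number \<open>T\<close> of steps; 9 the word of position types; 10 and 11 the
  numbers \<open>W\<close> and \<open>N\<close>; 13 counts the positions whose items have been printed; 6, 7, 12 and 15 are
  auxiliary.\<close>

definition plain :: com where
  "plain = Push 9 6 ;; Push 10 1"

text \<open>Reading an exhausted stack as 0 yields the blank beyond the input and the flag
  \<open>False\<close> beyond the certificate region. The minimum keeps the branches for symbols
  that are not input bits inside the alphabet.\<close>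

definition zipc :: "bool \<Rightarrow> com" where
  "zipc b = Case 3 (\<lambda>a. Case 5 (\<lambda>f.
     Push 9 (sy (Pre (min a 2) (f \<noteq> 0) b)) ;; Push 10 1 ;; Pop 3 ;; Pop 5))"

definition prepare :: "nat poly \<Rightarrow> nat poly \<Rightarrow> com" where
  "prepare q p = For 0 (\<lambda>a. Push 3 a ;; Push 4 1) ;; horner 5 (coeffs q) ;; horner 8 (coeffs p) ;;
     Each 5 12 (\<lambda>_. Push 14 1)"

definition bottom :: com where
  "bottom = Push 9 1 ;; Push 10 1 ;; Each 8 12 (\<lambda>_. plain) ;; zipc True ;; For 4 (\<lambda>_. zipc False) ;;
     For 14 (\<lambda>_. zipc False) ;; plain ;; Each 8 12 (\<lambda>_. plain) ;; Push 9 5 ;; Push 10 1"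

text \<open>Row 0 is already present and \<open>N\<close> is \<open>(T + 3) * W\<close>, so
  \<open>T + 2\<close> rows of type 2 follow, whence the two pushes on stack 8. The \<open>W\<close>
  positions from \<open>N\<close> on are one of type 3 and \<open>W - 1\<close> of type 4, whence
  the \<open>Pop 15\<close>.\<close>

definition upper :: com where
  "upper = Push 8 1 ;; Push 8 1 ;; Each 10 12 (\<lambda>_. Push 11 1) ;;
     For 8 (\<lambda>_. Each 10 12 (\<lambda>_. Push 9 2 ;; Push 11 1)) ;; Push 9 3 ;; Each 10 12 (\<lambda>_. Push 15 1) ;; Pop 15 ;;
     For 15 (\<lambda>_. Push 9 4)"

text \<open>A normal form for stores, in which updates are plain rewriting of arguments.\<close>

definition regs :: "nat list \<Rightarrow> nat list \<Rightarrow> nat list \<Rightarrow> nat list \<Rightarrow> nat list \<Rightarrow> nat list \<Rightarrow> nat list \<Rightarrow>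
    nat list \<Rightarrow> nat list \<Rightarrow> store" where
  "regs c3 c4 c5 c8 c9 c10 c11 c14 c15 =
     (\<lambda>_. [])(3 := c3, 4 := c4, 5 := c5, 8 := c8, 9 := c9, 10 := c10, 11 := c11, 14 := c14, 15 := c15)"

lemma regs_read [simp]:
  "regs c3 c4 c5 c8 c9 c10 c11 c14 c15 3 = c3"
  "regs c3 c4 c5 c8 c9 c10 c11 c14 c15 4 = c4"
  "regs c3 c4 c5 c8 c9 c10 c11 c14 c15 5 = c5"
  "regs c3 c4 c5 c8 c9 c10 c11 c14 c15 8 = c8"
  "regs c3 c4 c5 c8 c9 c10 c11 c14 c15 9 = c9"
  "regs c3 c4 c5 c8 c9 c10 c11 c14 c15 10 = c10"
  "regs c3 c4 c5 c8 c9 c10 c11 c14 c15 11 = c11"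
  "regs c3 c4 c5 c8 c9 c10 c11 c14 c15 14 = c14"
  "regs c3 c4 c5 c8 c9 c10 c11 c14 c15 15 = c15"
  "regs c3 c4 c5 c8 c9 c10 c11 c14 c15 1 = []"
  "regs c3 c4 c5 c8 c9 c10 c11 c14 c15 (Suc 0) = []"
  "regs c3 c4 c5 c8 c9 c10 c11 c14 c15 6 = []"
  "regs c3 c4 c5 c8 c9 c10 c11 c14 c15 7 = []"
  "regs c3 c4 c5 c8 c9 c10 c11 c14 c15 12 = []"
  "regs c3 c4 c5 c8 c9 c10 c11 c14 c15 13 = []"
  by (simp_all add: regs_def)

lemma regs_upd [simp]:
  "(regs c3 c4 c5 c8 c9 c10 c11 c14 c15)(3 := v) = regs v c4 c5 c8 c9 c10 c11 c14 c15"
  "(regs c3 c4 c5 c8 c9 c10 c11 c14 c15)(4 := v) = regs c3 v c5 c8 c9 c10 c11 c14 c15"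
  "(regs c3 c4 c5 c8 c9 c10 c11 c14 c15)(5 := v) = regs c3 c4 v c8 c9 c10 c11 c14 c15"
  "(regs c3 c4 c5 c8 c9 c10 c11 c14 c15)(8 := v) = regs c3 c4 c5 v c9 c10 c11 c14 c15"
  "(regs c3 c4 c5 c8 c9 c10 c11 c14 c15)(9 := v) = regs c3 c4 c5 c8 v c10 c11 c14 c15"
  "(regs c3 c4 c5 c8 c9 c10 c11 c14 c15)(10 := v) = regs c3 c4 c5 c8 c9 v c11 c14 c15"
  "(regs c3 c4 c5 c8 c9 c10 c11 c14 c15)(11 := v) = regs c3 c4 c5 c8 c9 c10 v c14 c15"
  "(regs c3 c4 c5 c8 c9 c10 c11 c14 c15)(14 := v) = regs c3 c4 c5 c8 c9 c10 c11 v c15"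
  "(regs c3 c4 c5 c8 c9 c10 c11 c14 c15)(15 := v) = regs c3 c4 c5 c8 c9 c10 c11 c14 v"
  by (auto simp: regs_def fun_eq_iff)

lemma sem_For_const: "sem (For i (\<lambda>_. c)) s = (sem c ^^ length (s i)) (s(i := []))"
  by (simp only: sem.simps(6) fold_const)

lemma sem_zipc:
  "sem (zipc b) (regs c3 c4 c5 c8 c9 c10 c11 c14 c15) =
    regs (tl c3) c4 (tl c5) c8 (sy (Pre (min (peek c3) 2) (peek c5 \<noteq> 0) b) # c9) (1 # c10) c11 c14 c15"
  by (simp add: zipc_def)

lemma sem_plain_funpow:
  "(sem plain ^^ j) (regs c3 c4 c5 c8 c9 c10 c11 c14 c15) =
    regs c3 c4 c5 c8 (replicate j 6 @ c9) (replicate j 1 @ c10) c11 c14 c15"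
  unfolding plain_def by (subst sem_Push2_funpow) simp_all

lemma sem_zipc_funpow:
  "(sem (zipc False) ^^ j) (regs (drop d xs) c4 (drop d fs) c8 c9 c10 c11 c14 c15) =
    regs (drop (d + j) xs) c4 (drop (d + j) fs) c8
      (rev (map (\<lambda>i. sy (Pre (min (peek (drop i xs)) 2) (peek (drop i fs) \<noteq> 0) False)) [d..<d + j]) @ c9)
      (replicate j 1 @ c10) c11 c14 c15"
proof (induction j arbitrary: c9 c10)
  case (Suc j)
  show ?case
    by (simp only: funpow.simps comp_apply Suc.IH sem_zipc) (simp add: drop_Suc tl_drop)
qed simp

lemma sem_plain:
  "sem plain (regs c3 c4 c5 c8 c9 c10 c11 c14 c15) = regs c3 c4 c5 c8 (6 # c9) (1 # c10) c11 c14 c15"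
  by (simp add: plain_def)

lemma sem_Each_plain:
  "sem (Each 8 12 (\<lambda>_. plain)) (regs c3 c4 c5 c8 c9 c10 c11 c14 c15) =
    regs c3 c4 c5 c8 (replicate (length c8) 6 @ c9) (replicate (length c8) 1 @ c10) c11 c14 c15"
proof -
  have "fresh 8 plain" "fresh 12 plain" by (simp_all add: plain_def)
  then show ?thesis by (subst sem_Each_const) (simp_all add: sem_plain_funpow)
qed

lemma sem_For_zipc:
  "sem (For 4 (\<lambda>_. zipc False)) (regs (drop d xs) c4 (drop d fs) c8 c9 c10 c11 c14 c15) =
    regs (drop (d + length c4) xs) [] (drop (d + length c4) fs) c8
      (rev (map (\<lambda>i. sy (Pre (min (peek (drop i xs)) 2) (peek (drop i fs) \<noteq> 0) False)) [d..<d + length c4]) @ c9)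
      (replicate (length c4) 1 @ c10) c11 c14 c15"
  "sem (For 14 (\<lambda>_. zipc False)) (regs (drop d xs) c4 (drop d fs) c8 c9 c10 c11 c14 c15) =
    regs (drop (d + length c14) xs) c4 (drop (d + length c14) fs) c8
      (rev (map (\<lambda>i. sy (Pre (min (peek (drop i xs)) 2) (peek (drop i fs) \<noteq> 0) False)) [d..<d + length c14]) @ c9)
      (replicate (length c14) 1 @ c10) c11 [] c15"
  by (simp_all only: sem_For_const regs_read regs_upd sem_zipc_funpow)

lemma sem_Each_count:
  "sem (Each 10 12 (\<lambda>_. Push 11 1)) (regs c3 c4 c5 c8 c9 c10 c11 c14 c15) =
    regs c3 c4 c5 c8 c9 c10 (replicate (length c10) 1 @ c11) c14 c15"
  "sem (Each 10 12 (\<lambda>_. Push 15 1)) (regs c3 c4 c5 c8 c9 c10 c11 c14 c15) =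
    regs c3 c4 c5 c8 c9 c10 c11 c14 (replicate (length c10) 1 @ c15)"
  by (subst sem_Each_const, simp_all add: sem_Push_funpow del: sem.simps)+

lemma sem_For_top:
  "sem (For 15 (\<lambda>_. Push 9 4)) (regs c3 c4 c5 c8 c9 c10 c11 c14 c15) =
    regs c3 c4 c5 c8 (replicate (length c15) 4 @ c9) c10 c11 c14 []"
  by (simp only: sem_For_const sem_Push_funpow regs_upd regs_read)

lemma sem_upper_regs:
  "sem upper (regs [] [] [] (replicate t 1) y (replicate (Suc w) 1) [] [] []) =
    regs [] [] [] [] (replicate w 4 @ 3 # replicate ((t + 2) * Suc w) 2 @ y) (replicate (Suc w) 1)
      (replicate ((t + 2) * Suc w) 1 @ replicate (Suc w) 1) [] []"
proof -
  have loop: "(sem (Each 10 12 (\<lambda>_. Push 9 2 ;; Push 11 1)) ^^ j) (regs [] [] [] [] c9 (replicate v 1) c11 [] []) =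
      regs [] [] [] [] (replicate (j * v) 2 @ c9) (replicate v 1) (replicate (j * v) 1 @ c11) [] []" for j v c9 c11
  proof (induction j arbitrary: c9 c11)
    case (Suc j)
    have "sem (Each 10 12 (\<lambda>_. Push 9 2 ;; Push 11 1)) (regs [] [] [] [] c9 (replicate v 1) c11 [] []) =
        regs [] [] [] [] (replicate v 2 @ c9) (replicate v 1) (replicate v 1 @ c11) [] []"
      by (subst sem_Each_const) (simp_all add: sem_Push2_funpow del: sem.simps)
    moreover have "replicate (j * v) a @ replicate v a @ c = replicate (Suc j * v) a @ c" for a :: nat and c
      by (simp add: add.commute flip: append_assoc replicate_add)
    ultimately show ?case unfolding funpow_Suc_right comp_apply by (simp only: Suc.IH)
  qed simp
  have s: "sem (Push 8 1) (sem (Push 8 1) (regs [] [] [] (replicate t 1) c9 c10 [] [] [])) =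
      regs [] [] [] (replicate (t + 2) 1) c9 c10 [] [] []" for c9 c10
    by simp
  have tl: "tl (replicate (Suc w) 1 @ []) = replicate w (1 :: nat)" "tl (replicate (Suc w) 1) = replicate w (1 :: nat)"
    by simp_all
  show ?thesis
    unfolding upper_def sem.simps(4) s
    by (simp only: sem_Each_count sem_For_top sem_For_const loop regs_read regs_upd sem.simps(2,3) length_replicate tl
        sem_Push_funpow append_Nil2)
qed

lemma sem_prepare:
  "sem (prepare q p) (store_of [x]) =
    regs (bits x) (replicate (length x) 1) (replicate (poly q (length x)) 1) (replicate (poly p (length x)) 1)
      [] [] [] (replicate (poly q (length x)) 1) []"
proof -
  have fold: "fold (\<lambda>a. sem (Push 3 a ;; Push 4 1)) xs s = s(3 := rev xs @ s 3, 4 := replicate (length xs) 1 @ s 4)" for xs s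
    by (induction xs arbitrary: s) (auto simp: fun_eq_iff replicate_append_same)
  have "store_of [x] = (regs [] [] [] [] [] [] [] [] [])(0 := rev (bits x))"
    by (auto simp: store_of_def regs_def fun_eq_iff)
  then have "sem (For 0 (\<lambda>a. Push 3 a ;; Push 4 1)) (store_of [x]) =
      fold (\<lambda>a. sem (Push 3 a ;; Push 4 1)) (rev (bits x)) (regs [] [] [] [] [] [] [] [] [])"
    by (simp only: sem.simps(6) fun_upd_same fun_upd_upd) (simp add: regs_def fun_upd_idem)
  also have "\<dots> = regs (bits x) (replicate (length x) 1) [] [] [] [] [] [] []"
    unfolding fold by (simp add: bits_def)
  finally have "sem (For 0 (\<lambda>a. Push 3 a ;; Push 4 1)) (store_of [x]) =
      regs (bits x) (replicate (length x) 1) [] [] [] [] [] [] []" .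
  then show ?thesis
    unfolding prepare_def sem.simps(4)
    by (simp add: sem_horner sem_Each_const sem_Push_funpow poly_foldr del: sem.simps)
qed

lemma peek_drop_bits: "peek (drop i (bits x)) = contents x (int i)"
  by (cases "i < length x") (auto simp: Cons_nth_drop_Suc[symmetric] bits_def contents_def)

lemma peek_drop_replicate: "peek (drop i (replicate n 1)) \<noteq> 0 \<longleftrightarrow> i < n"
  by (cases "n - i") auto

context history
begin

definition ysym :: "nat \<Rightarrow> nat" where
  "ysym i = (if i = 0 then 1 else if i < W then sy (bot i) else if i < N then 2 else if i = N then 3 else 4)"

lemma map_upt_const: "(\<And>i. a \<le> i \<Longrightarrow> i < b \<Longrightarrow> f i = y) \<Longrightarrow> map f [a..<b] = replicate (b - a) y"
  by (rule nth_equalityI) auto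

lemma map_upt_append: "a \<le> b \<Longrightarrow> b \<le> c \<Longrightarrow> map f [a..<c] = map f [a..<b] @ map f [b..<c]"
  by (metis le_Suc_ex map_append upt_add_eq_append)

end

locale instance_history = ntm +
  fixes x :: "bool list" and q p :: "nat poly"
begin

abbreviation len where "len \<equiv> length x"
abbreviation n where "n \<equiv> poly q len"
abbreviation T where "T \<equiv> poly p len"
text \<open>Position 0, \<open>T\<close> blanks, the origin, \<open>len + n\<close> further
  positions and \<open>T + 1\<close> blanks, in the order in which \<open>bottom\<close> writes
  them.\<close>

abbreviation E where "E \<equiv> 2 * T + n + len + 3"

sublocale history M x n T "Suc T" E
  by unfold_locales auto

lemma sem_bottom:
  "sem bottom (regs (bits x) (replicate len 1) (replicate n 1) (replicate T 1) [] [] [] (replicate n 1) []) =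
    regs [] [] [] (replicate T 1) (rev (map ysym [0..<W])) (replicate W 1) [] [] []"
proof -
  define z where "z i = sy (Pre (min (peek (drop i (bits x))) 2) (peek (drop i (replicate n 1)) \<noteq> 0) False)" for i
  define z0 where "z0 = sy (Pre (min (peek (bits x)) 2) (peek (replicate n (1 :: nat)) \<noteq> 0) True)"
  have tl: "tl xs = drop 1 xs" for xs :: "nat list" by (simp add: drop_Suc)
  have "sem bottom (regs (bits x) (replicate len 1) (replicate n 1) (replicate T 1) [] [] [] (replicate n 1) []) =
    regs (drop (1 + len + n) (bits x)) [] (drop (1 + len + n) (replicate n 1)) (replicate T 1)
     (5 # replicate T 6 @ 6 # rev (map z [1 + len..<1 + len + n]) @ rev (map z [1..<1 + len]) @ z0 # replicate T 6 @ [1])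
     (1 # replicate T 1 @ 1 # replicate n 1 @ replicate len 1 @ 1 # replicate T 1 @ [1]) [] [] []"
    unfolding bottom_def sem.simps(4) z_def z0_def
    by (simp only: sem_Each_plain sem_For_zipc tl sem_zipc sem_plain regs_read regs_upd length_replicate
        sem.simps(2) append_assoc append_Cons append_Nil)
  also have "drop (1 + len + n) (bits x) = []" by (simp add: bits_def)
  also have "drop (1 + len + n) (replicate n (1 :: nat)) = []" by simp
  also have "1 # replicate T 1 @ 1 # replicate n 1 @ replicate len 1 @ 1 # replicate T 1 @ [1] = replicate W (1 :: nat)"
    by (rule replicate_eqI) auto
  also have "5 # replicate T 6 @ 6 # rev (map z [1 + len..<1 + len + n]) @ rev (map z [1..<1 + len]) @ z0 # replicate T 6 @ [1] =
      rev (map ysym [0..<W])"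
  proof -
    have b: "bot (Suc T + i) = Pre (contents x (int i)) (i < n) (i = 0)" if "i < 1 + len + n" for i
      using that by (auto simp: bot_def)
    have c2: "min (contents x i) 2 = contents x i" for i by (simp add: contents_def)
    have z: "map z [i..<j] = map ysym [Suc T + i..<Suc T + j]" if "1 \<le> i" "i \<le> j" "j \<le> 1 + len + n" for i j
    proof (rule nth_equalityI)
      fix k assume "k < length (map z [i..<j])"
      then have k: "i + k < j" by simp
      have "ysym (Suc T + (i + k)) = sy (bot (Suc T + (i + k)))" using k that by (simp add: ysym_def)
      then have "z (i + k) = ysym (Suc T + (i + k))"
        using b[of "i + k"] k that unfolding z_def peek_drop_bits peek_drop_replicate c2 by simp
      then show "map z [i..<j] ! k = map ysym [Suc T + i..<Suc T + j] ! k"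
        using k by (simp add: add.assoc del: upt_Suc)
    qed (simp del: upt_Suc)
    have z0: "z0 = ysym (Suc T)"
      using b[of 0] peek_drop_bits[of 0 x] peek_drop_replicate[of 0 n] unfolding z0_def
      by (simp add: ysym_def c2)
    have plain: "ysym i = 6" if "0 < i" "i < Suc T \<or> Suc T + 1 + len + n \<le> i \<and> i < E" for i
    proof -
      have "bot i = Pre 0 False False" using that by (auto simp: bot_def contents_def)
      moreover have "0 < i" "i < W" using that by linarith+
      then have "ysym i = sy (bot i)" unfolding ysym_def by simp
      ultimately show ?thesis by simp
    qed
    have "map ysym [0..<W] = map ysym [0..<1] @ map ysym [1..<Suc T] @ map ysym [Suc T..<Suc T + 1] @
        map ysym [Suc T + 1..<Suc T + (1 + len)] @ map ysym [Suc T + (1 + len)..<Suc T + (1 + len + n)] @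
        map ysym [Suc T + (1 + len + n)..<E] @ map ysym [E..<W]"
      using map_upt_append[of 0 1 W ysym] map_upt_append[of 1 "Suc T" W ysym]
        map_upt_append[of "Suc T" "Suc T + 1" W ysym] map_upt_append[of "Suc T + 1" "Suc T + (1 + len)" W ysym]
        map_upt_append[of "Suc T + (1 + len)" "Suc T + (1 + len + n)" W ysym]
        map_upt_append[of "Suc T + (1 + len + n)" E W ysym]
      by (simp del: upt_Suc)
    moreover have "map ysym [1..<Suc T] = replicate T 6"
      using map_upt_const[of 1 "Suc T" ysym 6] plain by simp
    moreover have "map ysym [Suc T + (1 + len + n)..<E] = replicate (Suc T) 6"
      using map_upt_const[of "Suc T + (1 + len + n)" E ysym 6] plain by simp
    moreover have "[a..<Suc a] = [a]" for a :: nat by simp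
    moreover have "ysym E = 5" unfolding ysym_def bot_def by simp
    then have "map ysym [E..<W] = [5]" unfolding \<open>\<And>a. [a..<Suc a] = [a]\<close> by simp
    moreover have "map ysym [0..<1] = [1]" by (simp add: ysym_def)
    moreover have "map ysym [Suc T..<Suc T + 1] = [z0]" by (simp add: z0)
    moreover note z[of 1 "1 + len"] z[of "1 + len" "1 + len + n"]
    ultimately show ?thesis by (simp only: rev_append rev_replicate append_assoc) (simp add: replicate_append_same)
  qed
  finally show ?thesis .
qed

lemma sem_upper:
  "sem upper (regs [] [] [] (replicate T 1) (rev (map ysym [0..<W])) (replicate W 1) [] [] []) =
    regs [] [] [] [] (rev (map ysym [0..<N + W])) (replicate W 1) (replicate N 1) [] []"
proof -
  have "sem upper (regs [] [] [] (replicate T 1) (rev (map ysym [0..<W])) (replicate W 1) [] [] []) =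
    regs [] [] [] [] (replicate E 4 @ 3 # replicate ((T + 2) * W) 2 @ rev (map ysym [0..<W])) (replicate W 1)
      (replicate ((T + 2) * W) 1 @ replicate W 1) [] []"
    by (rule sem_upper_regs)
  also have "replicate ((T + 2) * W) 1 @ replicate W (1 :: nat) = replicate N 1"
    by (simp add: algebra_simps flip: replicate_add)
  also have "replicate E 4 @ 3 # replicate ((T + 2) * W) 2 @ rev (map ysym [0..<W]) = rev (map ysym [0..<N + W])"
  proof -
    have WN': "W \<le> N" by (rule WN)
    have "N - W = (T + 2) * W" by (simp add: algebra_simps)
    then have 2: "map ysym [W..<N] = replicate ((T + 2) * W) 2"
      using map_upt_const[of W N ysym 2] by (simp add: ysym_def)
    have "ysym i = 4" if "Suc N \<le> i" for i
    proof -
      have "i \<noteq> 0" "\<not> i < W" "\<not> i < N" "i \<noteq> N" using that WN' by linarith+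
      then show ?thesis unfolding ysym_def by simp
    qed
    then have "map ysym [Suc N..<N + W] = replicate (N + W - Suc N) 4" by (rule map_upt_const)
    moreover have "N + W - Suc N = E" by linarith
    ultimately have 4: "map ysym [Suc N..<N + W] = replicate E 4" by (simp only:)
    have "N \<noteq> 0" "\<not> N < W" using WN by linarith+
    then have 3: "ysym N = 3" unfolding ysym_def by simp
    have "map ysym [0..<N + W] = map ysym [0..<W] @ map ysym [W..<N] @ map ysym [N..<N + W]"
      using map_upt_append[of 0 W "N + W" ysym] map_upt_append[of W N "N + W" ysym] WN' by simp
    also have "map ysym [N..<N + W] = 3 # replicate E 4"
      by (subst upt_conv_Cons) (use 3 4 in simp_all)
    finally show ?thesis unfolding 2 by simp
  qed
  finally show ?thesis .
qed

end

section \<open>The digit tables and the printing program\<close>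

context ntm
begin

definition capg :: nat where
  "capg = (2 * length G + 1) * (m + 1)"

text \<open>The digits of the target at a position depend on its type only, so a finite table inside
  the program replaces all arithmetic; \<open>symS\<close> is the analogue for the sum of all
  items.\<close>

definition symT :: "nat \<Rightarrow> nat \<times> nat \<times> nat" where
  "symT y =
    (if y = 1 then (1, m - hcode Hash (Pre 0 False False), m - code (Pre 0 False False))
     else if y = 2 then (1, m, m)
     else if y = 3 then (0, hcode Hash Done, code Done)
     else if y = 4 then (0, 0, code Done)
     else (1, m, m - code (unsy y)))"

definition symS :: "nat \<Rightarrow> nat \<times> nat \<times> nat" where
  "symS y = (let l = \<Sum>\<tau>\<leftarrow>G. m - lf \<tau>; r = \<Sum>\<tau>\<leftarrow>G. rt \<tau>; d = \<Sum>\<tau>\<leftarrow>G. m - dn \<tau>; u = \<Sum>\<tau>\<leftarrow>G. up \<tau> in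
     if y = 1 then (length G, l, d)
     else if y = 2 then (length G, l + r, d + u)
     else if y = 3 then (0, r, u)
     else if y = 4 then (0, 0, u)
     else (length G, l + r, d))"

definition tabZ :: "nat \<Rightarrow> bool list" where
  "tabZ y = blk e capg capg capg"

definition tab1 :: "nat \<Rightarrow> bool list" where
  "tab1 y = (case symT y of (a, b, c) \<Rightarrow> blk e (capg - a) (capg - b) (capg - c))"

definition tab2 :: "nat \<Rightarrow> bool list" where
  "tab2 y = (case symT y of (a, b, c) \<Rightarrow> case symS y of (a', b', c') \<Rightarrow>
     blk e (capg - a' + a) (capg - b' + b) (capg - c' + c))"

definition number :: "(nat \<Rightarrow> bool list) \<Rightarrow> com" where
  "number tab = pushes 1 (dbits [True]) ;; Each 9 12 (\<lambda>y. pushes 1 (dbits (tab y))) ;; pushes 1 (cbits [Comma])"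

definition zeros :: "nat \<Rightarrow> com" where
  "zeros i = Each i 12 (\<lambda>_. pushes 1 (dbits (replicate (3 * e) False)))"

definition emit_tile :: "tile \<Rightarrow> com" where
  "emit_tile \<tau> = pushes 1 (dbits (binary (up \<tau>) @ replicate (2 * e) False)) ;; zeros 10 ;;
     pushes 1 (dbits (blk e 0 (rt \<tau>) 0 @ blk e 1 (m - lf \<tau>) (m - dn \<tau>))) ;; zeros 13 ;; pushes 1 (cbits [Comma])"

definition emit_items :: com where
  "emit_items = For 11 (\<lambda>_. seqs (map emit_tile G) ;; Push 13 1)"

text \<open>The bound comes first, then the family. The two \<open>Pop 10\<close> leave the
  \<open>W - 2\<close> marks that \<open>emit_tile\<close> needs for the empty positions between
  \<open>p + 1\<close> and \<open>p + W\<close>.\<close>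

definition emission :: com where
  "emission = number tabZ ;; Pop 10 ;; Pop 10 ;; emit_items ;; number tab1 ;; number tab2 ;;
     pushes 1 (cbits [Minus]) ;; number tabZ ;; pushes 1 (cbits [Minus]) ;; number tabZ"

definition reduce :: "nat poly \<Rightarrow> nat poly \<Rightarrow> com" where
  "reduce q p = prepare q p ;; bottom ;; upper ;; emission"

lemma concat_map_product:
  "concat (map h (List.product xs ys)) = concat (map (\<lambda>x. concat (map (\<lambda>y. h (x, y)) ys)) xs)"
  by (induction xs) (auto simp: comp_def)

lemma emits_number:
  assumes "s 12 = []"
  shows "emits s (number tab) (dbits (True # concat (map tab (s 9))) @ cbits [Comma])"
proof -
  have "emits s (Each 9 12 (\<lambda>y. pushes 1 (dbits (tab y)))) (concat (map (\<lambda>y. dbits (tab y)) (s 9)))"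
    by (rule emits_Each) (use assms emits_pushes in auto)
  then have "emits s (number tab) (dbits [True] @ concat (map (\<lambda>y. dbits (tab y)) (s 9)) @ cbits [Comma])"
    unfolding number_def by (intro emits_Seq emits_pushes)
  moreover have "dbits (True # concat (map tab (s 9))) = dbits [True] @ concat (map (\<lambda>y. dbits (tab y)) (s 9))"
    using dbits_append[of "[True]" "concat (map tab (s 9))"] by (simp add: dbits_concat comp_def)
  ultimately show ?thesis by simp
qed

lemma emits_zeros:
  assumes "s 12 = []" "i \<noteq> 12" "i \<noteq> 1"
  shows "emits s (zeros i) (dbits (concat (replicate (length (s i)) (replicate (3 * e) False))))"
proof -
  have "emits s (zeros i) (concat (map (\<lambda>_. dbits (replicate (3 * e) False)) (s i)))"
    unfolding zeros_def by (rule emits_Each) (use assms emits_pushes in auto)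
  then show ?thesis by (simp add: dbits_concat map_replicate_const)
qed

lemma fresh_emit_tile: "fresh 13 (zeros 10)" "j \<notin> {1, 10, 12, 13} \<Longrightarrow> fresh j (emit_tile \<tau>)"
  by (simp_all add: zeros_def emit_tile_def)

lemma ptime_pushes_out: "set w \<subseteq> {1, 2} \<Longrightarrow> ptime 16 18 (pushes 1 w)"
  by (rule ptime_tame[of "{}" _ 0]) auto

lemma wfc_out: "wfc 16 18 (pushes 1 (dbits bs))" "wfc 16 18 (pushes 1 (cbits cs))"
  using set_dbits[of bs] set_cbits[of cs] by auto

lemma ptime_number: "ptime 16 18 (number tab)"
proof -
  have "ptime 16 18 (Each 9 12 (\<lambda>y. pushes 1 (dbits (tab y))))"
    by (rule ptime_tame[of "{9, 12}" _ 0]) (simp_all add: wfc_out del: wfc_pushes One_nat_def)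
  then show ?thesis unfolding number_def
    by (intro ptime_Seq ptime_pushes_out set_dbits set_cbits) auto
qed

text \<open>The credit of the loop over stack 11 pays for the growth of the position counter 13,
  over which inner loops run.\<close>

lemma ptime_emit_items: "ptime 16 18 emit_items"
proof (rule ptime_tame[of "{10, 11, 12, 13}" _ 0])
  have "tame {10, 11, 12, 13} (emit_tile \<tau>) 0" for \<tau>
    by (simp add: emit_tile_def zeros_def)
  then show "tame {10, 11, 12, 13} emit_items 0"
    by (simp add: emit_items_def fresh_emit_tile del: One_nat_def)
  show "wfc 16 18 emit_items"
    by (auto simp: emit_items_def emit_tile_def zeros_def wfc_out simp del: wfc_pushes One_nat_def)
qed auto

lemma ptime_Push: "i < k \<Longrightarrow> 0 < a \<Longrightarrow> a < S \<Longrightarrow> ptime k S (Push i a)"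
  by (rule ptime_tame[of "{}" _ 0]) auto

lemma ptime_Pop: "i < k \<Longrightarrow> 0 < S \<Longrightarrow> ptime k S (Pop i)"
  by (rule ptime_tame[of "{}" _ 0]) auto

lemma wfc_zipc: "wfc 16 18 (zipc b)"
  by (auto simp: zipc_def)

text \<open>The alphabet extends to 17 because this is \<open>sy (Pre 2 True True)\<close>. The
  pieces have different loop stacks: stack 9 grows freely while the word of types is built and
  drives loops only afterwards.\<close>

lemma ptime_reduce: "ptime 16 18 (reduce q p)"
proof -
  have "ptime 16 18 (For 0 (\<lambda>a. Push 3 a ;; Push 4 1))"
    by (rule ptime_tame[of "{0}" _ 0]) auto
  moreover have "ptime 16 18 (Each 5 12 (\<lambda>_. Push 14 1))"
    by (rule ptime_tame[of "{5, 12}" _ 0]) auto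
  ultimately have 1: "ptime 16 18 (prepare q p)"
    unfolding prepare_def by (intro ptime_Seq ptime_horner) auto
  have plain: "ptime 16 18 plain"
    unfolding plain_def by (intro ptime_Seq ptime_Push) auto
  have each: "ptime 16 18 (Each 8 12 (\<lambda>_. plain))"
    by (rule ptime_tame[of "{8, 12}" _ 0]) (auto simp: plain_def)
  have zip: "ptime 16 18 (zipc b)" for b
    by (rule ptime_tame[of "{}" _ 0]) (auto simp: wfc_zipc, simp add: zipc_def)
  have "fresh 4 (zipc b)" "fresh 14 (zipc b)" "tame {4, 14} (zipc b) 1" for b
    by (auto simp: zipc_def)
  then have "ptime 16 18 (For i (\<lambda>_. zipc False))" if "i \<in> {4, 14}" for i
    using that by (intro ptime_tame[of "{4, 14}" _ 0]) (auto simp: wfc_zipc)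
  then have 2: "ptime 16 18 bottom"
    unfolding bottom_def by (intro ptime_Seq ptime_Push plain each zip) auto
  have "ptime 16 18 (Each 10 12 (\<lambda>_. Push 11 1))" "ptime 16 18 (Each 10 12 (\<lambda>_. Push 15 1))"
    by (rule ptime_tame[of "{10, 12}" _ 0]; auto)+
  moreover have "ptime 16 18 (For 8 (\<lambda>_. Each 10 12 (\<lambda>_. Push 9 2 ;; Push 11 1)))"
    by (rule ptime_tame[of "{8, 10, 12}" _ 0]) auto
  moreover have "ptime 16 18 (For 15 (\<lambda>_. Push 9 4))"
    by (rule ptime_tame[of "{15}" _ 0]) auto
  ultimately have 3: "ptime 16 18 upper"
    unfolding upper_def by (intro ptime_Seq ptime_Push ptime_Pop) auto
  have 4: "ptime 16 18 emission"
    unfolding emission_def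
    by (intro ptime_Seq ptime_number ptime_emit_items ptime_Pop ptime_pushes_out set_cbits) auto
  show ?thesis unfolding reduce_def using 1 2 3 4 by (intro ptime_Seq) auto
qed

end

context instance_history
begin

lemma capg: "til.cap = capg"
  by (simp add: capg_def til.cap_def)

lemma unsy_bot: "unsy (sy (bot c)) = bot c"
  by (cases "c < E") (simp_all add: bot_def unsy_sy contents_less del: sy.simps)

lemma sym_ysym:
  assumes "i < N + W"
  shows "symT (ysym i) = (til.tk i, til.th i, til.tv i)" "symS (ysym i) = (til.sk i, til.sh i, til.sv i)"
proof -
  have WN': "W \<le> N" "0 < W" "0 < N" by (rule WN)+
  consider "i = 0" | "0 < i" "i < W" | "W \<le> i" "i < N" | "i = N" | "N < i" by linarith
  then have "symT (ysym i) = (til.tk i, til.th i, til.tv i) \<and> symS (ysym i) = (til.sk i, til.sh i, til.sv i)"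
  proof cases
    case 1
    have "ysym i = 1" unfolding ysym_def using 1 by simp
    then show ?thesis unfolding symT_def symS_def til.tk_def til.th_def til.tv_def til.sk_def til.sh_def til.sv_def
      using 1 WN' bot_0 by (simp only: if_True if_False) simp
  next
    case 2
    have i: "i < N" "i \<noteq> 0" "\<not> W \<le> i" "i \<le> N" using 2 WN' by linarith+
    have y: "ysym i = sy (bot i)" unfolding ysym_def using 2 by simp
    have n: "sy (bot i) \<noteq> 1" "sy (bot i) \<noteq> 2" "sy (bot i) \<noteq> 3" "sy (bot i) \<noteq> 4"
      using sy_bounds(1)[of "bot i"] by linarith+
    show ?thesis
      unfolding y symT_def symS_def til.tk_def til.th_def til.tv_def til.sk_def til.sh_def til.sv_def Let_def
      using n i 2 by (simp only: unsy_bot if_True if_False simp_thms add_0_right)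
  next
    case 3
    have i: "i \<noteq> 0" "0 < i" "\<not> i < W" "i \<le> N" using 3 WN' by linarith+
    have y: "ysym i = 2" unfolding ysym_def using 3 i by simp
    show ?thesis
      unfolding y symT_def symS_def til.tk_def til.th_def til.tv_def til.sk_def til.sh_def til.sv_def Let_def
      using i 3 by simp
  next
    case 4
    have i: "i \<noteq> 0" "0 < i" "\<not> i < W" "W \<le> i" "\<not> i < N" "i \<le> N" using 4 WN' by linarith+
    have y: "ysym i = 3" unfolding ysym_def using i 4 by (simp only: if_False if_True simp_thms)
    show ?thesis
      unfolding y symT_def symS_def til.tk_def til.th_def til.tv_def til.sk_def til.sh_def til.sv_def Let_def
      using i 4 by (simp only: if_False if_True simp_thms) simp
  next
    case 5
    have i: "i \<noteq> 0" "0 < i" "\<not> i < W" "W \<le> i" "\<not> i < N" "\<not> i \<le> N" "i \<noteq> N" using 5 WN' by linarith+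
    have y: "ysym i = 4" unfolding ysym_def using i by (simp only: if_False if_True simp_thms)
    show ?thesis
      unfolding y symT_def symS_def til.tk_def til.th_def til.tv_def til.sk_def til.sh_def til.sv_def Let_def
      using i by (simp only: if_False if_True simp_thms) simp
  qed
  then show "symT (ysym i) = (til.tk i, til.th i, til.tv i)" "symS (ysym i) = (til.sk i, til.sh i, til.sv i)" by auto
qed

lemma emits_numbers:
  assumes "s 12 = []" "s 9 = rev (map ysym [0..<N + W])"
  shows "emits s (number tabZ) (cbits (int_chars (int til.big)))"
    and "emits s (number tab1) (cbits (int_chars (int til.fill1)))"
    and "emits s (number tab2) (cbits (int_chars (int til.fill2)))"
proof -
  have *: "emits s (number tab) (dbits (True # concat (map t (rev [0..<N + W]))) @ cbits [Comma])"
    if "\<And>i. i < N + W \<Longrightarrow> tab (ysym i) = t i" for tab t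
  proof -
    have "map tab (s 9) = map (\<lambda>i. tab (ysym i)) (rev [0..<N + W])"
      unfolding assms(2) by (simp only: rev_map[symmetric] map_map comp_def)
    also have "\<dots> = map t (rev [0..<N + W])" using that by (intro map_cong refl) simp
    finally show ?thesis using emits_number[of s tab] assms(1) by (simp only:)
  qed
  show "emits s (number tabZ) (cbits (int_chars (int til.big)))"
    unfolding cbits_nat til.binary_big by (rule *) (simp add: tabZ_def capg)
  show "emits s (number tab1) (cbits (int_chars (int til.fill1)))"
    unfolding cbits_nat til.binary_fill1 by (rule *) (simp only: tab1_def capg sym_ysym case_prod_conv)
  show "emits s (number tab2) (cbits (int_chars (int til.fill2)))"
    unfolding cbits_nat til.binary_fill2 by (rule *) (simp only: tab2_def capg sym_ysym case_prod_conv)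
qed

lemma emits_tile:
  assumes "s 12 = []" "length (s 10) = W - 2" "length (s 13) = j" "\<tau> \<in> set G"
  shows "emits s (emit_tile \<tau>) (cbits (int_chars (int (til.item (j, \<tau>)))))"
proof -
  have "emits s (emit_tile \<tau>) (dbits (binary (up \<tau>) @ replicate (2 * e) False) @
      dbits (concat (replicate (W - 2) (replicate (3 * e) False))) @
      dbits (blk e 0 (rt \<tau>) 0 @ blk e 1 (m - lf \<tau>) (m - dn \<tau>)) @
      dbits (concat (replicate j (replicate (3 * e) False))) @ cbits [Comma])"
    unfolding emit_tile_def using emits_zeros[of s 10] emits_zeros[of s 13] assms(1-3)
    by (intro emits_Seq emits_pushes) auto
  then show ?thesis
    unfolding cbits_nat til.binary_item[OF assms(4) G_bounds(2)[OF assms(4)]]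
    by (simp only: dbits_append append_assoc)
qed

lemma sem_emit_items:
  assumes "s 12 = []" "length (s 10) = W - 2" "s 11 = replicate N 1" "s 13 = []"
  shows "sem emit_items (s(1 := v)) =
    s(11 := [], 13 := replicate N 1, 1 := rev (concat (map (\<lambda>z. cbits (int_chars z)) til.items)) @ v)"
proof -
  define out where "out j = concat (map (\<lambda>\<tau>. cbits (int_chars (int (til.item (j, \<tau>))))) G)" for j
  define s' where "s' = s(11 := [])"
  have loop: "(sem (seqs (map emit_tile G) ;; Push 13 1) ^^ j) (s'(1 := v)) =
      s'(13 := replicate j 1, 1 := rev (concat (map out [0..<j])) @ v)" for j
  proof (induction j)
    case 0
    have "s'(13 := []) = s'" using assms(4) by (auto simp: s'_def)
    then show ?case by simp
  next
    case (Suc j)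
    let ?s = "s'(13 := replicate j 1)"
    have "emits ?s (seqs (map emit_tile G)) (out j)"
      unfolding out_def using assms by (intro emits_seqs emits_tile) (auto simp: s'_def)
    then have "sem (seqs (map emit_tile G)) (?s(1 := rev (concat (map out [0..<j])) @ v)) =
        ?s(1 := rev (out j) @ rev (concat (map out [0..<j])) @ v)"
      unfolding emits_def by blast
    then have "sem (seqs (map emit_tile G) ;; Push 13 1) (?s(1 := rev (concat (map out [0..<j])) @ v)) =
        s'(13 := replicate (Suc j) 1, 1 := rev (concat (map out [0..<Suc j])) @ v)"
      by (simp add: fun_eq_iff)
    then show ?case unfolding funpow.simps comp_apply Suc.IH .
  qed
  have "sem emit_items (s(1 := v)) = (sem (seqs (map emit_tile G) ;; Push 13 1) ^^ N) (s'(1 := v))"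
    unfolding emit_items_def sem_For_const using assms(3) by (simp add: s'_def fun_upd_twist)
  also have "\<dots> = s'(13 := replicate N 1, 1 := rev (concat (map out [0..<N])) @ v)" by (rule loop)
  also have "concat (map out [0..<N]) = concat (map (\<lambda>z. cbits (int_chars z)) til.items)"
    unfolding til.items_def out_def map_map comp_def concat_map_product ..
  finally show ?thesis unfolding s'_def .
qed

theorem sem_reduce: "sem (reduce q p) (store_of [x]) 1 = rev (bits (encode_ints (int til.big # til.family)))"
proof -
  let ?c = "\<lambda>z. cbits (int_chars z)"
  define s where "s = regs [] [] [] [] (rev (map ysym [0..<N + W])) (replicate W 1) (replicate N 1) [] []"
  define s1 where "s1 = s(10 := replicate (W - 2) 1)"
  define s2 where "s2 = s1(11 := [], 13 := replicate N 1)"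
  have start: "sem (reduce q p) (store_of [x]) = sem emission (s(1 := []))"
  proof -
    have "s(1 := []) = s" by (auto simp: s_def)
    then show ?thesis unfolding reduce_def sem.simps(4) sem_prepare sem_bottom sem_upper s_def by simp
  qed
  have s: "s 12 = []" "s 9 = rev (map ysym [0..<N + W])" "s 10 = replicate W 1" by (simp_all only: s_def regs_read)
  have s1: "s1 12 = []" "length (s1 10) = W - 2" "s1 11 = replicate N 1" "s1 13 = []"
    by (simp_all add: s1_def s_def)
  have s2: "s2 12 = []" "s2 9 = rev (map ysym [0..<N + W])"
    by (simp_all add: s2_def s1_def s_def)
  have pops: "sem (Pop 10) (sem (Pop 10) (s(1 := v))) = s1(1 := v)" for v
  proof -
    have "tl (tl (s 10)) = replicate (W - 2) 1" unfolding s(3) by simp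
    then show ?thesis by (auto simp: s1_def fun_eq_iff)
  qed
  have number: "sem c (t(1 := v)) = t(1 := rev w @ v)" if "emits t c w" for t c w v
    using that by (simp add: emits_def)
  have neg: "emits s2 (pushes 1 (cbits [Minus]) ;; number tabZ) (?c (- int til.big))"
  proof -
    have "emits s2 (pushes 1 (cbits [Minus]) ;; number tabZ) (cbits [Minus] @ ?c (int til.big))"
      by (intro emits_Seq emits_pushes emits_numbers s2)
    moreover have "0 < til.big" unfolding til.big_def by (rule add_pos_nonneg) simp_all
    then have "?c (- int til.big) = cbits [Minus] @ ?c (int til.big)"
      unfolding cbits_nat by (rule cbits_neg)
    ultimately show ?thesis by (simp only:)
  qed
  have neg': "sem (number tabZ) (sem (pushes 1 (cbits [Minus])) (s2(1 := v))) = s2(1 := rev (?c (- int til.big)) @ v)" for v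
    using number[OF neg] by simp
  have "sem emission (s(1 := [])) = s2(1 := rev (?c (- int til.big)) @ rev (?c (- int til.big)) @
      rev (?c (int til.fill2)) @ rev (?c (int til.fill1)) @ rev (concat (map ?c til.items)) @ rev (?c (int til.big)) @ [])"
    unfolding emission_def sem.simps(4) number[OF emits_numbers(1)[OF s(1,2)]] pops sem_emit_items[OF s1]
      s2_def[symmetric] number[OF emits_numbers(2)[OF s2]] number[OF emits_numbers(3)[OF s2]] neg' by (rule refl)
  then show ?thesis unfolding start bits_encode_ints til.family_def by simp
qed

end

theorem NP_hard:
  assumes "A \<in> NP"
  shows "A \<le>\<^sub>p ConsComp"
proof -
  obtain M and q :: "nat poly" where M: "wf_tm M" "tapes M \<ge> 2" "poly_time M 2"
    "\<And>x. x \<in> A \<longleftrightarrow> (\<exists>u. length u \<le> poly q (length x) \<and> accepts M [x, u])"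
    using assms unfolding NP_def by blast
  obtain p0 :: "nat poly" where p0: "\<And>ws. length ws = 2 \<Longrightarrow> halted M (run M ws (poly p0 (input_size ws)))"
    using M(3) unfolding poly_time_def by blast
  \<comment> \<open>A time bound in \<open>length x\<close> alone, valid for all admissible
    certificates at once.\<close>
  define p where "p = pcompose p0 ([:0, 1:] + q)"
  interpret ntm M using M by unfold_locales
  \<comment> \<open>Halted configurations stay fixed, so acceptance can be inspected at this one
    moment; the history then has a prescribed number of rows.\<close>
  have acc: "accepts M [x, u] \<longleftrightarrow> fst (run M [x, u] (poly p (length x))) = accept M"
    if "length u \<le> poly q (length x)" for x u
  proof -
    have le: "poly p0 (input_size [x, u]) \<le> poly p (length x)"
      unfolding p_def poly_pcompose using that by (intro poly_nat_mono) (simp add: input_size_def)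
    have h0: "halted M (run M [x, u] (poly p0 (input_size [x, u])))" by (rule p0) simp
    then have h: "halted M (run M [x, u] (poly p (length x)))"
      unfolding run_halted[OF h0 le] .
    show ?thesis
    proof
      assume "accepts M [x, u]"
      then obtain t where t: "fst (run M [x, u] t) = accept M" by (auto simp: accepts_def)
      then have "halted M (run M [x, u] t)" by (simp add: halted_def)
      then show "fst (run M [x, u] (poly p (length x))) = accept M" using halted_unique[OF h] t by metis
    qed (auto simp: accepts_def)
  qed
  \<comment> \<open>The instance lives in an interpretation depending on \<open>x\<close>, while the
    program does not depend on \<open>x\<close>; the function \<open>f\<close> is then obtained by
    choice.\<close>
  have "\<exists>y. sem (reduce q p) (store_of [x]) 1 = rev (bits y) \<and> (x \<in> A \<longleftrightarrow> y \<in> ConsComp)" for x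
  proof -
    interpret I: instance_history M x q p by unfold_locales
    have "x \<in> A \<longleftrightarrow> (\<exists>v. length v \<le> I.n \<and> fst (run M [x, v] I.T) = accept M)"
      unfolding M(4) using acc by blast
    also have "\<dots> \<longleftrightarrow> encode_ints (int I.til.big # I.til.family) \<in> ConsComp"
      unfolding encode_ints_in_ConsComp using I.conscomp_history by blast
    finally show ?thesis using I.sem_reduce by blast
  qed
  then obtain f where f: "\<And>x. sem (reduce q p) (store_of [x]) 1 = rev (bits (f x))"
    "\<And>x. x \<in> A \<longleftrightarrow> f x \<in> ConsComp" by metis
  have "poly_time_computable f"
    by (rule ptime_computable[OF ptime_reduce]) (use f(1) in auto)
  then show ?thesis unfolding karp_reducible_def using f(2) by blast
qed

section \<open>The verifier\<close>

declare One_nat_def [simp del]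

section \<open>Recognising encoded lists of integers\<close>

definition sym :: "bool \<Rightarrow> nat" where
  "sym b = (if b then 2 else 1)"

fun cc :: "char4 \<Rightarrow> nat" where
  "cc (Digit b) = sym b"
| "cc Minus = 3"
| "cc Comma = 4"

lemma sym_simps [simp]: "sym True = 2" "sym False = 1" "sym b = 2 \<longleftrightarrow> b" "sym b = 1 \<longleftrightarrow> \<not> b"
  "0 < sym b" "sym b \<le> 2" "sym b \<noteq> 3" "sym b \<noteq> 4" "sym b = sym c \<longleftrightarrow> b = c"
  by (auto simp: sym_def)

lemma bits_sym: "bits w = map sym w"
  by (simp add: bits_def sym_def)

definition enc :: "int list \<Rightarrow> nat list" where
  "enc zs = map cc (concat (map int_chars zs))"

lemma enc_simps [simp]: "enc [] = []" "enc (z # zs) = map cc (int_chars z) @ enc zs"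
  "enc (xs @ ys) = enc xs @ enc ys"
  by (simp_all add: enc_def)

text \<open>The number formed from two bits is the \<open>cc\<close> code of the character they
  encode. The second component keeps an unpaired last bit, by which words of odd length are
  detected.\<close>

fun pairs :: "bool list \<Rightarrow> nat list \<times> nat list" where
  "pairs [] = ([], [])"
| "pairs [a] = ([], [sym a])"
| "pairs (a # b # r) = ((2 * sym a + sym b - 2) # fst (pairs r), snd (pairs r))"

lemma pairs_char_codes: "pairs (concat (map char_code cs)) = (map cc cs, [])"
proof (induction cs)
  case (Cons c cs)
  then show ?case by (cases c) (auto simp: sym_def)
qed simp

lemma char_codes_pairs: "pairs w = (map cc cs, []) \<Longrightarrow> w = concat (map char_code cs)"
proof (induction w arbitrary: cs rule: pairs.induct)
  case (3 a b r)
  then obtain c cs' where cs: "cs = c # cs'" by (cases cs) auto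
  then have "r = concat (map char_code cs')" using 3 by (auto simp: prod_eq_iff)
  moreover have "cc c = 2 * sym a + sym b - 2" using "3.prems" cs by simp
  then have "char_code c = [a, b]"
    by (cases c; cases a; cases b) (auto simp: sym_def split: if_splits)
  ultimately show ?case using cs by simp
qed auto

text \<open>An automaton for lists of encoded integers.  State 1 expects a new integer, 2 a digit after a
  minus sign, 3 further digits, 4 the comma after the digit 0; 5 is the dead state, and in the
  initial state 6 the leading digit of the positive bound \<open>C\<close> is expected.\<close>

definition df :: "nat \<Rightarrow> nat \<Rightarrow> nat" where
  "df s c =
    (if s = 6 \<or> s = 2 then if c = 2 then 3 else 5
     else if s = 1 then if c = 1 then 4 else if c = 2 then 3 else if c = 3 then 2 else 5
     else if s = 3 then if c = 1 \<or> c = 2 then 3 else if c = 4 then 1 else 5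
     else if s = 4 then if c = 4 then 1 else 5
     else 5)"

lemma df_dead: "foldl df 5 w = 5"
  by (induction w) (auto simp: df_def)

lemma df_digits: "foldl df 3 (map sym bs) = 3"
  by (induction bs) (auto simp: df_def sym_def)

lemma int_chars_pos: "int_chars (int (bv 1 bs)) = Digit True # map Digit bs @ [Comma]"
  using binary_bv_1[of bs] by (simp add: int_chars_def)

lemma int_chars_neg: "int_chars (- int (bv 1 bs)) = Minus # Digit True # map Digit bs @ [Comma]"
  using binary_bv_1[of bs] bv_ge[of 1 bs] by (simp add: int_chars_def)

lemma int_chars_0: "int_chars 0 = [Digit False, Comma]"
  by (simp add: int_chars_def binary.simps)

lemma int_cases_bv:
  obtains "z = 0" | bs where "z = int (bv 1 bs)" | bs where "z = - int (bv 1 bs)"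
proof -
  consider "z = 0" | "0 < nat z" | "0 < nat (- z)" by linarith
  then show ?thesis
  proof cases
    case 2
    then show ?thesis using bv_binary[OF 2] that(2) by (metis int_nat_eq less_imp_le zero_less_nat_eq)
  next
    case 3
    then obtain bs where "bv 1 bs = nat (- z)" using bv_binary[OF 3] by blast
    then have "z = - int (bv 1 bs)" using 3 by simp
    then show ?thesis using that(3) by blast
  qed (rule that(1))
qed

lemma df_int: "foldl df 1 (map cc (int_chars z)) = 1"
proof (cases z rule: int_cases_bv)
  case 1
  then show ?thesis by (simp add: int_chars_0 df_def)
next
  case (2 bs)
  then show ?thesis using df_digits[of bs] by (simp add: int_chars_pos df_def comp_def)
next
  case (3 bs)
  then show ?thesis using df_digits[of bs] by (simp add: int_chars_neg df_def comp_def)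
qed

lemma df_enc: "foldl df 1 (enc zs) = 1"
  by (induction zs) (simp_all add: df_int)

text \<open>All live states have to be treated together, since the automaton passes between them
  inside one integer. The digits read in state 3 become a number behind the leading 1 already
  consumed.\<close>

lemma df_run:
  "foldl df s w = 1 \<Longrightarrow>
    (s = 1 \<longrightarrow> (\<exists>zs. w = enc zs)) \<and>
    (s = 2 \<longrightarrow> (\<exists>bs zs. w = 2 # map sym bs @ 4 # enc zs)) \<and>
    (s = 3 \<longrightarrow> (\<exists>bs zs. w = map sym bs @ 4 # enc zs)) \<and>
    (s = 4 \<longrightarrow> (\<exists>zs. w = 4 # enc zs))"
proof (induction w arbitrary: s)
  case Nil
  then show ?case by (auto intro: exI[of _ "[]"])
next
  case (Cons c w)
  from Cons.prems have run: "foldl df (df s c) w = 1" by simp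
  note IH = Cons.IH[OF run]
  have alive: "df s c \<noteq> 5" using run df_dead[of w] by auto
  show ?case
  proof (intro conjI impI)
    assume s: "s = 1"
    consider "c = 1" | "c = 2" | "c = 3" using alive s by (auto simp: df_def split: if_splits)
    then show "\<exists>zs. c # w = enc zs"
    proof cases
      case 1
      then obtain zs where "w = 4 # enc zs" using IH s by (auto simp: df_def)
      then have "c # w = enc (0 # zs)" using 1 by (simp add: int_chars_0)
      then show ?thesis by blast
    next
      case 2
      then obtain bs zs where "w = map sym bs @ 4 # enc zs" using IH s by (auto simp: df_def)
      then have "c # w = enc (int (bv 1 bs) # zs)" using 2 by (simp add: int_chars_pos comp_def)
      then show ?thesis by blast
    next
      case 3
      then obtain bs zs where "w = 2 # map sym bs @ 4 # enc zs" using IH s by (auto simp: df_def)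
      then have "c # w = enc (- int (bv 1 bs) # zs)" using 3 by (simp add: int_chars_neg comp_def)
      then show ?thesis by blast
    qed
  next
    assume s: "s = 2"
    then have "c = 2" using alive by (auto simp: df_def split: if_splits)
    then show "\<exists>bs zs. c # w = 2 # map sym bs @ 4 # enc zs" using IH s by (auto simp: df_def)
  next
    assume s: "s = 3"
    have "c = sym False \<or> c = sym True \<or> c = 4" using alive s by (auto simp: df_def split: if_splits)
    then consider b where "c = sym b" | "c = 4" by blast
    then show "\<exists>bs zs. c # w = map sym bs @ 4 # enc zs"
    proof cases
      case (1 b)
      then obtain bs zs where "w = map sym bs @ 4 # enc zs" using IH s by (cases b) (auto simp: df_def)
      then have "c # w = map sym (b # bs) @ 4 # enc zs" using 1 by simp
      then show ?thesis by blast
    next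
      case 2
      then obtain zs where "w = enc zs" using IH s by (auto simp: df_def)
      then show ?thesis using 2 by (intro exI[of _ "[]"] exI[of _ zs]) simp
    qed
  next
    assume s: "s = 4"
    then have "c = 4" using alive by (auto simp: df_def split: if_splits)
    then show "\<exists>zs. c # w = 4 # enc zs" using IH s by (auto simp: df_def)
  qed
qed

lemma df_accept: "foldl df 6 w = 1 \<longleftrightarrow> (\<exists>bs es. w = enc (int (bv 1 bs) # es))"
proof
  assume *: "foldl df 6 w = 1"
  then obtain c w' where w: "w = c # w'" by (cases w) auto
  then have "c = 2" "foldl df 3 w' = 1" using * df_dead[of w'] by (auto simp: df_def split: if_splits)
  then obtain bs es where "w' = map sym bs @ 4 # enc es" using df_run by blast
  then have "w = enc (int (bv 1 bs) # es)" using w \<open>c = 2\<close> by (simp add: int_chars_pos comp_def)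
  then show "\<exists>bs es. w = enc (int (bv 1 bs) # es)" by blast
next
  assume "\<exists>bs es. w = enc (int (bv 1 bs) # es)"
  then obtain bs es where "w = enc (int (bv 1 bs) # es)" by blast
  then show "foldl df 6 w = 1"
    using df_digits[of bs] df_enc[of es] by (simp add: int_chars_pos df_def comp_def)
qed

text \<open>The certificate is a sequence of instructions on the list of the remaining integers: \<open>False\<close>
  moves the first integer to the end, \<open>True\<close> consumes it.  Along with the partial sum \<open>\<sigma>\<close> the
  verifier maintains \<open>\<delta> = C - \<sigma>\<close>.\<close>

fun sim :: "bool \<Rightarrow> int list \<times> int \<times> int \<times> bool \<Rightarrow> int list \<times> int \<times> int \<times> bool" where
  "sim b ([], \<sigma>, \<delta>, ok) = ([], \<sigma>, \<delta>, ok)"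
| "sim False (z # zs, \<sigma>, \<delta>, ok) = (zs @ [z], \<sigma>, \<delta>, ok)"
| "sim True (z # zs, \<sigma>, \<delta>, ok) = (zs, \<sigma> + z, \<delta> - z, ok \<and> 0 \<le> \<sigma> + z \<and> 0 \<le> \<delta> - z)"

text \<open>The sum \<open>\<sigma> + \<delta>\<close> is invariant and serves as the bound. The
  flag can only fall, so a final \<open>True\<close> means that every consumption passed its
  tests.\<close>

lemma sim_sound:
  "fold sim us (L, \<sigma>, \<delta>, ok) = ([], \<sigma>', \<delta>', True) \<Longrightarrow>
    ok \<and> (\<exists>es. mset es = mset L \<and> walk (\<sigma> + \<delta>) \<sigma> es \<and> \<sigma>' = \<sigma> + sum_list es)"
proof (induction us arbitrary: L \<sigma> \<delta> ok)
  case Nil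
  then show ?case by auto
next
  case (Cons b us)
  show ?case
  proof (cases L)
    case Nil
    then have "fold sim us ([], \<sigma>, \<delta>, ok) = ([], \<sigma>', \<delta>', True)" using Cons.prems by simp
    from Cons.IH[OF this] show ?thesis using Nil by simp
  next
    case L: (Cons z zs)
    show ?thesis
    proof (cases b)
      case True
      then have "fold sim us (zs, \<sigma> + z, \<delta> - z, ok \<and> 0 \<le> \<sigma> + z \<and> 0 \<le> \<delta> - z) = ([], \<sigma>', \<delta>', True)"
        using Cons.prems L by simp
      from Cons.IH[OF this] obtain es where es: "ok" "0 \<le> \<sigma> + z" "0 \<le> \<delta> - z" "mset es = mset zs"
        "walk (\<sigma> + z + (\<delta> - z)) (\<sigma> + z) es" "\<sigma>' = \<sigma> + z + sum_list es" by blast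
      then show ?thesis using L by (auto intro!: exI[of _ "z # es"])
    next
      case False
      then have "fold sim us (zs @ [z], \<sigma>, \<delta>, ok) = ([], \<sigma>', \<delta>', True)" using Cons.prems L by simp
      from Cons.IH[OF this] show ?thesis using L by simp
    qed
  qed
qed

lemma sim_rotate: "fold sim (replicate (length A) False) (A @ B, \<sigma>, \<delta>, ok) = (B @ A, \<sigma>, \<delta>, ok)"
  by (induction A arbitrary: B) auto

text \<open>Fewer than \<open>length L\<close> rotations bring the next integer to the front. This
  yields the quadratic bound on the certificate.\<close>

lemma sim_complete:
  "mset es = mset L \<Longrightarrow> walk (\<sigma> + \<delta>) \<sigma> es \<Longrightarrow>
    \<exists>us. length us \<le> length L * length L \<and> (\<exists>\<delta>'. fold sim us (L, \<sigma>, \<delta>, True) = ([], \<sigma> + sum_list es, \<delta>', True))"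
proof (induction es arbitrary: L \<sigma> \<delta>)
  case Nil
  then show ?case by (intro exI[of _ "[]"]) simp
next
  case (Cons z es)
  have "z \<in> set L" using mset_eq_setD[OF Cons.prems(1)] by auto
  then obtain A B where L: "L = A @ z # B" by (meson split_list)
  have m: "mset es = mset (B @ A)" using Cons.prems(1) L by simp
  have w: "0 \<le> \<sigma> + z" "0 \<le> \<delta> - z" "walk (\<sigma> + z + (\<delta> - z)) (\<sigma> + z) es" using Cons.prems(2) by auto
  obtain us \<delta>' where us: "length us \<le> length (B @ A) * length (B @ A)"
    "fold sim us (B @ A, \<sigma> + z, \<delta> - z, True) = ([], \<sigma> + z + sum_list es, \<delta>', True)"
    using Cons.IH[OF m w(3)] by blast
  have "fold sim (replicate (length A) False @ True # us) (L, \<sigma>, \<delta>, True) = ([], \<sigma> + sum_list (z # es), \<delta>', True)"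
    using us(2) w L sim_rotate[of A "z # B"] by (simp add: add.assoc)
  moreover have "length (replicate (length A) False @ True # us) \<le> length L * length L"
    using us(1) L by (simp add: algebra_simps)
  ultimately show ?case by blast
qed

section \<open>Addition and subtraction of digit lists of fixed length\<close>

fun nv :: "bool list \<Rightarrow> int" where
  "nv [] = 0"
| "nv (b # bs) = of_bool b + 2 * nv bs"

lemma nv_append: "nv (xs @ ys) = nv xs + 2 ^ length xs * nv ys"
  by (induction xs) (auto simp: algebra_simps)

lemma nv_bounds: "0 \<le> nv bs" "nv bs < 2 ^ length bs"
  by (induction bs) (auto simp: of_bool_def)

lemma nv_replicate: "nv (replicate n False) = 0"
  by (induction n) auto

lemma nv_eq_0: "nv bs = 0 \<longleftrightarrow> True \<notin> set bs"
proof (induction bs)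
  case (Cons b bs)
  then show ?case using nv_bounds(1)[of bs] by (cases b) auto
qed simp

lemma nv_rev: "nv (rev bs @ [True]) = int (bv 1 bs)"
proof -
  have "int (bv a bs) = int a * 2 ^ length bs + nv (rev bs)" for a
    by (induction bs arbitrary: a) (auto simp: nv_append algebra_simps)
  then show ?thesis by (simp add: nv_append)
qed

text \<open>Least significant bit first; \<open>sb\<close> turns addition into subtraction and the carry into a borrow.\<close>

definition xbit :: "bool \<Rightarrow> bool \<Rightarrow> bool \<Rightarrow> bool" where
  "xbit d y k = (d \<noteq> (y \<noteq> k))"

text \<open>The majority of \<open>d\<close>, \<open>k\<close> and \<open>y\<close>, where
  \<open>y\<close> is negated for subtraction; this is the borrow of
  \<open>y - d - k\<close>.\<close>

definition cbit :: "bool \<Rightarrow> bool \<Rightarrow> bool \<Rightarrow> bool \<Rightarrow> bool" where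
  "cbit sb d y k = ((y \<noteq> sb) \<and> (d \<or> k) \<or> d \<and> k)"

fun ripple :: "bool \<Rightarrow> bool \<Rightarrow> bool list \<Rightarrow> bool list \<Rightarrow> bool list \<times> bool" where
  "ripple sb k ds [] = ([], k)"
| "ripple sb k ds (y # ys) =
    (let d = ds \<noteq> [] \<and> hd ds; r = ripple sb (cbit sb d y k) (tl ds) ys in (xbit d y k # fst r, snd r))"

lemma length_ripple: "length (fst (ripple sb k ds ys)) = length ys"
  by (induction sb k ds ys rule: ripple.induct) (auto simp: Let_def)

lemma ripple_value:
  assumes "length ds \<le> length ys"
  shows "nv ys + (if sb then - 1 else 1) * (nv ds + of_bool k) =
    nv (fst (ripple sb k ds ys)) + (if sb then - 1 else 1) * of_bool (snd (ripple sb k ds ys)) * 2 ^ length ys"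
  using assms
proof (induction sb k ds ys rule: ripple.induct)
  case (2 sb k ds y ys)
  define d where "d = (ds \<noteq> [] \<and> hd ds)"
  define g where "g = (if sb then - 1 else 1 :: int)"
  define r where "r = ripple sb (cbit sb d y k) (tl ds) ys"
  define xb where "xb = (of_bool (xbit d y k) :: int)"
  define cb where "cb = (of_bool (cbit sb d y k) :: int)"
  have IH: "nv ys + g * (nv (tl ds) + cb) = nv (fst r) + g * of_bool (snd r) * 2 ^ length ys"
    using 2 unfolding r_def g_def d_def cb_def by simp
  have ds: "nv ds = of_bool d + 2 * nv (tl ds)" by (cases ds) (auto simp: d_def)
  \<comment> \<open>The identity of a one-digit full adder or subtractor, checked for all
    bits.\<close>
  have b: "of_bool y + g * (of_bool d + of_bool k) = xb + g * (2 * cb)"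
    by (cases sb; cases d; cases y; cases k) (simp_all add: g_def xbit_def cbit_def xb_def cb_def)
  have "nv (y # ys) + g * (nv ds + of_bool k) =
      (of_bool y + g * (of_bool d + of_bool k)) + 2 * (nv ys + g * nv (tl ds))"
    by (simp add: ds algebra_simps)
  also have "\<dots> = xb + 2 * (nv ys + g * (nv (tl ds) + cb))"
    unfolding b by (simp add: algebra_simps)
  also have "\<dots> = nv (xbit d y k # fst r) + g * of_bool (snd r) * 2 ^ length (y # ys)"
    unfolding IH by (simp add: xb_def algebra_simps)
  finally show ?case by (simp add: Let_def g_def r_def d_def)
qed simp

text \<open>The result lies between 0 and \<open>2 ^ length ys\<close>, so the outgoing bit records
  exactly the overflow, just as in \<open>ripple_sub\<close> it records a negative
  difference.\<close>

lemma ripple_add: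
  assumes "length ds \<le> length ys"
  shows "snd (ripple False False ds ys) \<longleftrightarrow> 2 ^ length ys \<le> nv ys + nv ds"
    and "\<not> snd (ripple False False ds ys) \<Longrightarrow> nv (fst (ripple False False ds ys)) = nv ys + nv ds"
  using ripple_value[OF assms, of False False] nv_bounds[of "fst (ripple False False ds ys)"]
  by (cases "snd (ripple False False ds ys)"; simp add: length_ripple)+

lemma ripple_sub:
  assumes "length ds \<le> length ys"
  shows "snd (ripple True False ds ys) \<longleftrightarrow> nv ys < nv ds"
    and "\<not> snd (ripple True False ds ys) \<Longrightarrow> nv (fst (ripple True False ds ys)) = nv ys - nv ds"
  using ripple_value[OF assms, of True False] nv_bounds[of "fst (ripple True False ds ys)"]
  by (cases "snd (ripple True False ds ys)"; simp add: length_ripple)+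

text \<open>Use of the stacks: 3 holds the queue of integers, with 5, 8 and 9 for rotating it; 6 the state of the
  automaton; 13 and 14 the digits of \<open>\<sigma>\<close> and \<open>\<delta>\<close>, padded to fixed lengths; 18 and 19 two copies of
  the digits of the consumed integer and 10 its sign; 11 and 12 carry and borrow; 15 and 16 the results of
  additions and subtractions; 17 records failure.  In \<open>split\<close>, stack 7 tells that the first
  comma has been passed.\<close>

definition add_step :: "bool \<Rightarrow> nat \<Rightarrow> nat \<Rightarrow> nat \<Rightarrow> nat \<Rightarrow> com" where
  "add_step sb t d c y = Case d (\<lambda>a. Case c (\<lambda>k. Pop d ;; Pop c ;;
     Push t (sym (xbit (a = 2) (y = 2) (k \<noteq> 0))) ;;
     (if cbit sb (a = 2) (y = 2) (k \<noteq> 0) then Push c 1 else Skip)))"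

definition add_sub :: "bool \<Rightarrow> nat \<Rightarrow> nat \<Rightarrow> nat \<Rightarrow> nat \<Rightarrow> com" where
  "add_sub sb r t d c =
     For r (add_step sb t d c) ;;
     Case c (\<lambda>k. Pop c ;; (if k = 0 then Skip else Push 17 1)) ;; For t (\<lambda>a. Push r a)"

definition split_step :: "bool \<Rightarrow> nat \<Rightarrow> com" where
  "split_step b a = Case 7 (\<lambda>m. if m \<noteq> 0 then Push 5 a else
     (if b then (if a \<le> 2 then Push 18 a ;; Push 19 a else Skip) else Push 8 a) ;;
     (if a = 4 then Push 7 1 else if a = 3 \<and> b then Push 10 1 else Skip))"

definition split :: "bool \<Rightarrow> com" where
  "split b = For 3 (split_step b)"

definition read_bound :: com where
  "read_bound = For 3 (\<lambda>a. Case 7 (\<lambda>m. if m \<noteq> 0 then Push 5 a else if a = 4 then Push 7 1 else Push 14 a)) ;;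
     For 5 (\<lambda>a. Push 3 a) ;; Pop 7"

definition instruction :: "nat \<Rightarrow> com" where
  "instruction b = split (b = 2) ;;
     (if b = 2 then Case 10 (\<lambda>a.
        if a = 0 then add_sub False 13 15 18 11 ;; add_sub True 14 16 19 12
        else add_sub True 13 15 18 11 ;; add_sub False 14 16 19 12)
      else For 8 (\<lambda>a. Push 9 a) ;; For 9 (\<lambda>a. Push 5 a)) ;;
     For 5 (\<lambda>a. Push 3 a) ;; Pop 7 ;; Pop 10"

text \<open>Stack 4 holds the first bit of an incomplete pair. The minimum keeps all branches inside
  the alphabet and has no effect on bits.\<close>

definition decode :: com where
  "decode = For 3 (\<lambda>a. Case 4 (\<lambda>m. if m = 0 then Push 4 a else Pop 4 ;; Push 5 (min 4 (2 * m + a - 2))))"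

definition automaton :: com where
  "automaton = Each 3 12 (\<lambda>a. Case 6 (\<lambda>s. Pop 6 ;; Push 6 (df s a)))"

text \<open>Stack 13 receives the digits of \<sigma> = 0, as many as the input has characters, and
  stack 14 the same padding, on top of which \<open>read_bound\<close> puts the digits of
  \<open>C\<close>. Every integer of the instance then fits into both lengths.\<close>

definition preparation :: com where
  "preparation = For 0 (\<lambda>a. Push 3 a) ;; decode ;; For 5 (\<lambda>a. Push 3 a) ;; Push 6 6 ;; automaton ;;
     Each 3 12 (\<lambda>_. Push 13 1 ;; Push 14 1)"

text \<open>Malformed inputs are run through like all others and rejected only at the end by the
  state on stack 6 or a leftover bit on stack 4. The test of stack 13 for \<sigma> = 0 at the same
  time checks that the integers sum to 0.\<close>

definition verify :: com where
  "verify = preparation ;; read_bound ;; For 1 instruction ;;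
     For 13 (\<lambda>a. if a = 2 then Push 17 1 else Skip) ;; Case 3 (\<lambda>a. if a = 0 then Skip else Push 17 1) ;;
     Case 4 (\<lambda>a. if a = 0 then Skip else Push 17 1) ;; Case 6 (\<lambda>a. if a = 1 then Skip else Push 17 1) ;;
     Case 17 (\<lambda>a. if a = 0 then Push 2 1 else Skip)"

section \<open>Correctness of the verifier\<close>

definition flag_of :: "bool \<Rightarrow> nat list" where
  "flag_of k = (if k then [1] else [])"

lemma flag_of_simps [simp]: "flag_of True = [1]" "flag_of False = []" "peek (flag_of k) \<noteq> 0 \<longleftrightarrow> k" "peek (flag_of k) = 0 \<longleftrightarrow> \<not> k"
  "0 < peek (flag_of k) \<longleftrightarrow> k" "tl (flag_of k) = []"
  by (auto simp: flag_of_def)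

lemma peek_map_sym: "peek (map sym ds) = 2 \<longleftrightarrow> ds \<noteq> [] \<and> hd ds"
  by (cases ds) auto

lemma ripple_loop:
  assumes "distinct [r, t, d, c]"
  shows "s d = map sym ds \<Longrightarrow> s c = flag_of k \<Longrightarrow>
    fold (\<lambda>y. sem (add_step sb t d c y)) (map sym ys) s =
      s(d := map sym (drop (length ys) ds), c := flag_of (snd (ripple sb k ds ys)),
        t := rev (map sym (fst (ripple sb k ds ys))) @ s t)"
proof (induction ys arbitrary: s k ds)
  case Nil
  then show ?case by (auto simp: fun_eq_iff)
next
  case (Cons y ys)
  define b where "b = (ds \<noteq> [] \<and> hd ds)"
  define s1 where "s1 = s(d := map sym (tl ds), c := flag_of (cbit sb b y k), t := sym (xbit b y k) # s t)"
  have p: "(peek (s d) = 2) = b" "(peek (s c) \<noteq> 0) = k"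
    using Cons.prems by (simp_all add: peek_map_sym b_def)
  have "sem (add_step sb t d c (sym y)) s = s1"
    unfolding add_step_def sem.simps(5) p using assms(1) Cons.prems
    by (auto simp: s1_def fun_eq_iff map_tl flag_of_def)
  then have "fold (\<lambda>y. sem (add_step sb t d c y)) (map sym (y # ys)) s = fold (\<lambda>y. sem (add_step sb t d c y)) (map sym ys) s1" by simp
  also have "\<dots> = s1(d := map sym (drop (length ys) (tl ds)), c := flag_of (snd (ripple sb (cbit sb b y k) (tl ds) ys)),
        t := rev (map sym (fst (ripple sb (cbit sb b y k) (tl ds) ys))) @ s1 t)"
    by (rule Cons.IH) (use assms(1) in \<open>auto simp: s1_def\<close>)
  finally show ?case
    using assms(1) by (auto simp: s1_def fun_eq_iff Let_def b_def drop_Suc)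
qed

lemma sem_add_sub:
  assumes "distinct [r, t, d, c, 17]" "s r = map sym ys" "s d = map sym ds" "length ds \<le> length ys"
    "s t = []" "s c = []"
  shows "sem (add_sub sb r t d c) s = s(r := map sym (fst (ripple sb False ds ys)), d := [],
    17 := flag_of (snd (ripple sb False ds ys)) @ s 17)"
proof -
  let ?r = "ripple sb False ds ys"
  define s1 where "s1 = s(r := [], d := [], c := flag_of (snd ?r), t := rev (map sym (fst ?r)))"
  have 1: "sem (For r (add_step sb t d c)) s = s1"
    unfolding sem.simps(6) assms(2)
    by (subst ripple_loop[of r t d c "s(r := [])" ds False]) (use assms in \<open>auto simp: s1_def fun_eq_iff\<close>)
  have 2: "sem (Case c (\<lambda>k. Pop c ;; (if k = 0 then Skip else Push 17 1))) s1 =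
      s1(c := [], 17 := flag_of (snd ?r) @ s 17)"
    using assms(1) by (cases "snd ?r") (auto simp: s1_def fun_eq_iff)
  show ?thesis
    unfolding add_sub_def sem.simps(4) 1 2
    using assms by (subst sem_move) (auto simp: s1_def fun_eq_iff)
qed

lemma split_rest:
  assumes "s 7 = [1]"
  shows "fold (\<lambda>a. sem (split_step b a)) ws s = s(5 := rev ws @ s 5)"
  using assms by (induction ws arbitrary: s) (auto simp: split_step_def)

lemma split_digits:
  assumes "s 7 = []"
  shows "fold (\<lambda>a. sem (split_step True a)) (map sym bs) s =
      s(18 := map sym (rev bs) @ s 18, 19 := map sym (rev bs) @ s 19)"
    and "fold (\<lambda>a. sem (split_step False a)) (map sym bs) s =
      s(8 := map sym (rev bs) @ s 8)"
  using assms by (induction bs arbitrary: s) (auto simp: fun_eq_iff split_step_def)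

lemma enc_Cons: "enc (z # zs) = (if z < 0 then [3] else []) @ map sym (binary (nat \<bar>z\<bar>)) @ 4 # enc zs"
  by (simp add: int_chars_def comp_def)

lemma sem_split_consume:
  assumes "s 3 = enc (z # zs)" "\<forall>i \<in> {5, 7, 10, 18, 19}. s i = []"
  shows "sem (split True) s = s(3 := [], 5 := rev (enc zs), 7 := [1], 10 := flag_of (z < 0),
    18 := map sym (rev (binary (nat \<bar>z\<bar>))), 19 := map sym (rev (binary (nat \<bar>z\<bar>))))"
proof -
  have d: "fold (\<lambda>a. sem (split_step True a))
      (map sym (binary (nat \<bar>z\<bar>)) @ 4 # enc zs) s' =
    s'(7 := [1], 5 := rev (enc zs), 18 := map sym (rev (binary (nat \<bar>z\<bar>))), 19 := map sym (rev (binary (nat \<bar>z\<bar>))))"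
    if "s' 7 = []" "s' 18 = []" "s' 19 = []" "s' 5 = []" for s'
    unfolding fold_append comp_apply split_digits(1)[of s', OF that(1)] fold_simps
    by (subst split_rest) (use that in \<open>auto simp: fun_eq_iff split_step_def\<close>)
  show ?thesis
  proof (cases "z < 0")
    case True
    have "sem (split True) s = fold (\<lambda>a. sem (split_step True a))
      (map sym (binary (nat \<bar>z\<bar>)) @ 4 # enc zs) (s(3 := [], 10 := [1]))"
      unfolding split_def sem.simps(6) assms(1) enc_Cons using True assms(2) by (simp add: split_step_def)
    then show ?thesis using True assms(2) by (subst (asm) d) (auto simp: fun_eq_iff)
  next
    case False
    have "sem (split True) s = fold (\<lambda>a. sem (split_step True a))
      (map sym (binary (nat \<bar>z\<bar>)) @ 4 # enc zs) (s(3 := []))"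
      unfolding split_def sem.simps(6) assms(1) enc_Cons using False by simp
    then show ?thesis using False assms(2) by (subst (asm) d) (auto simp: fun_eq_iff)
  qed
qed

lemma sem_split_rotate:
  assumes "s 3 = enc (z # zs)" "\<forall>i \<in> {5, 7, 8}. s i = []"
  shows "sem (split False) s = s(3 := [], 5 := rev (enc zs), 7 := [1], 8 := rev (enc [z]))"
proof -
  have d: "fold (\<lambda>a. sem (split_step False a))
      (map sym (binary (nat \<bar>z\<bar>)) @ 4 # enc zs) s' =
    s'(7 := [1], 5 := rev (enc zs), 8 := 4 # map sym (rev (binary (nat \<bar>z\<bar>))) @ s' 8)"
    if "s' 7 = []" "s' 5 = []" for s'
    unfolding fold_append comp_apply split_digits(2)[of s', OF that(1)] fold_simps
    by (subst split_rest) (use that in \<open>auto simp: fun_eq_iff split_step_def\<close>)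
  show ?thesis
  proof (cases "z < 0")
    case True
    have "sem (split False) s = fold (\<lambda>a. sem (split_step False a))
      (map sym (binary (nat \<bar>z\<bar>)) @ 4 # enc zs) (s(3 := [], 8 := [3]))"
      unfolding split_def sem.simps(6) assms(1) enc_Cons using True assms(2) by (simp add: split_step_def)
    then show ?thesis using True assms(2) enc_Cons[of z "[]"] by (subst (asm) d) (auto simp: fun_eq_iff rev_map)
  next
    case False
    have "sem (split False) s = fold (\<lambda>a. sem (split_step False a))
      (map sym (binary (nat \<bar>z\<bar>)) @ 4 # enc zs) (s(3 := []))"
      unfolding split_def sem.simps(6) assms(1) enc_Cons using False by simp
    then show ?thesis using False assms(2) enc_Cons[of z "[]"] by (subst (asm) d) (auto simp: fun_eq_iff rev_map)
  qed
qed

lemma nv_rev_binary: "nv (rev (binary n)) = int n"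
proof (cases "n = 0")
  case True
  then show ?thesis by (simp add: binary.simps)
next
  case False
  then obtain bs where "binary n = True # bs" "bv 1 bs = n" using bv_binary by blast
  then show ?thesis using nv_rev[of bs] by simp
qed

definition temps :: "nat set" where
  "temps = {5, 7, 8, 9, 10, 11, 12, 15, 16, 18, 19}"

text \<open>After a failure only the lengths of the digit lists are maintained, although
  \<open>sim\<close> continues to update \<sigma> and \<delta>. The bounds on the integers meet the
  length condition of \<open>sem_add_sub\<close>; those on \<open>\<sigma> + \<delta>\<close>
  exclude an overflow without a corresponding failure in \<open>sim\<close>.\<close>

definition rel :: "nat \<Rightarrow> nat \<Rightarrow> store \<Rightarrow> int list \<times> int \<times> int \<times> bool \<Rightarrow> bool" where
  "rel n1 n2 s = (\<lambda>(L, \<sigma>, \<delta>, ok). s 3 = enc L \<and> (\<forall>i \<in> temps. s i = []) \<and> (s 17 = [] \<longleftrightarrow> ok) \<and>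
     (\<exists>xs ys. s 13 = map sym xs \<and> s 14 = map sym ys \<and> length xs = n1 \<and> length ys = n2 \<and>
        (ok \<longrightarrow> nv xs = \<sigma> \<and> nv ys = \<delta>)) \<and>
     (\<forall>z \<in> set L. length (binary (nat \<bar>z\<bar>)) \<le> n1 \<and> length (binary (nat \<bar>z\<bar>)) \<le> n2) \<and>
     \<sigma> + \<delta> < 2 ^ n1 \<and> \<sigma> + \<delta> < 2 ^ n2)"

lemma temps_empty: "\<forall>i \<in> temps. s i = [] \<Longrightarrow> i \<in> {5, 7, 8, 9, 10, 11, 12, 15, 16, 18, 19} \<Longrightarrow> s i = []"
  unfolding temps_def by (rule bspec)

lemma rel_consume:
  assumes "rel n1 n2 s (z # zs, \<sigma>, \<delta>, ok)"
  shows "rel n1 n2 (sem (instruction 2) s) (sim True (z # zs, \<sigma>, \<delta>, ok))"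
proof -
  obtain xs ys where r: "s 3 = enc (z # zs)" "\<forall>i \<in> temps. s i = []" "s 17 = [] \<longleftrightarrow> ok"
    "s 13 = map sym xs" "s 14 = map sym ys" "length xs = n1" "length ys = n2" "ok \<longrightarrow> nv xs = \<sigma> \<and> nv ys = \<delta>"
    "\<forall>z \<in> set (z # zs). length (binary (nat \<bar>z\<bar>)) \<le> n1 \<and> length (binary (nat \<bar>z\<bar>)) \<le> n2"
    "\<sigma> + \<delta> < 2 ^ n1" "\<sigma> + \<delta> < 2 ^ n2"
    using assms unfolding rel_def by blast
  note e = temps_empty[OF r(2)]
  let ?B = "rev (binary (nat \<bar>z\<bar>))"
  have B: "nv ?B = \<bar>z\<bar>" "length ?B \<le> length xs" "length ?B \<le> length ys"
    using r(6,7,9) by (simp_all add: nv_rev_binary)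
  define sb where "sb = (z < 0)"
  define rx where "rx = ripple sb False ?B xs"
  define ry where "ry = ripple (\<not> sb) False ?B ys"
  have s5: "\<forall>i \<in> {5, 7, 10, 18, 19}. s i = []" using e by simp
  define s1 where "s1 = s(3 := [], 5 := rev (enc zs), 7 := [1], 10 := flag_of sb, 18 := map sym ?B, 19 := map sym ?B)"
  have 1: "sem (split True) s = s1" unfolding s1_def sb_def by (rule sem_split_consume[OF r(1) s5])
  define s2 where "s2 = s1(13 := map sym (fst rx), 18 := [], 17 := flag_of (snd rx) @ s 17)"
  have 2: "sem (add_sub sb 13 15 18 11) s1 = s2"
    unfolding s2_def rx_def
    by (subst sem_add_sub[where ys = xs and ds = ?B]) (use r e B in \<open>auto simp: s1_def\<close>)
  define s3 where "s3 = s2(14 := map sym (fst ry), 19 := [], 17 := flag_of (snd ry) @ flag_of (snd rx) @ s 17)"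
  have 3: "sem (add_sub (\<not> sb) 14 16 19 12) s2 = s3"
    unfolding s3_def ry_def
    by (subst sem_add_sub[where ys = ys and ds = ?B]) (use r e B in \<open>auto simp: s1_def s2_def\<close>)
  have "sem (Case 10 (\<lambda>a. if a = 0 then add_sub False 13 15 18 11 ;; add_sub True 14 16 19 12
        else add_sub True 13 15 18 11 ;; add_sub False 14 16 19 12)) s1 = s3"
  proof -
    have "s1 10 = flag_of sb" by (simp add: s1_def)
    then show ?thesis using 2 3 by (cases sb) simp_all
  qed
  then have "sem (instruction 2) s = sem (Pop 10) (sem (Pop 7) (sem (For 5 (\<lambda>a. Push 3 a)) s3))"
    by (simp only: instruction_def sem.simps(4) if_True simp_thms 1)
  also have "\<dots> = s(3 := enc zs, 13 := map sym (fst rx), 14 := map sym (fst ry),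
      17 := flag_of (snd ry) @ flag_of (snd rx) @ s 17)"
    using e by (subst sem_move) (auto simp: s3_def s2_def s1_def fun_eq_iff)
  finally have fin: "sem (instruction 2) s = s(3 := enc zs, 13 := map sym (fst rx), 14 := map sym (fst ry),
      17 := flag_of (snd ry) @ flag_of (snd rx) @ s 17)" .
  have len: "length (fst rx) = n1" "length (fst ry) = n2"
    by (simp_all add: rx_def ry_def length_ripple r)
  \<comment> \<open>If \<open>z\<close> is nonnegative, an overflow of \<open>\<sigma> + z\<close>
    exceeds \<open>\<sigma> + \<delta>\<close>, so \<open>\<delta> - z\<close> is negative and
    \<open>sim\<close> fails too. The case of negative \<open>z\<close> is symmetric.\<close>
  have ok: "(\<not> snd rx \<and> \<not> snd ry \<longleftrightarrow> 0 \<le> \<sigma> + z \<and> 0 \<le> \<delta> - z) \<and>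
      (\<not> snd rx \<and> \<not> snd ry \<longrightarrow> nv (fst rx) = \<sigma> + z \<and> nv (fst ry) = \<delta> - z)" if "ok"
  proof -
    have v: "nv xs = \<sigma>" "nv ys = \<delta>" using r(8) that by auto
    then have ge: "0 \<le> \<sigma>" "0 \<le> \<delta>" using nv_bounds(1) by metis+
    show ?thesis
    proof (cases "z < 0")
      case True
      then show ?thesis
        using ripple_sub[OF B(2)] ripple_add[OF B(3)] B(1) v ge r(6,7,10,11)
        unfolding rx_def ry_def sb_def by auto
    next
      case False
      then show ?thesis
        using ripple_add[OF B(2)] ripple_sub[OF B(3)] B(1) v ge r(6,7,10,11)
        unfolding rx_def ry_def sb_def by auto
    qed
  qed
  have "(\<forall>i \<in> temps. sem (instruction 2) s i = [])" unfolding fin using r(2) by (auto simp: temps_def)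
  moreover have "sem (instruction 2) s 17 = [] \<longleftrightarrow> ok \<and> 0 \<le> \<sigma> + z \<and> 0 \<le> \<delta> - z"
    unfolding fin using ok r(3) by (auto simp: flag_of_def)
  moreover have "sem (instruction 2) s 3 = enc zs" "sem (instruction 2) s 13 = map sym (fst rx)"
    "sem (instruction 2) s 14 = map sym (fst ry)" unfolding fin by simp_all
  ultimately show ?thesis
    unfolding rel_def sim.simps case_prod_conv using len ok r(9-11) by auto
qed

lemma rel_rotate:
  assumes "rel n1 n2 s (z # zs, \<sigma>, \<delta>, ok)"
  shows "rel n1 n2 (sem (instruction 1) s) (sim False (z # zs, \<sigma>, \<delta>, ok))"
proof -
  have r: "s 3 = enc (z # zs)" "\<forall>i \<in> temps. s i = []" using assms unfolding rel_def by blast+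
  note e = temps_empty[OF r(2)]
  have 1: "sem (split False) s = s(3 := [], 5 := rev (enc zs), 7 := [1], 8 := rev (enc [z]))"
    by (rule sem_split_rotate, rule r(1)) (use e in simp)
  have "sem (instruction 1) s = sem (Pop 10) (sem (Pop 7) (sem (For 5 (\<lambda>a. Push 3 a)) (sem (For 9 (\<lambda>a. Push 5 a))
      (sem (For 8 (\<lambda>a. Push 9 a)) (s(3 := [], 5 := rev (enc zs), 7 := [1], 8 := rev (enc [z])))))))"
    by (simp add: instruction_def 1 del: sem.simps(1-3,5,6))
  also have "\<dots> = s(3 := enc zs @ enc [z])"
    using e by (simp add: sem_move fun_eq_iff del: sem.simps(6))
  finally have "sem (instruction 1) s = s(3 := enc (zs @ [z]))" by simp
  then show ?thesis using assms unfolding rel_def by (auto simp: temps_def)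
qed

text \<open>On an empty queue a consuming instruction adds and subtracts the empty digit list, which
  is 0 and produces neither carry nor borrow.\<close>

lemma rel_empty:
  assumes "rel n1 n2 s ([], \<sigma>, \<delta>, ok)" "b \<in> {1, 2}"
  shows "rel n1 n2 (sem (instruction b) s) ([], \<sigma>, \<delta>, ok)"
proof -
  obtain xs ys where r: "s 3 = []" "\<forall>i \<in> temps. s i = []"
    "s 13 = map sym xs" "s 14 = map sym ys" "length xs = n1" "length ys = n2" "ok \<longrightarrow> nv xs = \<sigma> \<and> nv ys = \<delta>"
    using assms(1) unfolding rel_def by auto
  note e = temps_empty[OF r(2)]
  have 1: "sem (split c) s = s" for c
    using r(1) by (simp add: split_def fun_upd_idem)
  show ?thesis
  proof (cases "b = 2")
    case False
    then have "sem (instruction b) s = s"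
      using e r(1) by (simp add: instruction_def 1 fun_upd_idem)
    then show ?thesis using assms(1) by simp
  next
    case True
    define rx where "rx = ripple False False [] xs"
    define ry where "ry = ripple True False [] ys"
    have "nv xs < 2 ^ length xs" "0 \<le> nv ys" by (rule nv_bounds)+
    then have f: "\<not> snd rx" "\<not> snd ry" "nv (fst rx) = nv xs" "nv (fst ry) = nv ys"
      using ripple_add[of "[]" xs] ripple_sub[of "[]" ys] unfolding rx_def ry_def by auto
    have len: "length (fst rx) = n1" "length (fst ry) = n2"
      by (simp_all add: rx_def ry_def length_ripple r)
    have 2: "sem (add_sub False 13 15 18 11) s = s(13 := map sym (fst rx))"
      unfolding rx_def by (subst sem_add_sub[where ys = xs and ds = "[]"])
        (use r e f(1) in \<open>auto simp: rx_def fun_eq_iff\<close>)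
    have 3: "sem (add_sub True 14 16 19 12) (s(13 := v)) = s(13 := v, 14 := map sym (fst ry))" for v
      unfolding ry_def by (subst sem_add_sub[where ys = ys and ds = "[]"])
        (use r e f(2) in \<open>auto simp: ry_def fun_eq_iff\<close>)
    have "s 10 = []" using e by simp
    then have "sem (instruction b) s = sem (Pop 10) (sem (Pop 7) (sem (For 5 (\<lambda>a. Push 3 a))
        (s(13 := map sym (fst rx), 14 := map sym (fst ry)))))"
      using True by (simp add: instruction_def 1 2 3 del: sem.simps(1-3,6))
    also have "\<dots> = s(13 := map sym (fst rx), 14 := map sym (fst ry))"
      using e r(1) by (simp add: sem_move fun_eq_iff del: sem.simps(6))
    finally have fin: "sem (instruction b) s = s(13 := map sym (fst rx), 14 := map sym (fst ry))" .
    show ?thesis using assms(1) r f len unfolding rel_def fin by (auto simp: temps_def)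
  qed
qed

lemma rel_fold:
  "rel n1 n2 s st \<Longrightarrow> rel n1 n2 (fold (\<lambda>a. sem (instruction a)) (map sym us) s) (fold sim us st)"
proof (induction us arbitrary: s st)
  case (Cons b us)
  obtain L \<sigma> \<delta> ok where st: "st = (L, \<sigma>, \<delta>, ok)" by (cases st)
  have "rel n1 n2 (sem (instruction (sym b)) s) (sim b st)"
  proof (cases L)
    case Nil
    then show ?thesis using rel_empty[of n1 n2 s \<sigma> \<delta> ok "sym b"] Cons.prems st by (simp add: sym_def)
  next
    case (Cons z zs)
    then show ?thesis using rel_consume[of n1 n2 s z zs] rel_rotate[of n1 n2 s z zs] \<open>rel n1 n2 s st\<close> st
      by (cases b) simp_all
  qed
  from Cons.IH[OF this] show ?case by simp
qed simp

lemma sem_decode: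
  assumes "s 3 = map sym w" "s 4 = []"
  shows "sem decode s = s(3 := [], 4 := snd (pairs w), 5 := rev (fst (pairs w)) @ s 5)"
proof -
  have "fold (\<lambda>a. sem (Case 4 (\<lambda>m. if m = 0 then Push 4 a else Pop 4 ;; Push 5 (min 4 (2 * m + a - 2))))) (map sym w) s =
      s(4 := snd (pairs w), 5 := rev (fst (pairs w)) @ s 5)" if "s 4 = []" for s
    using that
  proof (induction w arbitrary: s rule: pairs.induct)
    case (3 a b r)
    have "min 4 (2 * sym a + sym b - 2) = 2 * sym a + sym b - 2" by (simp add: sym_def)
    moreover have "sym c \<noteq> 0" for c by (simp add: sym_def)
    note this [simp]
    ultimately show ?case using "3.IH" "3.prems" by (simp add: fun_eq_iff)
  qed (auto simp: fun_eq_iff)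
  from this[of "s(3 := [])"] show ?thesis
    using assms by (simp add: decode_def fun_eq_iff)
qed

lemma sem_automaton:
  assumes "s 12 = []" "s 6 = [q]"
  shows "sem automaton s = s(6 := [foldl df q (s 3)])"
proof -
  have "fold (\<lambda>a. sem (Case 6 (\<lambda>s. Pop 6 ;; Push 6 (df s a)))) w s = s(6 := [foldl df q w])"
    if "s 6 = [q]" for w s q
    using that by (induction w arbitrary: s q) (auto simp: fun_eq_iff)
  then show ?thesis using assms by (simp add: automaton_def sem_Each)
qed

lemma sem_read_bound:
  assumes "s 3 = enc (int (bv 1 bs) # es)" "s 5 = []" "s 7 = []"
  shows "sem read_bound s = s(3 := enc es, 14 := map sym (rev (True # bs)) @ s 14)"
proof -
  define f where "f = (\<lambda>a. Case 7 (\<lambda>m. if m \<noteq> 0 then Push 5 a else if a = 4 then Push 7 1 else Push 14 a))"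
  have digits: "fold (\<lambda>a. sem (f a)) (map sym cs) s = s(14 := map sym (rev cs) @ s 14)" if "s 7 = []" for cs s
    using that by (induction cs arbitrary: s) (auto simp: f_def fun_eq_iff)
  have rest: "fold (\<lambda>a. sem (f a)) w s = s(5 := rev w @ s 5)" if "s 7 = [1]" for w s
    using that by (induction w arbitrary: s) (auto simp: f_def)
  have e: "s 3 = map sym (True # bs) @ 4 # enc es" using assms(1) by (simp add: int_chars_pos comp_def)
  have comma: "sem (f 4) s' = s'(7 := [1])" if "s' 7 = []" for s'
    using that by (simp add: f_def)
  have "sem (For 3 f) s = s(3 := [], 14 := map sym (rev (True # bs)) @ s 14, 7 := [1], 5 := rev (enc es))"
    unfolding sem.simps(6) e fold_append comp_apply fold_simps
    using assms by (subst digits; (subst comma)?; (subst rest)?) (simp_all add: fun_eq_iff)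
  then show ?thesis
    unfolding read_bound_def sem.simps(4) f_def[symmetric]
    using assms by (subst sem_move) (simp_all add: fun_eq_iff)
qed

lemma checks:
  assumes "s 2 = []"
  shows "peek (sem (For 13 (\<lambda>a. if a = 2 then Push 17 1 else Skip) ;; Case 3 (\<lambda>a. if a = 0 then Skip else Push 17 1) ;;
     Case 4 (\<lambda>a. if a = 0 then Skip else Push 17 1) ;; Case 6 (\<lambda>a. if a = 1 then Skip else Push 17 1) ;;
     Case 17 (\<lambda>a. if a = 0 then Push 2 1 else Skip)) s 2) = 1 \<longleftrightarrow>
     peek (s 17) = 0 \<and> 2 \<notin> set (s 13) \<and> peek (s 3) = 0 \<and> peek (s 4) = 0 \<and> peek (s 6) = 1"
proof -
  define k where "k = length (filter (\<lambda>a. a = 2) (s 13))"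
  have "fold (\<lambda>a. sem (if a = 2 then Push 17 1 else Skip)) xs s =
      s(17 := replicate (length (filter (\<lambda>a. a = 2) xs)) 1 @ s 17)" for xs :: "nat list" and s
    by (induction xs arbitrary: s) (auto simp: fun_eq_iff replicate_app_Cons_same)
  then have "sem (For 13 (\<lambda>a. if a = 2 then Push 17 1 else Skip)) s = s(13 := [], 17 := replicate k 1 @ s 17)"
    by (simp add: k_def)
  moreover have "k = 0 \<longleftrightarrow> 2 \<notin> set (s 13)" by (auto simp: k_def filter_empty_conv)
  ultimately show ?thesis using assms by (cases k) (auto simp del: sem.simps(6))
qed

lemma sem_preparation:
  "sem preparation (store_of [x, u]) =
   (\<lambda>_. [])(1 := rev (map sym u), 3 := fst (pairs x), 4 := snd (pairs x), 6 := [foldl df 6 (fst (pairs x))],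
     13 := replicate (length (fst (pairs x))) 1, 14 := replicate (length (fst (pairs x))) 1)"
proof -
  define s0 :: store where "s0 = (\<lambda>_. [])(1 := rev (map sym u))"
  have "store_of [x, u] = s0(0 := rev (map sym x))"
    by (auto simp: store_of_def s0_def fun_eq_iff bits_sym)
  then have 1: "sem (For 0 (\<lambda>a. Push 3 a)) (store_of [x, u]) = s0(3 := map sym x)"
    by (simp only: sem_move) (auto simp: s0_def fun_eq_iff)
  have 2: "sem decode (s0(3 := map sym x)) = s0(4 := snd (pairs x), 5 := rev (fst (pairs x)))"
    by (subst sem_decode[where w = x]) (auto simp: s0_def fun_eq_iff)
  have 3: "sem (For 5 (\<lambda>a. Push 3 a)) (s0(4 := snd (pairs x), 5 := rev (fst (pairs x)))) =
      s0(3 := fst (pairs x), 4 := snd (pairs x))"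
    by (subst sem_move) (auto simp: s0_def fun_eq_iff)
  show ?thesis
    unfolding preparation_def sem.simps(2,4) 1 2 3
    by (subst sem_automaton[where q = 6], simp add: s0_def, simp add: s0_def, subst sem_Each_const)
      (auto simp: s0_def sem_Push2_funpow fun_eq_iff)
qed

lemma rel_start:
  assumes "s = (\<lambda>_. [])(1 := rev (map sym u), 3 := ch, 4 := v, 6 := w, 13 := replicate (length ch) 1, 14 := replicate (length ch) 1)"
    and "ch = enc (C # es)" "C = int (bv 1 bs)"
  shows "rel (length ch) (length bs + 1 + length ch) (sem read_bound (s(1 := []))) (es, 0, C, True)"
proof -
  have len: "length (binary (nat \<bar>z\<bar>)) \<le> length (enc zs)" if "z \<in> set zs" for z zs
    using that
  proof (induction zs)
    case (Cons y zs)
    then show ?case unfolding enc_Cons by auto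
  qed simp
  have "length (rev bs @ [True]) = length bs + 1" by simp
  then have "int (bv 1 bs) < 2 ^ (length bs + 1)"
    using nv_bounds(2)[of "rev bs @ [True]"] unfolding nv_rev by (simp only:)
  moreover have "length bs + 1 \<le> length ch" unfolding assms(2,3) by (simp add: int_chars_pos)
  then have "(2 :: int) ^ (length bs + 1) \<le> 2 ^ length ch" "(2 :: int) ^ (length bs + 1) \<le> 2 ^ (length bs + 1 + length ch)"
    by (intro power_increasing; simp)+
  ultimately have C: "C < 2 ^ length ch" "C < 2 ^ (length bs + 1 + length ch)" unfolding assms(3) by linarith+
  have z: "length (binary (nat \<bar>z\<bar>)) \<le> length ch" if "z \<in> set es" for z
    using len[of z "C # es"] that assms(2) by simp
  have r: "replicate k 1 = map sym (replicate k False)" for k by simp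
  have fin: "sem read_bound (s(1 := [])) = (s(1 := []))(3 := enc es, 14 := map sym (rev (True # bs) @ replicate (length ch) False))"
    by (subst sem_read_bound[of _ bs es]) (use assms in simp_all)
  have "nv (rev (True # bs) @ replicate (length ch) False) = C"
    using nv_rev[of bs] by (simp add: nv_append nv_replicate assms(3))
  then show ?thesis
    unfolding rel_def fin case_prod_conv
    using z C assms(1)
    by (intro conjI exI[of _ "replicate (length ch) False"] exI[of _ "rev (True # bs) @ replicate (length ch) False"])
      (auto simp: temps_def nv_replicate le_SucI trans_le_add1 trans_le_add2)
qed

lemma fresh_instruction: "j \<in> {1, 2, 4, 6} \<Longrightarrow> fresh j (instruction b)"
  by (auto simp: instruction_def split_def split_step_def add_sub_def add_step_def)

lemma fresh_read_bound: "j \<in> {1, 2, 4, 6} \<Longrightarrow> fresh j read_bound"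
  by (auto simp: read_bound_def)

lemma df_bounds: "0 < df s a" "df s a < 8"
  by (auto simp: df_def)

lemma sym_less_8: "sym b < 8"
  by (simp add: sym_def)

lemma wfc_instruction: "wfc 20 8 (instruction b)"
  by (auto simp: instruction_def split_def split_step_def add_sub_def add_step_def sym_less_8)

text \<open>This excludes the symbol 0 from stack 17, so that reading 0 there means that no failure
  was recorded.\<close>

lemma wf_store_run: "wf_store 8 (sem (For 1 instruction) (sem read_bound (sem preparation (store_of ws))))"
proof -
  have "wfc 20 8 preparation" "wfc 20 8 read_bound" "wfc 20 8 (For 1 instruction)"
    by (auto simp: preparation_def decode_def automaton_def read_bound_def df_bounds wfc_instruction)
  then show ?thesis by (intro wf_store_sem[of 20 8] wf_store_of) simp_all
qed

text \<open>Stack 1 has the last bit of \<open>u\<close> on top, so the instructions are executed in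
  the order of \<open>rev u\<close>.\<close>

lemma verify_iff:
  "peek (sem verify (store_of [x, u]) 2) = 1 \<longleftrightarrow>
    (\<exists>C es \<delta>. x = encode_ints (C # es) \<and> 0 < C \<and> fold sim (rev u) (es, 0, C, True) = ([], 0, \<delta>, True))"
proof -
  define ch where "ch = fst (pairs x)"
  define s :: store where "s = (\<lambda>_. [])(1 := rev (map sym u), 3 := ch, 4 := snd (pairs x), 6 := [foldl df 6 ch],
     13 := replicate (length ch) 1, 14 := replicate (length ch) 1)"
  define t where "t = sem (For 1 instruction) (sem read_bound s)"
  have fr: "fresh j (For 1 instruction)" if "j \<in> {2, 4, 6}" for j
    using that fresh_instruction by auto
  have t: "t j = s j" if "j \<in> {2, 4, 6}" for j
    using sem_fresh_at[OF fr[OF that]] sem_fresh_at[of j read_bound s] fresh_read_bound[of j] that unfolding t_def by auto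
  have s2: "s 2 = []" "s 4 = snd (pairs x)" "s 6 = [foldl df 6 ch]" by (simp_all add: s_def)
  have accept: "peek (sem verify (store_of [x, u]) 2) = 1 \<longleftrightarrow>
      peek (t 17) = 0 \<and> 2 \<notin> set (t 13) \<and> peek (t 3) = 0 \<and> peek (snd (pairs x)) = 0 \<and> foldl df 6 ch = 1"
  proof -
    have "sem verify (store_of [x, u]) = sem (For 13 (\<lambda>a. if a = 2 then Push 17 1 else Skip) ;; Case 3 (\<lambda>a. if a = 0 then Skip else Push 17 1) ;;
     Case 4 (\<lambda>a. if a = 0 then Skip else Push 17 1) ;; Case 6 (\<lambda>a. if a = 1 then Skip else Push 17 1) ;;
     Case 17 (\<lambda>a. if a = 0 then Push 2 1 else Skip)) t"
      using sem_preparation[of x u] by (simp only: verify_def sem.simps(4) t_def s_def ch_def)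
    moreover have t': "t 2 = []" "t 4 = snd (pairs x)" "t 6 = [foldl df 6 ch]" using t s2 by simp_all
    ultimately show ?thesis using checks[of t, OF t'(1)] by (simp only: t' peek_simps)
  qed
  have par: "peek (snd (pairs x)) = 0 \<longleftrightarrow> snd (pairs x) = []"
    by (induction x rule: pairs.induct) auto
  have main: "peek (t 17) = 0 \<and> 2 \<notin> set (t 13) \<and> peek (t 3) = 0 \<longleftrightarrow> (\<exists>\<delta>. fold sim (rev u) (es, 0, C, True) = ([], 0, \<delta>, True))"
    if C: "ch = enc (C # es)" "C = int (bv 1 bs)" for C es bs
  proof -
    have "t = fold (\<lambda>a. sem (instruction a)) (rev (map sym u)) (sem read_bound (s(1 := [])))"
    proof -
      have "sem read_bound s 1 = rev (map sym u)"
        using sem_fresh_at[of 1 read_bound s] fresh_read_bound[of 1] by (simp add: s_def)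
      moreover have "sem read_bound (s(1 := [])) = (sem read_bound s)(1 := [])"
        using sem_fresh[of 1 read_bound s] fresh_read_bound[of 1] by simp
      ultimately show ?thesis by (simp add: t_def)
    qed
    then have r: "rel (length ch) (length bs + 1 + length ch) t (fold sim (rev u) (es, 0, C, True))"
      using rel_fold[OF rel_start[OF s_def C], of "rev u"] by (simp add: rev_map)
    obtain L \<sigma> \<delta> ok where f: "fold sim (rev u) (es, 0, C, True) = (L, \<sigma>, \<delta>, ok)" by (metis prod_cases4)
    obtain xs where q: "t 3 = enc L" "t 17 = [] \<longleftrightarrow> ok" "t 13 = map sym xs" "ok \<longrightarrow> nv xs = \<sigma>"
      using r unfolding f rel_def by blast
    have "peek (t 3) = 0 \<longleftrightarrow> L = []"
    proof (cases L)
      case (Cons z zs)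
      then have "t 3 = (if z < 0 then [3] else []) @ map sym (binary (nat \<bar>z\<bar>)) @ 4 # enc zs"
        using q(1) by (simp only: enc_Cons)
      then show ?thesis using Cons by (cases "binary (nat \<bar>z\<bar>)") (auto simp: sym_def)
    qed (simp add: q)
    moreover have "2 \<notin> set (t 13) \<longleftrightarrow> nv xs = 0" unfolding q(3) nv_eq_0 by (auto simp: sym_def)
    moreover have "wf_store 8 t"
      using wf_store_run[of "[x, u]"] by (simp only: t_def s_def ch_def sem_preparation)
    then have "peek (t 17) = 0 \<longleftrightarrow> t 17 = []"
      by (cases "t 17") (auto simp: wf_store_def dest!: spec[of _ 17])
    ultimately show ?thesis using q f by auto
  qed
  show ?thesis
  proof
    assume "peek (sem verify (store_of [x, u]) 2) = 1"
    then have a: "peek (t 17) = 0 \<and> 2 \<notin> set (t 13) \<and> peek (t 3) = 0" "snd (pairs x) = []" "foldl df 6 ch = 1"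
      using accept par by auto
    obtain bs es where e: "ch = enc (int (bv 1 bs) # es)" using a(3) df_accept by blast
    have "pairs x = (map cc (concat (map int_chars (int (bv 1 bs) # es))), [])"
      using a(2) e unfolding ch_def enc_def by (simp add: prod_eq_iff)
    then have "x = encode_ints (int (bv 1 bs) # es)" unfolding encode_ints_def by (rule char_codes_pairs)
    moreover have "0 < int (bv 1 bs)" using bv_ge[of 1 bs] by simp
    ultimately show "\<exists>C es \<delta>. x = encode_ints (C # es) \<and> 0 < C \<and> fold sim (rev u) (es, 0, C, True) = ([], 0, \<delta>, True)"
      using main[OF e refl] a(1) by blast
  next
    assume "\<exists>C es \<delta>. x = encode_ints (C # es) \<and> 0 < C \<and> fold sim (rev u) (es, 0, C, True) = ([], 0, \<delta>, True)"
    then obtain C es \<delta> where x: "x = encode_ints (C # es)" "0 < C"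
      "fold sim (rev u) (es, 0, C, True) = ([], 0, \<delta>, True)" by blast
    have p: "pairs x = (enc (C # es), [])"
      unfolding x(1) encode_ints_def enc_def by (rule pairs_char_codes)
    obtain bs where bs: "C = int (bv 1 bs)"
      using bv_binary[of "nat C"] x(2) by (metis int_nat_eq less_imp_le zero_less_nat_eq)
    have "ch = enc (C # es)" by (simp only: ch_def p fst_conv)
    moreover have "foldl df 6 ch = 1" using df_accept calculation bs by blast
    ultimately show "peek (sem verify (store_of [x, u]) 2) = 1"
      using main[of C es bs] bs x(3) accept p by auto
  qed
qed

lemma ptime_verify: "ptime 20 8 verify"
proof -
  have move: "ptime 20 8 (For i (\<lambda>a. Push j a))" if "i < 20" "j < 20" "i \<noteq> j" for i j
    by (rule ptime_tame[of "{i}" _ 0]) (use that in auto)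
  have basic: "ptime 20 8 (Push i a)" "ptime 20 8 (Pop i)" if "i < 20" "0 < a" "a < 8" for i a
    by (rule ptime_tame[of "{}" _ 0]; use that in auto)+
  have decode: "ptime 20 8 decode"
    by (rule ptime_tame[of "{3}" _ 0]) (auto simp: decode_def)
  have automaton: "ptime 20 8 automaton"
    by (rule ptime_tame[of "{3, 12}" _ 0]) (auto simp: automaton_def df_bounds)
  have each: "ptime 20 8 (Each 3 12 (\<lambda>_. Push 13 1 ;; Push 14 1))"
    by (rule ptime_tame[of "{3, 12}" _ 0]) auto
  have "ptime 20 8 (For 3 (\<lambda>a. Case 7 (\<lambda>m. if m \<noteq> 0 then Push 5 a else if a = 4 then Push 7 1 else Push 14 a)))"
    by (rule ptime_tame[of "{3}" _ 0]) auto
  then have bound: "ptime 20 8 read_bound"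
    unfolding read_bound_def by (intro ptime_Seq move basic[of _ 1]) auto
  \<comment> \<open>Stacks 18 and 19 stay outside: no loop runs over them, and every digit read from
    the queue is copied to both, which would exceed the credit.\<close>
  let ?K = "{1, 3, 5, 8, 9, 13, 14, 15, 16}"
  have "tame ?K (instruction b) 1" for b
    by (auto simp: instruction_def split_def split_step_def add_sub_def add_step_def)
  then have loop: "ptime 20 8 (For 1 instruction)"
    by (intro ptime_tame[of ?K _ 0]) (use fresh_instruction wfc_instruction in auto)
  have final: "ptime 20 8 (For 13 (\<lambda>a. if a = 2 then Push 17 1 else Skip))"
    by (rule ptime_tame[of "{13}" _ 0]) auto
  have "ptime 20 8 (Case i (\<lambda>a. if P a then Push j 1 else Skip))" "ptime 20 8 (Case i (\<lambda>a. if P a then Skip else Push j 1))"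
    if "i < 20" "j < 20" for i j P
    by (rule ptime_tame[of "{}" _ 0]; use that in auto)+
  then show ?thesis unfolding verify_def preparation_def
    by (intro ptime_Seq move basic decode automaton each bound loop final) auto
qed

theorem ConsComp_in_NP: "ConsComp \<in> NP"
proof (rule ptime_verifier[OF ptime_verify, of _ "[:0, 0, 1:]"])
  fix x
  show "x \<in> ConsComp \<longleftrightarrow> (\<exists>u. length u \<le> poly [:0, 0, 1:] (length x) \<and> peek (sem verify (store_of [x, u]) 2) = 1)"
  proof
    assume "x \<in> ConsComp"
    then obtain C es where x: "x = encode_ints (C # es)" "sum_list es = 0" "0 < C" "conscomp_solvable es C"
      unfolding ConsComp_def conscomp_instance_def by blast
    obtain es' where es: "mset es' = mset es" "walk C 0 es'"
      using x(4) unfolding conscomp_solvable_iff_walk by blast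
    have "sum_list es' = 0" using es(1) x(2) by (metis sum_mset_sum_list)
    then obtain us \<delta> where us: "length us \<le> length es * length es" "fold sim us (es, 0, C, True) = ([], 0, \<delta>, True)"
      using sim_complete[OF es(1), of 0 C] es(2) by auto
    have "length es \<le> length (concat (map int_chars es))"
      by (induction es) (auto simp: int_chars_def)
    also have "length cs \<le> length (concat (map char_code cs))" for cs
    proof (induction cs)
      case (Cons c cs)
      then show ?case by (cases c) auto
    qed simp
    finally have "length es \<le> length (concat (map char_code (concat (map int_chars es))))" .
    also have "\<dots> \<le> length x" by (simp add: x(1) encode_ints_def)
    finally have "length es * length es \<le> length x * length x" by (intro mult_le_mono)
    then have "length (rev us) \<le> poly [:0, 0, 1:] (length x)" using us(1) by simp
    moreover have "peek (sem verify (store_of [x, rev us]) 2) = 1"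
      unfolding verify_iff using x us(2) by auto
    ultimately show "\<exists>u. length u \<le> poly [:0, 0, 1:] (length x) \<and> peek (sem verify (store_of [x, u]) 2) = 1"
      by blast
  next
    assume "\<exists>u. length u \<le> poly [:0, 0, 1:] (length x) \<and> peek (sem verify (store_of [x, u]) 2) = 1"
    then obtain u C es \<delta> where u: "x = encode_ints (C # es)" "0 < C" "fold sim (rev u) (es, 0, C, True) = ([], 0, \<delta>, True)"
      unfolding verify_iff by blast
    from sim_sound[OF u(3)] obtain es' where es: "mset es' = mset es" "walk C 0 es'" "sum_list es' = 0" by auto
    then have "sum_list es = 0" by (metis sum_mset_sum_list)
    then show "x \<in> ConsComp"
      unfolding u(1) encode_ints_in_ConsComp conscomp_instance_def conscomp_solvable_iff_walk
      using u(2) es by blast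
  qed
qed auto

theorem theorem3p1: "NP_complete ConsComp"
  unfolding NP_complete_def using ConsComp_in_NP NP_hard by blast

end
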